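(* Let $n,k$ be integers with $1\le k<n-1$. There exist random complexes $\mathcal{T}_{n,k}\sim\nu_{n,k}$, $\mathcal{T}_{n-1,k}\sim\nu_{n-1,k}$, $\mathcal{T}_{n-1,k-1}\sim\nu_{n-1,k-1}$, $\mathcal{Y}_{n-1,k}\sim\mu_{n-1,k}$ and $\mathcal{Y}_{n-1,k-1}\sim\mu_{n-1,k-1}$, defined on a common probability space, such that: $\mathcal{T}_{n-1,k}$ is independent of $\mathcal{Y}_{n-1,k}$; $\mathcal{T}_{n-1,k-1}$ is independent of $\mathcal{Y}_{n-1,k-1}$; $\mathcal{T}_{n-1,k}$ and $\mathcal{T}_{n-1,k-1}$ are conditionally independent given $\mathcal{T}_{n,k}$; and almost surely $$\mathcal{T}_{n,k}=\operatorname{Cone}\big(n,\mathcal{T}_{n-1,k-1}\cup\mathcal{Y}_{n-1,k-1}\big)\cup\big(\mathcal{T}_{n-1,k}\setminus\mathcal{Y}_{n-1,k}\big).$$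
   Context: For $m\ge1$, a $j$-face on $[m]=\{1,\dots,m\}$ is a subset of size $j+1$; a simplicial complex on $[m]$ is a nonempty family of subsets of $[m]$ closed under taking subsets (so it contains $\emptyset$). $X_j$ denotes the set of $j$-faces of $X$, and $K_m^k$ is the family of all subsets of $[m]$ of size at most $k+1$. $\mathscr{C}_{m,k}$ is the set of simplicial complexes $X$ on $[m]$ with $K_m^{k-1}\subseteq X\subseteq K_m^k$. Reduced homology $\tilde H_j(X)$ (integer coefficients) is the homology of the chain complex with chain groups $\mathbb{Z}^{X_j}$, $j\ge -1$ (where $X_{-1}=\{\emptyset\}$), and the usual oriented boundary maps (faces oriented by the increasing order on $[m]$); $\beta_j(X)$ is the rank of $\tilde H_j(X)$. $\mathscr{T}_{m,k}$ (the $k$-dimensional hypertrees on $[m]$) is the set of $X\in\mathscr{C}_{m,k}$ with $\beta_k(X)=\beta_{k-1}(X)=0$ and $|X_k|=\binom{m-1}{k}$; for these $\tilde H_{k-1}(X)$ is finite, and $\nu_{m,k}(T):=|\tilde H_{k-1}(T)|^2/m^{\binom{m-2}{k}}$ defines a probability measure on $\mathscr{T}_{m,k}$. $\mu_{m,k}$ is the law of the Linial–Meshulam complex $\mathcal{Y}_k(m,1/(m+1))$: the random element of $\mathscr{C}_{m,k}$ in which each $k$-face of $[m]$ is included independently with probability $1/(m+1)$. Complexes on $[n-1]$ are regarded as complexes on $[n]$. For complexes in $\mathscr{C}_{m,j}$, union and set difference are taken on the $j$-dimensional faces, the full $(j-1)$-skeleton $K_m^{j-1}$ being kept. For a complex $\Delta$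 on $[n-1]$, $\operatorname{Cone}(n,\Delta):=\Delta\cup\{\sigma\cup\{n\}:\sigma\in\Delta\}$. *)

theory Defs
  imports "HOL-Probability.Probability" "HOL-Algebra.Free_Abelian_Groups"
begin

section \<open>Simplicial complexes on \<open>{1..m}\<close>\<close>

definition is_simplicial_complex :: "nat \<Rightarrow> nat set set \<Rightarrow> bool" where
  "is_simplicial_complex m X \<longleftrightarrow>
     X \<noteq> {} \<and> X \<subseteq> Pow {1..m} \<and> (\<forall>\<sigma>\<in>X. \<forall>\<tau>. \<tau> \<subseteq> \<sigma> \<longrightarrow> \<tau> \<in> X)"

text \<open>Dimensions are integers, because the empty face has dimension \<open>-1\<close> and the boundary maps
  also refer to dimension \<open>-2\<close>, in which there are no faces.\<close>

definition faces :: "nat set set \<Rightarrow> int \<Rightarrow> nat set set" where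
  "faces X j = {\<sigma> \<in> X. finite \<sigma> \<and> int (card \<sigma>) = j + 1}"

definition full_skeleton :: "nat \<Rightarrow> int \<Rightarrow> nat set set" where
  "full_skeleton m k = {\<sigma>. \<sigma> \<subseteq> {1..m} \<and> int (card \<sigma>) \<le> k + 1}"

definition complexes :: "nat \<Rightarrow> nat \<Rightarrow> nat set set set" where
  "complexes m k =
     {X. is_simplicial_complex m X \<and>
         full_skeleton m (int k - 1) \<subseteq> X \<and> X \<subseteq> full_skeleton m (int k)}"

text \<open>The difference of two members of \<open>complexes m j\<close> is taken on the \<open>j\<close>-faces and keeps the
  full \<open>(j - 1)\<close>-skeleton. The corresponding convention for unions gives the ordinary
  set-theoretic union, so no separate operation is introduced for it.\<close>

definition complex_diff :: "nat \<Rightarrow> nat \<Rightarrow> nat set set \<Rightarrow> nat set set \<Rightarrow> nat set set" where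
  "complex_diff m j A B = full_skeleton m (int j - 1) \<union> (faces A (int j) - faces B (int j))"

definition Cone :: "nat \<Rightarrow> nat set set \<Rightarrow> nat set set" where
  "Cone n \<Delta> = \<Delta> \<union> {\<sigma> \<union> {n} | \<sigma>. \<sigma> \<in> \<Delta>}"


section \<open>Reduced integral homology\<close>

abbreviation chain_group :: "nat set set \<Rightarrow> int \<Rightarrow> (nat set \<Rightarrow>\<^sub>0 int) monoid" where
  "chain_group X j \<equiv> free_Abelian_group (faces X j)"

definition face_boundary :: "nat set \<Rightarrow> (nat set \<Rightarrow>\<^sub>0 int)" where
  "face_boundary \<sigma> =
     (\<Sum>i<card \<sigma>. frag_cmul ((-1) ^ i) (frag_of (\<sigma> - {sorted_list_of_set \<sigma> ! i})))"

abbreviation boundary_map :: "(nat set \<Rightarrow>\<^sub>0 int) \<Rightarrow> (nat set \<Rightarrow>\<^sub>0 int)" where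
  "boundary_map \<equiv> frag_extend face_boundary"

definition cycles :: "nat set set \<Rightarrow> int \<Rightarrow> (nat set \<Rightarrow>\<^sub>0 int) set" where
  "cycles X j = kernel (chain_group X j) (chain_group X (j - 1)) boundary_map"

definition boundaries :: "nat set set \<Rightarrow> int \<Rightarrow> (nat set \<Rightarrow>\<^sub>0 int) set" where
  "boundaries X j = boundary_map ` carrier (chain_group X (j + 1))"

definition reduced_homology :: "nat set set \<Rightarrow> int \<Rightarrow> (nat set \<Rightarrow>\<^sub>0 int) set monoid" where
  "reduced_homology X j = subgroup_generated (chain_group X j) (cycles X j) Mod boundaries X j"

text \<open>The rank of an abelian group is the largest size of a \<open>\<int>\<close>-linearly independent set.\<close>

definition int_independent :: "('a, 'b) monoid_scheme \<Rightarrow> 'a set \<Rightarrow> bool" where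
  "int_independent G S \<longleftrightarrow> finite S \<and> S \<subseteq> carrier G \<and>
     (\<forall>c :: 'a \<Rightarrow> int. finprod G (\<lambda>s. s [^]\<^bsub>G\<^esub> c s) S = \<one>\<^bsub>G\<^esub> \<longrightarrow> (\<forall>s\<in>S. c s = 0))"

definition abelian_rank :: "('a, 'b) monoid_scheme \<Rightarrow> enat" where
  "abelian_rank G = (SUP S \<in> {S. int_independent G S}. enat (card S))"

definition betti :: "int \<Rightarrow> nat set set \<Rightarrow> enat" where
  "betti j X = abelian_rank (reduced_homology X j)"


section \<open>Hypertrees and the two families of laws\<close>

definition hypertrees :: "nat \<Rightarrow> nat \<Rightarrow> nat set set set" where
  "hypertrees m k =
     {X \<in> complexes m k. betti (int k) X = 0 \<and> betti (int k - 1) X = 0 \<and>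
        card (faces X (int k)) = (m - 1) choose k}"

text \<open>Meant for \<open>m \<ge> 2\<close>, where the subtraction \<open>m - 2\<close> does not truncate. The measure is given by
  its point masses, so that its total mass being one is not part of the definition.\<close>

definition hypertree_measure :: "nat \<Rightarrow> nat \<Rightarrow> nat set set measure" where
  "hypertree_measure m k =
     point_measure (hypertrees m k)
       (\<lambda>T. ennreal ((real (card (carrier (reduced_homology T (int k - 1)))))\<^sup>2
                     / real m ^ ((m - 2) choose k)))"

definition linial_meshulam :: "nat \<Rightarrow> nat \<Rightarrow> real \<Rightarrow> nat set set pmf" where
  "linial_meshulam m k p =
     (let F = faces (Pow {1..m}) (int k) in
        map_pmf (\<lambda>\<omega>. full_skeleton m (int k - 1) \<union> {\<sigma> \<in> F. \<omega> \<sigma>})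
          (Pi_pmf F False (\<lambda>_. bernoulli_pmf p)))"

definition linial_meshulam_measure :: "nat \<Rightarrow> nat \<Rightarrow> nat set set measure" where
  "linial_meshulam_measure m k = measure_pmf (linial_meshulam m k (1 / real (m + 1)))"


section \<open>Probabilistic notions\<close>

definition has_law :: "'w measure \<Rightarrow> ('w \<Rightarrow> 'a) \<Rightarrow> 'a measure \<Rightarrow> bool" where
  "has_law M X \<mu> \<longleftrightarrow> X \<in> M \<rightarrow>\<^sub>M \<mu> \<and> distr M \<mu> X = \<mu>"

text \<open>Elementary conditional independence of \<open>X\<close> and \<open>Y\<close> given \<open>Z\<close>, for \<open>Z\<close> a discrete random
  variable.\<close>

definition cond_indep_given ::
  "'w measure \<Rightarrow> 'a measure \<Rightarrow> ('w \<Rightarrow> 'a) \<Rightarrow> 'b measure \<Rightarrow> ('w \<Rightarrow> 'b) \<Rightarrow> ('w \<Rightarrow> 'c) \<Rightarrow> bool" where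
  "cond_indep_given M N X L Y Z \<longleftrightarrow>
     (\<forall>z. \<P>(\<omega> in M. Z \<omega> = z) > 0 \<longrightarrow>
       (\<forall>A\<in>sets N. \<forall>B\<in>sets L.
          \<P>(\<omega> in M. X \<omega> \<in> A \<and> Y \<omega> \<in> B \<bar> Z \<omega> = z) =
          \<P>(\<omega> in M. X \<omega> \<in> A \<bar> Z \<omega> = z) * \<P>(\<omega> in M. Y \<omega> \<in> B \<bar> Z \<omega> = z)))"

text \<open>An existential statement has to name the type of the underlying set of the probability space.
  Quintuples of complexes lose no generality: every coupling of five random complexes can be
  realised on them by passing to the joint law.\<close>

type_synonym sample =
  "nat set set \<times> nat set set \<times> nat set set \<times> nat set set \<times> nat set set"

end

theory Submission
  imports Defs "HOL-Algebra.Multiplicative_Group"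
begin

text \<open>The weight \<open>|H\<^sub>k\<^sub>-\<^sub>1(T)|\<^sup>2\<close> is the square of a minor of the boundary matrix, because a sublattice of
  \<open>\<int>\<^sup>r\<close> has index the absolute value of its determinant. It is therefore a principal minor of the
  skew-symmetric matrix \<open>dirac\<close> of signed incidences, on the set \<open>R \<union> T\<close> with \<open>R\<close> the \<open>(k - 1)\<close>-faces avoiding
  the last vertex. Sums of such minors over \<open>T\<close> are determinants of \<open>dirac\<close> plus a diagonal projection,
  and they are evaluated from one explicit inverse, obtained from the identity
  \<open>\<partial>\<partial>\<^sup>* + \<partial>\<^sup>*\<partial> = m\<close> on the full simplex: with \<open>G = \<partial>\<^sup>*\<partial>\<close>, the probability that \<open>T\<close> contains \<open>B\<close> is
  \<open>det (G / m)\<^sub>B\<close>, and the probability that \<open>T\<close> avoids \<open>C\<close> is \<open>det (1 - G / m)\<^sub>C\<close>.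

  Splitting the faces on \<open>n = m + 1\<close> vertices by whether they contain \<open>n\<close>, the weight of \<open>Cone n A \<union> B\<close>
  becomes the minor of \<open>dirac\<close> on the \<open>(k - 1)\<close>-faces outside \<open>A\<close> and the \<open>k\<close>-faces in \<open>B\<close>. Summing over
  \<open>A\<close> gives \<open>det G\<^sub>B\<close> and summing over \<open>B\<close> gives \<open>det (m - G)\<close> on the complement of \<open>A\<close>; these are the laws of
  the thinned tree \<open>T \<setminus> Y\<close> and of the thickened tree \<open>T \<union> Y\<close> in dimensions \<open>k\<close> and \<open>k - 1\<close>. The coupling
  draws \<open>T\<^sub>n\<^sub>,\<^sub>k\<close> first and then, independently given \<open>T\<^sub>n\<^sub>,\<^sub>k\<close>, each of the two pairs conditioned on its fibre.\<close>

section \<open>Determinants over finite index sets\<close>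

text \<open>The parameter \<open>1/(m+1)\<close> comes from the powers of m. All trees of a given
  dimension on m vertices have the same number of faces, so with q = 1/(m+1) the chance q^(|T|-|B|)
  (1-q)^|B| that thinning reduces T to B is m^|B| up to a constant. This factor cancels the division
  by m in the inclusion probability det (G/m)_B and leaves the integral minor det G_B.

  The obstacle is that the weight of a pair (A, B) does not split into a factor for the link and a
  factor for the deletion. Each marginal is nevertheless a single determinant: summing over one of
  the two sets puts an identity block on the diagonal, and the Schur complement of that block is
  \<partial>^T \<partial> or \<partial> \<partial>^T. Only these two marginals have to be matched.
  The dependence between link and deletion is carried by the large tree itself, which is why
  conditional independence can be prescribed.

  Determinants are indexed by the faces themselves, so that minors, complements and unions of index
  sets need no enumeration.\<close>

definition sdet :: "'a set \<Rightarrow> ('a \<Rightarrow> 'a \<Rightarrow> 'b::comm_ring_1) \<Rightarrow> 'b" where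
  "sdet S A = (\<Sum>p | p permutes S. of_int (sign p) * (\<Prod>i\<in>S. A i (p i)))"

lemma sdet_cong:
  assumes "\<And>i j. i \<in> S \<Longrightarrow> j \<in> S \<Longrightarrow> A i j = B i j"
  shows "sdet S A = sdet S B"
  unfolding sdet_def
proof (intro sum.cong refl arg_cong2[where f = "(*)"] prod.cong)
  fix p i assume "p \<in> {p. p permutes S}" "i \<in> S"
  then show "A i (p i) = B i (p i)"
    using assms by (simp add: permutes_in_image)
qed

lemma sdet_empty [simp]: "sdet {} A = 1"
  by (simp add: sdet_def)

lemma sdet_of_int: "sdet S (\<lambda>i j. of_int (A i j)) = of_int (sdet S A)"
  by (simp add: sdet_def)

lemma sdet_scale:
  assumes "finite S"
  shows "sdet S (\<lambda>i j. c * A i j) = c ^ card S * sdet S A"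
  by (simp add: sdet_def prod.distrib sum_distrib_left mult_ac)

lemma sdet_transpose:
  assumes "finite S"
  shows "sdet S (\<lambda>i j. A j i) = sdet S A"
proof -
  have "sdet S (\<lambda>i j. A j i) = (\<Sum>p | p permutes S. of_int (sign (inv_into UNIV p)) * (\<Prod>i\<in>S. A (inv_into UNIV p i) i))"
    unfolding sdet_def by (rule sum_permutations_inverse)
  also have "\<dots> = sdet S A"
    unfolding sdet_def
  proof (intro sum.cong refl arg_cong2[where f = "(*)"])
    fix p assume "p \<in> {p. p permutes S}"
    then have p: "p permutes S" by simp
    show "of_int (sign (inv_into UNIV p)) = (of_int (sign p) :: 'b)"
      using sign_inverse permutes_imp_permutation[OF assms p] by metis
    show "(\<Prod>i\<in>S. A (inv_into UNIV p i) i) = (\<Prod>i\<in>S. A i (p i))"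
      by (rule prod.reindex_bij_witness[where i = p and j = "inv_into UNIV p"])
        (use p in \<open>auto simp: permutes_inverses permutes_in_image permutes_in_image[OF permutes_inv[OF p]]\<close>)
  qed
  finally show ?thesis .
qed

lemma permutes_fixing_iff:
  assumes "\<And>x. x \<in> S - U \<Longrightarrow> p x = x" "U \<subseteq> S"
  shows "p permutes S \<longleftrightarrow> p permutes U"
  using assms permutes_superset[of p S U] permutes_subset[of p U S] by blast

text \<open>A permutation that moves a row outside \<open>U\<close> meets a zero entry, so only the
  permutations of \<open>U\<close> survive. It is applied in both directions, to cut an index set
  down and to enlarge it.\<close>

lemma sdet_identity_rows:
  assumes "finite S" "U \<subseteq> S"
    and id: "\<And>i j. i \<in> S - U \<Longrightarrow> j \<in> S \<Longrightarrow> A i j = (if i = j then 1 else 0)"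
  shows "sdet S A = sdet U A"
proof -
  have fU: "finite U" using assms finite_subset by blast
  have "sdet S A = (\<Sum>p | p permutes U. of_int (sign p) * (\<Prod>i\<in>S. A i (p i)))"
    unfolding sdet_def
  proof (rule sum.mono_neutral_right)
    show "finite {p. p permutes S}" using assms(1) by (rule finite_permutations)
    show "{p. p permutes U} \<subseteq> {p. p permutes S}" using assms(2) permutes_subset by blast
    show "\<forall>p\<in>{p. p permutes S} - {p. p permutes U}. of_int (sign p) * (\<Prod>i\<in>S. A i (p i)) = 0"
    proof
      fix p assume p: "p \<in> {p. p permutes S} - {p. p permutes U}"
      then obtain x where x: "x \<in> S - U" "p x \<noteq> x"
        using permutes_fixing_iff[of S U p] assms(2) by auto
      then have "A x (p x) = 0" using id[of x "p x"] p by (auto simp: permutes_in_image)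
      then have "(\<Prod>i\<in>S. A i (p i)) = 0"
        using x assms(1) by (intro prod_zero) auto
      then show "of_int (sign p) * (\<Prod>i\<in>S. A i (p i)) = 0" by simp
    qed
  qed
  also have "\<dots> = sdet U A"
    unfolding sdet_def
  proof (intro sum.cong refl arg_cong2[where f = "(*)"])
    fix p assume "p \<in> {p. p permutes U}"
    then have "\<forall>i\<in>S-U. A i (p i) = 1" using id assms(2) by (auto simp: permutes_def)
    then show "(\<Prod>i\<in>S. A i (p i)) = (\<Prod>i\<in>U. A i (p i))"
      by (intro prod.mono_neutral_right) (use assms in auto)
  qed
  finally show ?thesis .
qed

lemma sdet_identity_columns:
  assumes "finite S" "U \<subseteq> S"
    and "\<And>i j. i \<in> S \<Longrightarrow> j \<in> S - U \<Longrightarrow> A i j = (if i = j then 1 else 0)"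
  shows "sdet S A = sdet U A"
proof -
  have "sdet S (\<lambda>i j. A j i) = sdet U (\<lambda>i j. A j i)"
    using assms by (intro sdet_identity_rows) auto
  then show ?thesis using sdet_transpose assms finite_subset by metis
qed

lemma sdet_identity: "finite S \<Longrightarrow> sdet S (\<lambda>i j. if i = j then 1 else 0) = 1"
  by (subst sdet_identity_rows[of S "{}"]) auto

text \<open>Composition with the transposition of the two rows gives det = - det, and an ordered
  ring has no 2-torsion.\<close>

lemma sdet_equal_rows:
  fixes A :: "'a \<Rightarrow> 'a \<Rightarrow> 'b::linordered_idom"
  assumes "finite S" "a \<in> S" "b \<in> S" "a \<noteq> b" "\<And>j. A a j = A b j"
  shows "sdet S A = 0"
proof -
  let ?t = "Transposition.transpose a b"
  have t: "?t permutes S" using assms by (intro permutes_swap_id) auto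
  have "sdet S A = (\<Sum>p | p permutes S. of_int (sign (p \<circ> ?t)) * (\<Prod>i\<in>S. A i ((p \<circ> ?t) i)))"
    unfolding sdet_def by (rule sum_permutations_compose_right[OF t])
  also have "\<dots> = (\<Sum>p | p permutes S. - (of_int (sign p) * (\<Prod>i\<in>S. A i (p i))))"
  proof (intro sum.cong refl)
    fix p assume "p \<in> {p. p permutes S}"
    then have p: "p permutes S" by simp
    have "sign (p \<circ> ?t) = - sign p"
      using assms permutes_imp_permutation[OF assms(1) p]
      by (simp add: sign_compose permutation_swap_id sign_swap_id)
    moreover have "(\<Prod>i\<in>S. A i ((p \<circ> ?t) i)) = (\<Prod>i\<in>S. A i (p i))"
    proof (rule prod.reindex_bij_witness[where i = ?t and j = ?t])
      fix i assume "i \<in> S"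
      show "A (?t i) (p (?t i)) = A i ((p \<circ> ?t) i)"
        using assms(5) by (auto simp: Transposition.transpose_def)
    qed (use t in \<open>auto simp: permutes_in_image\<close>)
    ultimately show "of_int (sign (p \<circ> ?t)) * (\<Prod>i\<in>S. A i ((p \<circ> ?t) i)) =
        - (of_int (sign p) * (\<Prod>i\<in>S. A i (p i)))" by simp
  qed
  also have "\<dots> = - sdet S A" by (simp add: sdet_def sum_negf)
  finally show ?thesis by simp
qed

lemma sdet_permute_rows:
  assumes "finite S" "q permutes S"
  shows "sdet S (\<lambda>i. A (q i)) = of_int (sign q) * sdet S A"
proof -
  have "sdet S (\<lambda>i. A (q i)) = (\<Sum>p | p permutes S. of_int (sign (p \<circ> q)) * (\<Prod>i\<in>S. A (q i) ((p \<circ> q) i)))"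
    unfolding sdet_def by (rule sum_permutations_compose_right[OF assms(2)])
  also have "\<dots> = (\<Sum>p | p permutes S. of_int (sign q) * (of_int (sign p) * (\<Prod>i\<in>S. A i (p i))))"
  proof (intro sum.cong refl)
    fix p assume "p \<in> {p. p permutes S}"
    then have p: "p permutes S" by simp
    have "sign (p \<circ> q) = sign p * sign q"
      using assms p by (intro sign_compose permutes_imp_permutation)
    moreover have "(\<Prod>i\<in>S. A (q i) ((p \<circ> q) i)) = (\<Prod>i\<in>S. A i (p i))"
      using prod.permute[OF assms(2), of "\<lambda>i. A i (p i)"] by (simp add: comp_def)
    ultimately show "of_int (sign (p \<circ> q)) * (\<Prod>i\<in>S. A (q i) ((p \<circ> q) i)) =
        of_int (sign q) * (of_int (sign p) * (\<Prod>i\<in>S. A i (p i)))" by simp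
  qed
  finally show ?thesis by (simp add: sdet_def sum_distrib_left)
qed

text \<open>Expanding every row sum gives a sum over all maps \<open>g\<close> from \<open>S\<close>
  to \<open>S\<close>. A non-injective \<open>g\<close> repeats a row of \<open>B\<close>; the
  injective ones are the permutations and contribute their sign.\<close>

lemma sdet_mult:
  fixes A B :: "'a \<Rightarrow> 'a \<Rightarrow> 'b::linordered_idom"
  assumes "finite S"
  shows "sdet S (\<lambda>i j. \<Sum>k\<in>S. A i k * B k j) = sdet S A * sdet S B"
proof -
  let ?P = "{p. p permutes S}"
  let ?g = "\<lambda>p. restrict p S"
  have fP: "finite ?P" using assms by (rule finite_permutations)
  have "sdet S (\<lambda>i j. \<Sum>k\<in>S. A i k * B k j) =
      (\<Sum>p\<in>?P. of_int (sign p) * (\<Sum>g\<in>S \<rightarrow>\<^sub>E S. \<Prod>i\<in>S. A i (g i) * B (g i) (p i)))"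
    unfolding sdet_def using assms by (intro sum.cong refl arg_cong2[where f = "(*)"] prod_sum_PiE)
  also have "\<dots> = (\<Sum>g\<in>S \<rightarrow>\<^sub>E S. (\<Prod>i\<in>S. A i (g i)) * sdet S (\<lambda>i. B (g i)))"
    unfolding sdet_def sum_distrib_left by (subst sum.swap) (simp add: prod.distrib mult_ac)
  also have "\<dots> = (\<Sum>g\<in>?g ` ?P. (\<Prod>i\<in>S. A i (g i)) * sdet S (\<lambda>i. B (g i)))"
  proof (rule sum.mono_neutral_right)
    show "finite (S \<rightarrow>\<^sub>E S)" using assms by (intro finite_PiE) auto
    show "?g ` ?P \<subseteq> S \<rightarrow>\<^sub>E S" by (auto simp: permutes_in_image)
    show "\<forall>g\<in>(S \<rightarrow>\<^sub>E S) - ?g ` ?P. (\<Prod>i\<in>S. A i (g i)) * sdet S (\<lambda>i. B (g i)) = 0"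
    proof
      fix g assume g: "g \<in> (S \<rightarrow>\<^sub>E S) - ?g ` ?P"
      have "\<not> inj_on g S"
      proof
        assume inj: "inj_on g S"
        let ?p = "\<lambda>x. if x \<in> S then g x else x"
        have "?p permutes S"
        proof (rule inj_imp_permutes)
          show "inj_on ?p S" using inj by (simp add: inj_on_def)
        qed (use g assms in auto)
        moreover have "g = ?g ?p" using g by (auto simp: PiE_def extensional_def restrict_def)
        ultimately show False using g by blast
      qed
      then obtain a b where "a \<in> S" "b \<in> S" "a \<noteq> b" "g a = g b" by (auto simp: inj_on_def)
      then have "sdet S (\<lambda>i. B (g i)) = 0" by (intro sdet_equal_rows[of S a b]) (use assms in auto)
      then show "(\<Prod>i\<in>S. A i (g i)) * sdet S (\<lambda>i. B (g i)) = 0" by simp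
    qed
  qed
  also have "\<dots> = (\<Sum>p\<in>?P. (\<Prod>i\<in>S. A i (?g p i)) * sdet S (\<lambda>i. B (?g p i)))"
  proof (subst sum.reindex)
    show "inj_on ?g ?P"
    proof (rule inj_onI, rule ext)
      fix p q x assume "p \<in> ?P" "q \<in> ?P" "?g p = ?g q"
      then show "p x = q x" by (cases "x \<in> S") (auto dest: fun_cong[where x = x] simp: permutes_def)
    qed
  qed simp
  also have "\<dots> = (\<Sum>p\<in>?P. of_int (sign p) * (\<Prod>i\<in>S. A i (p i)) * sdet S B)"
  proof (intro sum.cong refl)
    fix p assume "p \<in> ?P"
    then have p: "p permutes S" by simp
    have "sdet S (\<lambda>i. B (?g p i)) = sdet S (\<lambda>i. B (p i))" by (rule sdet_cong) simp
    then show "(\<Prod>i\<in>S. A i (?g p i)) * sdet S (\<lambda>i. B (?g p i)) =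
        of_int (sign p) * (\<Prod>i\<in>S. A i (p i)) * sdet S B"
      using sdet_permute_rows[OF assms p, of B] by simp
  qed
  also have "\<dots> = sdet S A * sdet S B" by (simp add: sdet_def sum_distrib_right)
  finally show ?thesis .
qed

text \<open>The determinant is affine in a diagonal entry, and the permutations fixing
  \<open>x\<close> make the complementary minor its coefficient.\<close>

lemma sdet_add_diag:
  assumes "finite S" "x \<in> S"
  shows "sdet S (\<lambda>i j. A i j + (if i = j \<and> i = x then 1 else 0)) = sdet S A + sdet (S - {x}) A"
proof -
  let ?P = "{p. p permutes S}" and ?Q = "{p. p permutes (S - {x})}"
  have fP: "finite ?P" using assms by (intro finite_permutations)
  have sub: "?Q \<subseteq> ?P" using permutes_subset by blast
  have Q: "?Q = {p \<in> ?P. p x = x}"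
    using permutes_fixing_iff[of S "S - {x}"] assms(2) sub by (auto simp: permutes_def)
  have "sdet S (\<lambda>i j. A i j + (if i = j \<and> i = x then 1 else 0)) =
     (\<Sum>p\<in>?P. of_int (sign p) * (\<Prod>i\<in>S. A i (p i)) +
        (if p x = x then of_int (sign p) * (\<Prod>i\<in>S-{x}. A i (p i)) else 0))"
    unfolding sdet_def
  proof (intro sum.cong refl)
    fix p assume p: "p \<in> ?P"
    have eq: "(\<Prod>i\<in>S-{x}. A i (p i) + (if i = p i \<and> i = x then 1 else 0)) = (\<Prod>i\<in>S-{x}. A i (p i))"
      by (intro prod.cong) auto
    show "of_int (sign p) * (\<Prod>i\<in>S. A i (p i) + (if i = p i \<and> i = x then 1 else 0)) =
       of_int (sign p) * (\<Prod>i\<in>S. A i (p i)) +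
        (if p x = x then of_int (sign p) * (\<Prod>i\<in>S-{x}. A i (p i)) else 0)"
      unfolding prod.remove[OF assms] eq by (auto simp: algebra_simps)
  qed
  also have "\<dots> = sdet S A + (\<Sum>p\<in>?P. if p x = x then of_int (sign p) * (\<Prod>i\<in>S-{x}. A i (p i)) else 0)"
    by (simp add: sum.distrib sdet_def)
  also have "(\<Sum>p\<in>?P. if p x = x then of_int (sign p) * (\<Prod>i\<in>S-{x}. A i (p i)) else 0) = sdet (S - {x}) A"
    unfolding sdet_def Q by (rule sum.inter_filter[OF fP, symmetric])
  finally show ?thesis .
qed

lemma sum_Pow_insert:
  assumes "finite C" "x \<notin> C"
  shows "(\<Sum>S\<in>Pow (insert x C). f S) = (\<Sum>S\<in>Pow C. f S) + (\<Sum>S\<in>Pow C. f (insert x S))"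
proof -
  have "inj_on (insert x) (Pow C)" using assms by (intro inj_onI) (auto dest: insert_ident[THEN iffD1, rotated 2])
  moreover have "Pow C \<inter> insert x ` Pow C = {}" using assms by blast
  ultimately show ?thesis
    using assms by (simp add: Pow_insert sum.union_disjoint sum.reindex)
qed

text \<open>Each added diagonal 1 is either passed over or deletes its index. \<open>U\<close> is
  arbitrary in the induction because the hypothesis is applied to \<open>U\<close> and to
  \<open>U - {x}\<close>.\<close>

lemma sdet_principal_minors:
  assumes "finite U" "C \<subseteq> U"
  shows "sdet U (\<lambda>i j. A i j + (if i = j \<and> i \<in> C then 1 else 0)) = (\<Sum>S\<in>Pow C. sdet (U - S) A)"
proof -
  have "finite C" using assms finite_subset by blast
  then show ?thesis using assms
  proof (induction C arbitrary: U)
    case (insert x C)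
    let ?A = "\<lambda>i j. A i j + (if i = j \<and> i \<in> C then 1 else 0)"
    have "sdet U (\<lambda>i j. A i j + (if i = j \<and> i \<in> insert x C then 1 else 0)) =
        sdet U (\<lambda>i j. ?A i j + (if i = j \<and> i = x then 1 else 0))"
      using insert.hyps by (intro sdet_cong) auto
    also have "\<dots> = sdet U ?A + sdet (U - {x}) ?A"
      using insert.prems by (intro sdet_add_diag) auto
    also have "\<dots> = (\<Sum>S\<in>Pow C. sdet (U - S) A) + (\<Sum>S\<in>Pow C. sdet (U - {x} - S) A)"
      using insert.IH[of U] insert.IH[of "U - {x}"] insert.prems insert.hyps
      by (simp add: subset_Diff_insert)
    also have "\<dots> = (\<Sum>S\<in>Pow (insert x C). sdet (U - S) A)"
      using insert.hyps by (simp add: sum_Pow_insert Diff_insert2[symmetric] flip: Diff_insert)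
    finally show ?case .
  qed simp
qed

text \<open>An identity block on \<open>S\<close> lets the matrix factor into a block lower and a
  block upper triangular matrix without any inversion, so the formula holds over the integers
  too.\<close>

lemma sdet_Schur:
  fixes A :: "'a \<Rightarrow> 'a \<Rightarrow> 'b::linordered_idom"
  assumes "finite S" "finite T" "S \<inter> T = {}"
    and id: "\<And>i j. i \<in> S \<Longrightarrow> j \<in> S \<Longrightarrow> A i j = (if i = j then 1 else 0)"
  shows "sdet (S \<union> T) A = sdet T (\<lambda>i j. A i j - (\<Sum>s\<in>S. A i s * A s j))"
proof -
  let ?U = "S \<union> T"
  define P where "P i j = (if j \<in> S then A i j else if i = j then 1 else 0)" for i j
  define Q where "Q i j = (if i \<in> S then A i j else if j \<in> S then 0 else A i j - (\<Sum>s\<in>S. A i s * A s j))" for i j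
  have "sdet ?U A = sdet ?U (\<lambda>i j. \<Sum>k\<in>?U. P i k * Q k j)"
  proof (rule sdet_cong)
    fix i j assume i: "i \<in> ?U" and j: "j \<in> ?U"
    have "(\<Sum>k\<in>?U. P i k * Q k j) = (\<Sum>k\<in>S. P i k * Q k j) + (\<Sum>k\<in>T. P i k * Q k j)"
      using assms by (intro sum.union_disjoint) auto
    also have "(\<Sum>k\<in>S. P i k * Q k j) = (\<Sum>k\<in>S. A i k * A k j)" by (simp add: P_def Q_def)
    also have "(\<Sum>k\<in>T. P i k * Q k j) = (\<Sum>k\<in>T. if k = i then Q k j else 0)"
      using assms by (intro sum.cong) (auto simp: P_def)
    also have "\<dots> = (if i \<in> T then Q i j else 0)" using assms by simp
    also have "(\<Sum>k\<in>S. A i k * A k j) + (if i \<in> T then Q i j else 0) = A i j"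
    proof (cases "i \<in> S")
      case True
      then have "(\<Sum>k\<in>S. A i k * A k j) = (\<Sum>k\<in>S. if i = k then A k j else 0)"
        using id by (intro sum.cong) auto
      then show ?thesis using True assms by auto
    next
      case False
      show ?thesis
      proof (cases "j \<in> S")
        case True
        then have "(\<Sum>k\<in>S. A i k * A k j) = (\<Sum>k\<in>S. if k = j then A i k else 0)"
          using id by (intro sum.cong) auto
        then show ?thesis using True False i assms by (auto simp: Q_def)
      qed (use False i in \<open>auto simp: Q_def\<close>)
    qed
    finally show "A i j = (\<Sum>k\<in>?U. P i k * Q k j)" by simp
  qed
  also have "\<dots> = sdet ?U P * sdet ?U Q" using assms by (intro sdet_mult) auto
  also have "sdet ?U P = sdet S P"
    using assms by (intro sdet_identity_columns) (auto simp: P_def)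
  also have "\<dots> = sdet S (\<lambda>i j. if i = j then 1 else 0)"
    using id by (intro sdet_cong) (simp add: P_def)
  also have "\<dots> = 1" using assms by (intro sdet_identity)
  also have "sdet ?U Q = sdet T Q"
    using assms id by (intro sdet_identity_columns) (auto simp: Q_def)
  also have "\<dots> = sdet T (\<lambda>i j. A i j - (\<Sum>s\<in>S. A i s * A s j))"
    using assms by (intro sdet_cong) (auto simp: Q_def)
  finally show ?thesis by simp
qed

text \<open>With \<open>N\<close> inverse to \<open>X\<close>, the product \<open>Y N\<close>
  differs from the identity only in the rows of \<open>B\<close>. Changing |B| rows therefore costs
  one minor of size |B|, as in Jacobi's complementary minor formula.\<close>

lemma sdet_replace_rows:
  fixes X N Y :: "'a \<Rightarrow> 'a \<Rightarrow> 'b::linordered_idom"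
  assumes "finite U" "B \<subseteq> U"
    and inv: "\<And>i j. i \<in> U \<Longrightarrow> j \<in> U \<Longrightarrow> (\<Sum>k\<in>U. X i k * N k j) = (if i = j then 1 else 0)"
    and eq: "\<And>i j. i \<in> U - B \<Longrightarrow> j \<in> U \<Longrightarrow> Y i j = X i j"
  shows "sdet U Y = sdet U X * sdet B (\<lambda>i j. \<Sum>k\<in>U. Y i k * N k j)"
proof -
  have "sdet U X * sdet U N = sdet U (\<lambda>i j. if i = j then 1 else 0)"
    unfolding sdet_mult[OF assms(1), symmetric] using inv by (intro sdet_cong)
  then have 1: "sdet U X * sdet U N = 1" using assms(1) sdet_identity by simp
  have "sdet U Y * sdet U N = sdet B (\<lambda>i j. \<Sum>k\<in>U. Y i k * N k j)"
    unfolding sdet_mult[OF assms(1), symmetric]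
  proof (rule sdet_identity_rows)
    fix i j assume "i \<in> U - B" "j \<in> U"
    then show "(\<Sum>k\<in>U. Y i k * N k j) = (if i = j then 1 else 0)" using eq inv[of i j] by simp
  qed (use assms in auto)
  then show ?thesis using 1 by (metis mult.assoc mult.commute mult.right_neutral)
qed

text \<open>The index \<open>y\<close> is joined to \<open>x\<close> only, so a nonvanishing term
  must exchange the two, and the exchange is odd.\<close>

lemma sdet_remove_pair:
  fixes A :: "'a \<Rightarrow> 'a \<Rightarrow> 'b::linordered_idom"
  assumes "finite S" "x \<in> S" "y \<in> S" "x \<noteq> y"
    and row: "\<And>j. j \<in> S \<Longrightarrow> j \<noteq> x \<Longrightarrow> A y j = 0"
    and col: "\<And>i. i \<in> S \<Longrightarrow> i \<noteq> x \<Longrightarrow> A i y = 0"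
  shows "sdet S A = - (A x y * A y x) * sdet (S - {x,y}) A"
proof -
  let ?U = "S - {x,y}" and ?t = "Transposition.transpose x y"
  let ?P = "{p. p permutes S}" and ?Q = "{p. p permutes ?U}"
  have fP: "finite ?P" using assms by (intro finite_permutations)
  have Q: "?Q = {p. p permutes S \<and> p x = x \<and> p y = y}"
    using permutes_fixing_iff[of S ?U] permutes_subset[of _ ?U S] assms by (auto simp: permutes_def)
  have t: "?t permutes S" using assms by (intro permutes_swap_id) auto
  have img: "(\<lambda>p. p \<circ> ?t) ` ?Q = {p \<in> ?P. p x = y \<and> p y = x}"
  proof (intro equalityI subsetI)
    fix p assume "p \<in> {p \<in> ?P. p x = y \<and> p y = x}"
    then have p: "p permutes S" "p x = y" "p y = x" by auto
    then have "p \<circ> ?t \<in> ?Q" unfolding Q using t permutes_compose[OF t p(1)] by (simp add: comp_def)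
    moreover have "p = (p \<circ> ?t) \<circ> ?t" by (simp add: fun_eq_iff)
    ultimately show "p \<in> (\<lambda>p. p \<circ> ?t) ` ?Q" by (metis (no_types, lifting) image_eqI)
  next
    fix p assume "p \<in> (\<lambda>p. p \<circ> ?t) ` ?Q"
    then obtain q where "q permutes S" "q x = x" "q y = y" "p = q \<circ> ?t" unfolding Q by blast
    then show "p \<in> {p \<in> ?P. p x = y \<and> p y = x}" using permutes_compose[OF t] by simp
  qed
  have "sdet S A = (\<Sum>p\<in>(\<lambda>p. p \<circ> ?t) ` ?Q. of_int (sign p) * (\<Prod>i\<in>S. A i (p i)))"
    unfolding sdet_def img
  proof (rule sum.mono_neutral_right[OF fP])
    show "\<forall>p\<in>?P - {p \<in> ?P. p x = y \<and> p y = x}. of_int (sign p) * (\<Prod>i\<in>S. A i (p i)) = 0"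
    proof
      fix p assume "p \<in> ?P - {p \<in> ?P. p x = y \<and> p y = x}"
      then have p: "p permutes S" "p x \<noteq> y \<or> p y \<noteq> x" by auto
      have "\<exists>i\<in>S. A i (p i) = 0"
      proof (cases "p y = x")
        case False
        then have "A y (p y) = 0" using p assms by (intro row) (auto simp: permutes_in_image)
        then show ?thesis using assms by blast
      next
        case True
        then have "p x \<noteq> y" using p by auto
        \<comment> \<open>Row \<open>y\<close> gives no zero here; the vanishing factor lies in
          column \<open>y\<close>, in the row that \<open>p\<close> sends to
          \<open>y\<close>.\<close>
        then have "(inv_into UNIV p) y \<noteq> x" "p (inv_into UNIV p y) = y" "(inv_into UNIV p) y \<in> S"
          using p(1) assms by (auto simp: permutes_inverses permutes_in_image[OF permutes_inv])
        then show ?thesis using col by metis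
      qed
      then have "(\<Prod>i\<in>S. A i (p i)) = 0" using assms(1) by (intro prod_zero)
      then show "of_int (sign p) * (\<Prod>i\<in>S. A i (p i)) = 0" by simp
    qed
  qed auto
  also have "\<dots> = (\<Sum>p\<in>?Q. of_int (sign (p \<circ> ?t)) * (\<Prod>i\<in>S. A i ((p \<circ> ?t) i)))"
  proof (subst sum.reindex)
    show "inj_on (\<lambda>p. p \<circ> ?t) ?Q"
      by (rule inj_onI) (metis comp_assoc comp_id transpose_comp_involutory)
  qed simp
  also have "\<dots> = (\<Sum>p\<in>?Q. - (A x y * A y x) * (of_int (sign p) * (\<Prod>i\<in>?U. A i (p i))))"
  proof (intro sum.cong refl)
    fix p assume pQ: "p \<in> ?Q"
    then have p: "p permutes S" "p x = x" "p y = y" unfolding Q by auto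
    have "sign (p \<circ> ?t) = - sign p"
      using assms permutes_imp_permutation[OF assms(1) p(1)]
      by (simp add: sign_compose permutation_swap_id sign_swap_id)
    moreover have "(\<Prod>i\<in>S. A i ((p \<circ> ?t) i)) = A x y * (A y x * (\<Prod>i\<in>?U. A i ((p \<circ> ?t) i)))"
    proof -
      have "S - {x} - {y} = ?U" by blast
      then show ?thesis using p assms by (simp add: prod.remove[of S x] prod.remove[of "S - {x}" y])
    qed
    moreover have "(\<Prod>i\<in>?U. A i ((p \<circ> ?t) i)) = (\<Prod>i\<in>?U. A i (p i))"
      by (intro prod.cong) (auto simp: Transposition.transpose_def)
    ultimately show "of_int (sign (p \<circ> ?t)) * (\<Prod>i\<in>S. A i ((p \<circ> ?t) i)) =
        - (A x y * A y x) * (of_int (sign p) * (\<Prod>i\<in>?U. A i (p i)))"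
      by (simp add: mult_ac)
  qed
  also have "\<dots> = - (A x y * A y x) * sdet ?U A" by (simp add: sdet_def sum_distrib_left)
  finally show ?thesis .
qed

text \<open>Both diagonal blocks vanish, so a nonvanishing term would inject \<open>R\<close> into
  \<open>T\<close> and \<open>T\<close> into \<open>R\<close>.\<close>

lemma sdet_bipartite_unbalanced:
  assumes "finite R" "finite T" "R \<inter> T = {}" "card R \<noteq> card T"
    and "\<And>i j. i \<in> R \<Longrightarrow> j \<in> R \<Longrightarrow> A i j = 0" "\<And>i j. i \<in> T \<Longrightarrow> j \<in> T \<Longrightarrow> A i j = 0"
  shows "sdet (R \<union> T) A = 0"
  unfolding sdet_def
proof (intro sum.neutral ballI)
  fix p assume "p \<in> {p. p permutes R \<union> T}"
  then have p: "p permutes R \<union> T" by simp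
  have "\<exists>i\<in>R \<union> T. A i (p i) = 0"
  proof (rule ccontr)
    assume "\<not> ?thesis"
    then have nz: "\<And>i. i \<in> R \<union> T \<Longrightarrow> A i (p i) \<noteq> 0" by blast
    have mem: "\<And>i. i \<in> R \<union> T \<Longrightarrow> p i \<in> R \<union> T" using permutes_in_image[OF p] by blast
    have "p ` R \<subseteq> T" "p ` T \<subseteq> R" using nz mem assms(5,6) by blast+
    moreover have "inj_on p R" "inj_on p T" using p permutes_inj_on by blast+
    ultimately have "card R \<le> card T" "card T \<le> card R"
      using assms by (meson card_inj_on_le)+
    then show False using assms by simp
  qed
  then have "(\<Prod>i\<in>R \<union> T. A i (p i)) = 0" using assms by (intro prod_zero) auto
  then show "of_int (sign p) * (\<Prod>i\<in>R \<union> T. A i (p i)) = 0" by simp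
qed

section \<open>The index of an integer lattice\<close>

text \<open>Membership in the column lattice of \<open>A\<close>; the values of \<open>z\<close>
  outside \<open>R\<close> are ignored.\<close>

definition in_lattice :: "'a set \<Rightarrow> ('a \<Rightarrow> 'a \<Rightarrow> int) \<Rightarrow> ('a \<Rightarrow> int) \<Rightarrow> bool" where
  "in_lattice R A z \<longleftrightarrow> (\<exists>c. \<forall>i\<in>R. z i = (\<Sum>j\<in>R. A i j * c j))"

text \<open>Representatives of the quotient of Z^R by the column lattice. Vanishing outside
  \<open>R\<close> makes distinct functions distinct vectors.\<close>

definition lattice_transversal :: "'a set \<Rightarrow> ('a \<Rightarrow> 'a \<Rightarrow> int) \<Rightarrow> ('a \<Rightarrow> int) set \<Rightarrow> bool" where
  "lattice_transversal R A V \<longleftrightarrow> finite V \<and> (\<forall>v\<in>V. \<forall>i. i \<notin> R \<longrightarrow> v i = 0) \<and>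
     (\<forall>z. \<exists>!v. v \<in> V \<and> in_lattice R A (\<lambda>i. z i - v i))"

definition int_kernel_trivial :: "'a set \<Rightarrow> ('a \<Rightarrow> 'a \<Rightarrow> int) \<Rightarrow> bool" where
  "int_kernel_trivial R A \<longleftrightarrow> (\<forall>c. (\<forall>i\<in>R. (\<Sum>j\<in>R. A i j * c j) = 0) \<longrightarrow> (\<forall>j\<in>R. c j = 0))"

lemma int_kernel_nontrivialI:
  assumes "\<forall>i\<in>R. (\<Sum>j\<in>R. A i j * c j) = 0" "k \<in> R" "c k \<noteq> 0"
  shows "\<not> int_kernel_trivial R A"
  using assms unfolding int_kernel_trivial_def by blast

text \<open>The singular case is included so that the whole predicate passes through column
  operations and through the induction on \<open>R\<close>. The kernel will govern the top Betti
  number, the index the order of the homology group below.\<close>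

definition index_is_det :: "'a set \<Rightarrow> ('a \<Rightarrow> 'a \<Rightarrow> int) \<Rightarrow> bool" where
  "index_is_det R A \<longleftrightarrow> (if sdet R A = 0 then \<not> int_kernel_trivial R A
     else int_kernel_trivial R A \<and> (\<exists>V. lattice_transversal R A V \<and> int (card V) = \<bar>sdet R A\<bar>))"

lemma sdet_singleton [simp]: "sdet {x} A = A x x"
  by (simp add: sdet_def)

lemma sdet_add_column:
  fixes A :: "'a \<Rightarrow> 'a \<Rightarrow> 'b::linordered_idom"
  assumes "finite R" "a \<in> R" "b \<in> R" "a \<noteq> b"
  shows "sdet R (\<lambda>i j. A i j + (if j = a then t * A i b else 0)) = sdet R A"
proof -
  let ?S = "\<lambda>k j. (if k = j then 1 else 0) + (if k = b \<and> j = a then t else 0)"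
  have "sdet R (\<lambda>i j. A i j + (if j = a then t * A i b else 0)) = sdet R (\<lambda>i j. \<Sum>k\<in>R. A i k * ?S k j)"
  proof (rule sdet_cong)
    fix i j assume "j \<in> R"
    have "(\<Sum>k\<in>R. A i k * ?S k j) = (\<Sum>k\<in>R. (if k = j then A i k else 0) + (if k = b then if j = a then t * A i k else 0 else 0))"
      using assms(4) by (intro sum.cong) (auto simp: algebra_simps)
    also have "\<dots> = A i j + (if j = a then t * A i b else 0)"
      using assms \<open>j \<in> R\<close> by (simp add: sum.distrib)
    finally show "A i j + (if j = a then t * A i b else 0) = (\<Sum>k\<in>R. A i k * ?S k j)" by simp
  qed
  also have "\<dots> = sdet R A * sdet R ?S" using assms by (intro sdet_mult)
  also have "sdet R ?S = sdet {b} ?S" using assms by (intro sdet_identity_rows) auto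
  finally show ?thesis using assms by simp
qed

text \<open>A column operation is the invertible integer substitution that replaces
  \<open>c b\<close> by \<open>c b + t * c a\<close>. It changes neither the lattice nor the
  triviality of the kernel nor the determinant.\<close>

lemma index_is_det_add_column:
  assumes "finite R" "a \<in> R" "b \<in> R" "a \<noteq> b"
    and B: "index_is_det R (\<lambda>i j. A i j + (if j = a then t * A i b else 0))"
  shows "index_is_det R A"
proof -
  let ?B = "\<lambda>i j. A i j + (if j = a then t * A i b else 0)"
  have Bc: "(\<Sum>j\<in>R. ?B i j * c j) = (\<Sum>j\<in>R. A i j * (c(b := c b + t * c a)) j)" for i and c :: "'a \<Rightarrow> int"
  proof -
    have "(\<Sum>j\<in>R. ?B i j * c j) = (\<Sum>j\<in>R. A i j * c j + (if j = a then t * A i b * c j else 0))"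
      by (intro sum.cong) (auto simp: algebra_simps)
    also have "\<dots> = (\<Sum>j\<in>R. A i j * c j + (if j = b then A i j * (t * c a) else 0))"
      using assms by (simp add: sum.distrib)
    also have "\<dots> = (\<Sum>j\<in>R. A i j * (c(b := c b + t * c a)) j)"
      by (intro sum.cong) (auto simp: algebra_simps)
    finally show ?thesis .
  qed
  have Ac: "(\<Sum>j\<in>R. A i j * c j) = (\<Sum>j\<in>R. ?B i j * (c(b := c b - t * c a)) j)" for i and c :: "'a \<Rightarrow> int"
    unfolding Bc using assms by (intro sum.cong) auto
  have lat: "in_lattice R ?B = in_lattice R A"
  proof (intro ext iffI)
    fix z assume "in_lattice R ?B z"
    then obtain c where "\<forall>i\<in>R. z i = (\<Sum>j\<in>R. ?B i j * c j)" unfolding in_lattice_def by blast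
    then show "in_lattice R A z" unfolding Bc in_lattice_def by blast
  next
    fix z assume "in_lattice R A z"
    then obtain c where "\<forall>i\<in>R. z i = (\<Sum>j\<in>R. A i j * c j)" unfolding in_lattice_def by blast
    then show "in_lattice R ?B z" unfolding Ac in_lattice_def by blast
  qed
  have ker: "int_kernel_trivial R ?B \<longleftrightarrow> int_kernel_trivial R A"
  proof
    assume K: "int_kernel_trivial R ?B"
    show "int_kernel_trivial R A"
      unfolding int_kernel_trivial_def
    proof (intro allI impI ballI)
      fix c j assume c: "\<forall>i\<in>R. (\<Sum>j\<in>R. A i j * c j) = 0" and j: "j \<in> R"
      have "\<forall>j\<in>R. (c(b := c b - t * c a)) j = 0"
        using K[unfolded int_kernel_trivial_def, rule_format, of "c(b := c b - t * c a)"] c[unfolded Ac] by blast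
      then show "c j = 0" using assms j by (metis diff_0_right fun_upd_apply mult_zero_right)
    qed
  next
    assume K: "int_kernel_trivial R A"
    show "int_kernel_trivial R ?B"
      unfolding int_kernel_trivial_def
    proof (intro allI impI ballI)
      fix c j assume c: "\<forall>i\<in>R. (\<Sum>j\<in>R. ?B i j * c j) = 0" and j: "j \<in> R"
      have "\<forall>j\<in>R. (c(b := c b + t * c a)) j = 0"
        using K[unfolded int_kernel_trivial_def, rule_format, of "c(b := c b + t * c a)"] c[unfolded Bc] by blast
      then show "c j = 0" using assms j by (metis add_0_right fun_upd_apply mult_zero_right)
    qed
  qed
  show ?thesis
    using B unfolding index_is_det_def lattice_transversal_def lat ker sdet_add_column[OF assms(1-4)] .
qed

lemma sdet_diag_row:
  fixes A :: "'a \<Rightarrow> 'a \<Rightarrow> 'b::linordered_idom"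
  assumes "finite R" "x \<notin> R" "\<And>j. j \<in> R \<Longrightarrow> A x j = 0"
  shows "sdet (insert x R) A = A x x * sdet R A"
proof -
  let ?U = "insert x R"
  let ?D = "\<lambda>i j. if i = j then if i = x then A x x else 1 else 0"
  let ?B = "\<lambda>i j. if i = x then if j = x then 1 else 0 else A i j"
  have "sdet ?U A = sdet ?U (\<lambda>i j. \<Sum>k\<in>?U. ?D i k * ?B k j)"
  proof (rule sdet_cong)
    fix i j assume ij: "i \<in> ?U" "j \<in> ?U"
    have "(\<Sum>k\<in>?U. ?D i k * ?B k j) = (\<Sum>k\<in>?U. if k = i then (if i = x then A x x else 1) * ?B i j else 0)"
      by (intro sum.cong) auto
    also have "\<dots> = A i j" using assms ij by auto
    finally show "A i j = (\<Sum>k\<in>?U. ?D i k * ?B k j)" by simp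
  qed
  also have "\<dots> = sdet ?U ?D * sdet ?U ?B" using assms by (intro sdet_mult) auto
  also have "sdet ?U ?D = sdet {x} ?D" using assms by (intro sdet_identity_rows) auto
  also have "sdet ?U ?B = sdet R ?B" using assms by (intro sdet_identity_rows) auto
  also have "sdet R ?B = sdet R A" using assms by (intro sdet_cong) auto
  finally show ?thesis by simp
qed

text \<open>By the pigeonhole principle two of the infinitely many multiples \<open>t * z\<close>
  share a representative, and then they differ by a lattice vector.\<close>

lemma lattice_torsion:
  assumes "lattice_transversal R A V"
  shows "\<exists>m\<noteq>0. in_lattice R A (\<lambda>i. m * z i)"
proof -
  have fin: "finite V" and ex: "\<And>z. \<exists>v. v \<in> V \<and> in_lattice R A (\<lambda>i. z i - v i)"
    using assms unfolding lattice_transversal_def by blast+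
  define g where "g t = (SOME v. v \<in> V \<and> in_lattice R A (\<lambda>i. t * z i - v i))" for t :: int
  have g: "g t \<in> V \<and> in_lattice R A (\<lambda>i. t * z i - g t i)" for t
    unfolding g_def using someI_ex[OF ex[of "\<lambda>i. t * z i"]] .
  have "\<not> inj g"
  proof
    assume "inj g"
    moreover have "finite (range g)" using g fin by (meson finite_subset image_subsetI)
    ultimately show False using finite_imageD infinite_UNIV_int by blast
  qed
  then obtain s t where st: "s \<noteq> t" "g s = g t" by (auto simp: inj_def)
  obtain c d where c: "\<forall>i\<in>R. s * z i - g s i = (\<Sum>j\<in>R. A i j * c j)"
    and d: "\<forall>i\<in>R. t * z i - g t i = (\<Sum>j\<in>R. A i j * d j)"
    using g unfolding in_lattice_def by blast
  have "\<forall>i\<in>R. (s - t) * z i = (\<Sum>j\<in>R. A i j * (c j - d j))"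
  proof
    fix i assume "i \<in> R"
    then have "(\<Sum>j\<in>R. A i j * (c j - d j)) = (s * z i - g s i) - (t * z i - g t i)"
      using c d by (simp add: right_diff_distrib sum_subtractf)
    then show "(s - t) * z i = (\<Sum>j\<in>R. A i j * (c j - d j))" using st by (simp add: algebra_simps)
  qed
  then have "in_lattice R A (\<lambda>i. (s - t) * z i)"
    unfolding in_lattice_def by (intro exI[of _ "\<lambda>j. c j - d j"])
  then show ?thesis using st by (intro exI[of _ "s - t"]) auto
qed

text \<open>The matrix is block triangular with the 1 x 1 block \<open>A x x\<close>. Coordinate
  \<open>x\<close> of a lattice vector is a multiple of this entry; division with remainder settles
  that coordinate and leaves a problem over \<open>R\<close>, shifted by a multiple of column
  \<open>x\<close>.\<close>

lemma index_is_det_diag_row: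
  assumes "finite R" "x \<notin> R" and row: "\<And>j. j \<in> R \<Longrightarrow> A x j = 0" and R: "index_is_det R A"
  shows "index_is_det (insert x R) A"
proof -
  let ?U = "insert x R" and ?d = "A x x"
  have sx: "(\<Sum>j\<in>?U. A x j * c j) = ?d * c x" for c
    using assms(1,2) row by simp
  have si: "(\<Sum>j\<in>?U. A i j * c j) = A i x * c x + (\<Sum>j\<in>R. A i j * c j)" for i c
    using assms(1,2) by simp
  have upd: "(\<Sum>j\<in>R. A i j * (c(x := q)) j) = (\<Sum>j\<in>R. A i j * c j)" for i c q
    using assms(2) by (intro sum.cong) auto
  have det: "sdet ?U A = ?d * sdet R A"
    using assms row by (intro sdet_diag_row)
  show ?thesis
  proof (cases "sdet R A = 0")
    case True
    then have "\<not> int_kernel_trivial R A" using R by (simp add: index_is_det_def)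
    then obtain c k where c: "\<forall>i\<in>R. (\<Sum>j\<in>R. A i j * c j) = 0" "k \<in> R" "c k \<noteq> 0"
      unfolding int_kernel_trivial_def by blast
    have "\<forall>i\<in>?U. (\<Sum>j\<in>?U. A i j * (c(x := 0)) j) = 0"
    proof
      fix i assume "i \<in> ?U"
      then consider "i = x" | "i \<in> R" by blast
      then show "(\<Sum>j\<in>?U. A i j * (c(x := 0)) j) = 0"
      proof cases
        case 1 then show ?thesis using sx[of "c(x := 0)"] by simp
      next
        case 2 then show ?thesis using c(1) unfolding si upd by simp
      qed
    qed
    then have "\<not> int_kernel_trivial ?U A"
      by (rule int_kernel_nontrivialI[where k = k]) (use c assms(2) in auto)
    then show ?thesis using True det by (simp add: index_is_det_def)
  next
    case False
    then obtain V where K: "int_kernel_trivial R A" and V: "lattice_transversal R A V"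
      and cardV: "int (card V) = \<bar>sdet R A\<bar>"
      using R by (auto simp: index_is_det_def)
    show ?thesis
    proof (cases "?d = 0")
      case True
      \<comment> \<open>The lattice over \<open>R\<close> has finite index, so a nonzero multiple of
        column \<open>x\<close> lies in it. As the diagonal entry is 0, this relation is a kernel
        vector with entry \<open>- m\<close> at \<open>x\<close>.\<close>
      obtain m c where m: "m \<noteq> 0" "\<forall>i\<in>R. m * A i x = (\<Sum>j\<in>R. A i j * c j)"
        using lattice_torsion[OF V, of "\<lambda>i. A i x"] unfolding in_lattice_def by blast
      have "\<forall>i\<in>?U. (\<Sum>j\<in>?U. A i j * (c(x := - m)) j) = 0"
      proof
        fix i assume "i \<in> ?U"
        then show "(\<Sum>j\<in>?U. A i j * (c(x := - m)) j) = 0"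
          using m True unfolding si upd by (auto simp: sum.neutral row algebra_simps)
      qed
      then have "\<not> int_kernel_trivial ?U A"
        by (rule int_kernel_nontrivialI[where k = x]) (use m in auto)
      then show ?thesis using True det by (simp add: index_is_det_def)
    next
      case d0: False
      \<comment> \<open>The new representatives: a residue modulo the diagonal entry at
        \<open>x\<close>, an old representative elsewhere.\<close>
      let ?f = "\<lambda>(v, i). v(x := i)"
      let ?W = "?f ` (V \<times> {0..<\<bar>?d\<bar>})"
      have V0: "v x = 0" if "v \<in> V" for v using V that assms(2) unfolding lattice_transversal_def by blast
      have inj: "inj_on ?f (V \<times> {0..<\<bar>?d\<bar>})"
      proof (rule inj_onI, clarify)
        fix v i w j assume a: "v \<in> V" "w \<in> V" "v(x := i) = w(x := j)"
        have "v = (v(x := i))(x := 0)" using V0[OF a(1)] by (simp add: fun_eq_iff)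
        also have "\<dots> = w" unfolding a(3) using V0[OF a(2)] by (simp add: fun_eq_iff)
        finally show "v = w \<and> i = j" using a(3) by (metis fun_upd_same)
      qed
      have finV: "finite V" using V by (simp add: lattice_transversal_def)
      have "int (card ?W) = \<bar>sdet ?U A\<bar>"
        by (simp add: card_image[OF inj] card_cartesian_product cardV det abs_mult)
      moreover have "lattice_transversal ?U A ?W"
        unfolding lattice_transversal_def
      proof (intro conjI allI)
        show "finite ?W" using finV by simp
        show "\<forall>v\<in>?W. \<forall>i. i \<notin> ?U \<longrightarrow> v i = 0"
          using V by (auto simp: lattice_transversal_def)
        fix z :: "'a \<Rightarrow> int"
        let ?i = "z x mod \<bar>?d\<bar>"
        have i: "?i \<in> {0..<\<bar>?d\<bar>}" using d0 by simp
        have "?d dvd z x - ?i"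
          by (metis abs_dvd_iff dvd_minus_mod)
        then obtain q where q: "z x - ?i = ?d * q" by blast
        have uq: "\<exists>!v. v \<in> V \<and> in_lattice R A (\<lambda>i. z i - q * A i x - v i)"
          using V unfolding lattice_transversal_def by (elim conjE) (drule spec[of _ "\<lambda>i. z i - q * A i x"])
        show "\<exists>!v. v \<in> ?W \<and> in_lattice ?U A (\<lambda>i. z i - v i)"
        proof (rule ex_ex1I)
          from uq obtain v c where v: "v \<in> V" "\<forall>i\<in>R. z i - q * A i x - v i = (\<Sum>j\<in>R. A i j * c j)"
            unfolding in_lattice_def by blast
          have "v(x := ?i) \<in> ?W" using v i by (intro image_eqI[of _ _ "(v, ?i)"]) auto
          moreover have "\<forall>i\<in>?U. z i - (v(x := ?i)) i = (\<Sum>j\<in>?U. A i j * (c(x := q)) j)"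
          proof
            fix i assume "i \<in> ?U"
            then consider "i = x" | "i \<in> R" "i \<noteq> x" using assms(2) by auto
            then show "z i - (v(x := ?i)) i = (\<Sum>j\<in>?U. A i j * (c(x := q)) j)"
            proof cases
              case 1 then show ?thesis using q sx[of "c(x := q)"] by simp
            next
              case 2 then show ?thesis using v(2)[rule_format, of i] unfolding si upd by (simp add: algebra_simps)
            qed
          qed
          ultimately show "\<exists>v. v \<in> ?W \<and> in_lattice ?U A (\<lambda>i. z i - v i)"
            unfolding in_lattice_def by blast
        next
          have key: "\<exists>u. u \<in> V \<and> w = u(x := ?i) \<and> in_lattice R A (\<lambda>i. z i - q * A i x - u i)"
            if w: "w \<in> ?W \<and> in_lattice ?U A (\<lambda>i. z i - w i)" for w
          proof -
            from w obtain u i where u: "u \<in> V" "i \<in> {0..<\<bar>?d\<bar>}" "w = u(x := i)" by auto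
            from w obtain c where c: "\<forall>i\<in>?U. z i - w i = (\<Sum>j\<in>?U. A i j * c j)"
              unfolding in_lattice_def by blast
            have cx: "z x - i = ?d * c x" using c[rule_format, of x] u sx[of c] by simp
            then have "z x = i + \<bar>?d\<bar> * (sgn ?d * c x)" by (simp add: abs_mult_sgn mult.assoc[symmetric])
            then have "?i = i mod \<bar>?d\<bar>" by simp
            then have i': "i = ?i" using u(2) by simp
            then have "c x = q" using cx q d0 by simp
            have "\<forall>i\<in>R. z i - q * A i x - u i = (\<Sum>j\<in>R. A i j * c j)"
            proof
              fix k assume "k \<in> R"
              then have "z k - u k = A k x * c x + (\<Sum>j\<in>R. A k j * c j)"
                using c[rule_format, of k] u(3) assms(2) unfolding si by (cases "k = x") auto
              then show "z k - q * A k x - u k = (\<Sum>j\<in>R. A k j * c j)"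
                using \<open>c x = q\<close> by (simp add: algebra_simps)
            qed
            then show ?thesis using u i' unfolding in_lattice_def by blast
          qed
          fix w w' assume "w \<in> ?W \<and> in_lattice ?U A (\<lambda>i. z i - w i)" "w' \<in> ?W \<and> in_lattice ?U A (\<lambda>i. z i - w' i)"
          then show "w = w'" using key[of w] key[of w'] uq by metis
        qed
      qed
      moreover have "int_kernel_trivial ?U A"
        unfolding int_kernel_trivial_def
      proof (intro allI impI)
        fix c assume c: "\<forall>i\<in>?U. (\<Sum>j\<in>?U. A i j * c j) = 0"
        then have "c x = 0" using sx[of c] d0 by simp
        moreover have "\<forall>i\<in>R. (\<Sum>j\<in>R. A i j * c j) = 0" using c \<open>c x = 0\<close> by (simp add: si)
        ultimately show "\<forall>j\<in>?U. c j = 0" using K unfolding int_kernel_trivial_def by blast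
      qed
      ultimately show ?thesis using det d0 False by (auto simp: index_is_det_def)
    qed
  qed
qed

text \<open>Column operations bring the row of the new index into diagonal form: the Euclidean algorithm
  leaves a single nonzero entry, which two further operations move to the diagonal.\<close>

theorem lattice_index_det:
  assumes "finite R"
  shows "index_is_det R A"
  using assms
proof (induction R arbitrary: A)
  case empty
  have "lattice_transversal {} A {\<lambda>_. 0}"
    by (auto simp: lattice_transversal_def in_lattice_def)
  then show ?case
    by (auto simp: index_is_det_def int_kernel_trivial_def intro!: exI[of _ "{\<lambda>_. 0}"])
next
  case (insert x R)
  let ?U = "insert x R"
  have fU: "finite ?U" using insert by simp
  show ?case
  proof (induction "\<Sum>j\<in>?U. nat \<bar>A x j\<bar>" arbitrary: A rule: less_induct)
    case less
    show ?case
    proof (cases "\<exists>a\<in>?U. \<exists>b\<in>?U. a \<noteq> b \<and> A x a \<noteq> 0 \<and> A x b \<noteq> 0")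
      case True
      then obtain a b where ab: "a \<in> ?U" "b \<in> ?U" "a \<noteq> b" "A x a \<noteq> 0" "A x b \<noteq> 0" "\<bar>A x b\<bar> \<le> \<bar>A x a\<bar>"
        by (metis linear)
      \<comment> \<open>The sign makes the addition of \<open>t\<close> times the smaller entry move
        the larger one towards 0. This lowers the induction measure, the sum of the absolute values
        in row \<open>x\<close>.\<close>
      define t where "t = - (sgn (A x a) * sgn (A x b))"
      let ?B = "\<lambda>i j. A i j + (if j = a then t * A i b else 0)"
      have "\<bar>A x a + t * A x b\<bar> < \<bar>A x a\<bar>"
        using ab unfolding t_def by (auto simp: sgn_if abs_if split: if_splits)
      then have "(\<Sum>j\<in>?U. nat \<bar>?B x j\<bar>) < (\<Sum>j\<in>?U. nat \<bar>A x j\<bar>)"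
        by (intro sum_strict_mono_ex1[OF fU]) (use ab in auto)
      then have "index_is_det ?U ?B" by (rule less.hyps)
      then show ?thesis using fU ab by (intro index_is_det_add_column[of ?U a b A t])
    next
      case False
      show ?thesis
      proof (cases "\<exists>a\<in>R. A x a \<noteq> 0")
        case True
        then obtain a where a: "a \<in> R" "A x a \<noteq> 0" by blast
        have ax: "a \<noteq> x" using a insert by blast
        have z: "A x j = 0" if "j \<in> ?U" "j \<noteq> a" for j using False a that by blast
        \<comment> \<open>The diagonal entry of row \<open>x\<close> is 0 at this point. The first
          operation copies the entry at \<open>a\<close> onto it, the second subtracts it from
          column \<open>a\<close> and so clears the rest of the row.\<close>
        let ?B = "\<lambda>i j. A i j + (if j = x then 1 * A i a else 0)"
        let ?C = "\<lambda>i j. ?B i j + (if j = a then (-1) * ?B i x else 0)"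
        have "index_is_det ?U ?C"
          by (rule index_is_det_diag_row) (use insert z in auto)
        then have "index_is_det ?U ?B"
          by (rule index_is_det_add_column[rotated 4]) (use fU a ax in auto)
        then show ?thesis
          by (rule index_is_det_add_column[rotated 4]) (use fU a ax in auto)
      next
        case False
        then show ?thesis by (intro index_is_det_diag_row) (use insert in auto)
      qed
    qed
  qed
qed

section \<open>Signed incidences\<close>

text \<open>The coefficient of \<open>s\<close> in the simplicial boundary of \<open>t\<close>. It
  is defined for all pairs of sets and vanishes unless \<open>t\<close> adds one vertex to
  \<open>s\<close>, so sums may run over a whole power set with no dimension fixed.\<close>

definition inc :: "nat set \<Rightarrow> nat set \<Rightarrow> int" where
  "inc s t = (if \<exists>v. v \<notin> s \<and> t = insert v s then (-1) ^ card {u \<in> s. u < the_elem (t - s)} else 0)"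

lemma inc_insert:
  assumes "v \<notin> s"
  shows "inc s (insert v s) = (-1) ^ card {u \<in> s. u < v}"
proof -
  have "insert v s - s = {v}" using assms by blast
  then show ?thesis using assms by (auto simp: inc_def)
qed

lemma inc_nonzeroE:
  assumes "inc s t \<noteq> 0"
  obtains v where "v \<notin> s" "t = insert v s"
  using assms by (auto simp: inc_def split: if_splits)

lemma inc_nonzero_cards:
  assumes "inc s t \<noteq> 0" "finite s"
  shows "card t = Suc (card s)"
  using assms by (elim inc_nonzeroE) simp

lemma inc_insert_square: "v \<notin> s \<Longrightarrow> inc s (insert v s) * inc s (insert v s) = 1"
  by (simp add: inc_insert flip: power_mult_distrib)

text \<open>For a < b the vertex \<open>b\<close> moves up one place once \<open>a\<close> is
  present, while the place of \<open>a\<close> does not depend on \<open>b\<close>. This sign is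
  behind both \<partial>\<partial> = 0 and the off-diagonal cancellation in the Laplacian.\<close>

lemma inc_anticommute:
  assumes "finite r" "a \<noteq> b" "a \<notin> r" "b \<notin> r"
  shows "inc r (insert a r) * inc (insert a r) (insert a (insert b r)) =
       - (inc r (insert b r) * inc (insert b r) (insert a (insert b r)))"
proof -
  have *: "inc r (insert a r) * inc (insert a r) (insert a (insert b r)) =
       - (inc r (insert b r) * inc (insert b r) (insert a (insert b r)))"
    if "a < b" "a \<notin> r" "b \<notin> r" for a b
  proof -
    have 1: "{u \<in> insert a r. u < b} = insert a {u \<in> r. u < b}" using that by auto
    have 2: "{u \<in> insert b r. u < a} = {u \<in> r. u < a}" using that by auto
    have "inc (insert a r) (insert a (insert b r)) = - inc r (insert b r)"
      using that assms(1) 1 inc_insert[of b "insert a r"] by (simp add: inc_insert insert_commute)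
    moreover have "inc (insert b r) (insert a (insert b r)) = inc r (insert a r)"
      using that 2 inc_insert[of a "insert b r"] by (simp add: inc_insert)
    ultimately show ?thesis by simp
  qed
  show ?thesis
  proof (cases "a < b")
    case True then show ?thesis using * assms by blast
  next
    case False
    then show ?thesis using *[of b a] assms by (simp add: insert_commute)
  qed
qed

section \<open>The boundary identity and the Laplacian of the full simplex\<close>

lemma inc_inc_nonzero:
  assumes "inc r g * inc g t \<noteq> 0"
  obtains u v where "u \<notin> r" "v \<notin> r" "u \<noteq> v" "g = insert u r" "t = insert u (insert v r)"
proof -
  have nz: "inc r g \<noteq> 0" "inc g t \<noteq> 0" using assms by auto
  obtain u where u: "u \<notin> r" "g = insert u r" using nz(1) by (rule inc_nonzeroE)
  obtain v where v: "v \<notin> g" "t = insert v g" using nz(2) by (rule inc_nonzeroE)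
  show ?thesis by (rule that[of u v]) (use u v in auto)
qed

text \<open>Between \<open>r\<close> and a set with two more vertices lie exactly two faces, and
  their terms cancel by anticommutation.\<close>

lemma inc_inc_sum:
  assumes "finite V" "r \<subseteq> V" "t \<subseteq> V"
  shows "(\<Sum>g\<in>Pow V. inc r g * inc g t) = 0"
proof (cases "\<exists>a b. a \<noteq> b \<and> a \<notin> r \<and> b \<notin> r \<and> t = insert a (insert b r)")
  case True
  then obtain a b where ab: "a \<noteq> b" "a \<notin> r" "b \<notin> r" "t = insert a (insert b r)" by blast
  have "(\<Sum>g\<in>Pow V. inc r g * inc g t) = (\<Sum>g\<in>{insert a r, insert b r}. inc r g * inc g t)"
  proof (rule sum.mono_neutral_right)
    show "\<forall>g\<in>Pow V - {insert a r, insert b r}. inc r g * inc g t = 0"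
    proof (rule ballI, rule ccontr)
      fix g assume g: "g \<in> Pow V - {insert a r, insert b r}" and "inc r g * inc g t \<noteq> 0"
      then obtain u v where uv: "u \<notin> r" "g = insert u r" "t = insert u (insert v r)"
        by (elim inc_inc_nonzero) simp
      then have "u \<in> insert a (insert b r)" using ab(4) by simp
      then show False using uv(1,2) g by auto
    qed
  qed (use assms ab in auto)
  also have "\<dots> = 0"
  proof -
    have "a \<in> insert a r" "a \<notin> insert b r" using ab by simp_all
    then have "insert a r \<noteq> insert b r" by metis
    then show ?thesis
      using inc_anticommute[OF finite_subset[OF assms(2,1)] ab(1-3)] unfolding ab(4) by simp
  qed
  finally show ?thesis .
next
  case False
  show ?thesis
  proof (intro sum.neutral ballI, rule ccontr)
    fix g assume "inc r g * inc g t \<noteq> 0"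
    then show False using False by (elim inc_inc_nonzero) metis
  qed
qed

lemma up_neighbours_common:
  assumes "inc g t * inc g' t \<noteq> 0" "g \<noteq> g'"
  obtains a b r where "a \<noteq> b" "a \<notin> r" "b \<notin> r" "g = insert a r" "g' = insert b r" "t = insert a (insert b r)"
proof -
  have nz: "inc g t \<noteq> 0" "inc g' t \<noteq> 0" using assms by auto
  obtain u where u: "u \<notin> g" "t = insert u g" using nz(1) by (rule inc_nonzeroE)
  obtain v where v: "v \<notin> g'" "t = insert v g'" using nz(2) by (rule inc_nonzeroE)
  have g: "g = t - {u}" and g': "g' = t - {v}" using u v by auto
  have uv: "u \<noteq> v" using g g' assms(2) by blast
  show ?thesis
  proof (rule that[of v u "t - {u} - {v}"])
    have "u \<in> t" "v \<in> t" using u(2) v(2) by blast+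
    then show "g = insert v (t - {u} - {v})" "g' = insert u (t - {u} - {v})"
      "t = insert v (insert u (t - {u} - {v}))"
      unfolding g g' using uv by blast+
  qed (use uv in auto)
qed

lemma down_neighbours_common:
  assumes "inc r g * inc r g' \<noteq> 0" "g \<noteq> g'"
  obtains a b where "a \<noteq> b" "a \<notin> r" "b \<notin> r" "g = insert a r" "g' = insert b r"
proof -
  have nz: "inc r g \<noteq> 0" "inc r g' \<noteq> 0" using assms by auto
  obtain u where u: "u \<notin> r" "g = insert u r" using nz(1) by (rule inc_nonzeroE)
  obtain v where v: "v \<notin> r" "g' = insert v r" using nz(2) by (rule inc_nonzeroE)
  show ?thesis by (rule that[of u v]) (use u v assms(2) in auto)
qed

text \<open>On the diagonal, \<open>g\<close> has \<open>card V - card g\<close> cofaces and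
  \<open>card g\<close> facets. Off the diagonal either both sums are empty or each has one term, at
  the union above and at the intersection below, with opposite signs. So the Laplacian is the same
  scalar in every dimension.\<close>

lemma Laplacian_full:
  assumes "finite V" "g \<subseteq> V" "g' \<subseteq> V"
  shows "(\<Sum>t\<in>Pow V. inc g t * inc g' t) + (\<Sum>r\<in>Pow V. inc r g * inc r g') =
         (if g = g' then int (card V) else 0)"
proof (cases "g = g'")
  case True
  have fg: "finite g" using assms finite_subset by blast
  have "(\<Sum>t\<in>Pow V. inc g t * inc g t) = (\<Sum>t\<in>(\<lambda>v. insert v g) ` (V - g). inc g t * inc g t)"
  proof (rule sum.mono_neutral_right)
    show "\<forall>t\<in>Pow V - (\<lambda>v. insert v g) ` (V - g). inc g t * inc g t = 0"
    proof (rule ballI, rule ccontr)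
      fix t assume t: "t \<in> Pow V - (\<lambda>v. insert v g) ` (V - g)" and "inc g t * inc g t \<noteq> 0"
      then have "inc g t \<noteq> 0" by simp
      then obtain v where "v \<notin> g" "t = insert v g" by (rule inc_nonzeroE)
      then show False using t by auto
    qed
  qed (use assms in auto)
  also have "\<dots> = (\<Sum>v\<in>V - g. 1)"
  proof (subst sum.reindex)
    show "inj_on (\<lambda>v. insert v g) (V - g)" by (rule inj_onI) blast
  qed (auto intro!: sum.cong simp: inc_insert_square)
  also have "\<dots> = int (card V) - int (card g)"
    using assms fg by (simp add: card_Diff_subset card_mono of_nat_diff)
  finally have 1: "(\<Sum>t\<in>Pow V. inc g t * inc g t) = int (card V) - int (card g)" .
  have "(\<Sum>r\<in>Pow V. inc r g * inc r g) = (\<Sum>r\<in>(\<lambda>v. g - {v}) ` g. inc r g * inc r g)"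
  proof (rule sum.mono_neutral_right)
    show "\<forall>r\<in>Pow V - (\<lambda>v. g - {v}) ` g. inc r g * inc r g = 0"
    proof (rule ballI, rule ccontr)
      fix r assume r: "r \<in> Pow V - (\<lambda>v. g - {v}) ` g" and "inc r g * inc r g \<noteq> 0"
      then have "inc r g \<noteq> 0" by simp
      then obtain v where "v \<notin> r" "g = insert v r" by (rule inc_nonzeroE)
      then have "v \<in> g" "r = g - {v}" by auto
      then show False using r by blast
    qed
  qed (use assms in auto)
  also have "\<dots> = (\<Sum>v\<in>g. 1)"
  proof (subst sum.reindex)
    show "inj_on (\<lambda>v. g - {v}) g" by (rule inj_onI) blast
    show "sum ((\<lambda>r. inc r g * inc r g) \<circ> (\<lambda>v. g - {v})) g = (\<Sum>v\<in>g. 1)"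
    proof (rule sum.cong)
      fix v assume "v \<in> g"
      then show "((\<lambda>r. inc r g * inc r g) \<circ> (\<lambda>v. g - {v})) v = 1"
        using inc_insert_square[of v "g - {v}"] by (simp add: insert_absorb)
    qed simp
  qed
  finally have 2: "(\<Sum>r\<in>Pow V. inc r g * inc r g) = int (card g)" by simp
  show ?thesis using 1 2 True by simp
next
  case ne: False
  show ?thesis
  proof (cases "\<exists>a b r. a \<noteq> b \<and> a \<notin> r \<and> b \<notin> r \<and> g = insert a r \<and> g' = insert b r")
    case True
    then obtain a b r where ab: "a \<noteq> b" "a \<notin> r" "b \<notin> r" "g = insert a r" "g' = insert b r" by blast
    let ?t = "insert a (insert b r)"
    have fr: "finite r" using ab assms finite_subset by (metis finite_insert)
    have "(\<Sum>t\<in>Pow V. inc g t * inc g' t) = (\<Sum>t\<in>{?t}. inc g t * inc g' t)"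
    proof (rule sum.mono_neutral_right)
      show "\<forall>t\<in>Pow V - {?t}. inc g t * inc g' t = 0"
      proof (rule ballI, rule ccontr)
        fix t assume t: "t \<in> Pow V - {?t}" and "inc g t * inc g' t \<noteq> 0"
        then have "t = g \<union> g'" by (elim up_neighbours_common[OF _ ne]) auto
        then have "t = ?t" unfolding ab by auto
        then show False using t by simp
      qed
    qed (use assms ab in auto)
    moreover have "(\<Sum>r\<in>Pow V. inc r g * inc r g') = (\<Sum>r\<in>{r}. inc r g * inc r g')"
    proof (rule sum.mono_neutral_right)
      show "\<forall>r'\<in>Pow V - {r}. inc r' g * inc r' g' = 0"
      proof (rule ballI, rule ccontr)
        fix r' assume r: "r' \<in> Pow V - {r}" and "inc r' g * inc r' g' \<noteq> 0"
        then have "r' = g \<inter> g'" by (elim down_neighbours_common[OF _ ne]) auto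
        then have "r' = r" unfolding ab(4,5) using ab(1-3) by auto
        then show False using r by simp
      qed
    qed (use assms ab in auto)
    moreover have "inc g ?t * inc g' ?t = - (inc r g * inc r g')"
    proof -
      let ?x = "inc r g" and ?y = "inc g ?t" and ?z = "inc r g'" and ?w = "inc g' ?t"
      have 1: "?x * ?y = - (?z * ?w)" using inc_anticommute[OF fr ab(1-3)] ab by simp
      have 2: "?x * ?x = 1" using inc_insert_square[OF ab(2)] ab by simp
      have 3: "?w * ?w = 1" using inc_insert_square[of a "insert b r"] ab by simp
      \<comment> \<open>Incidence signs are their own inverses, so the anticommutation relation can
        be solved for the product wanted.\<close>
      have "?y * ?w = (?x * ?x) * (?y * ?w)" using 2 by simp
      also have "\<dots> = ?x * ?w * (?x * ?y)" by simp
      also have "\<dots> = - (?x * ?z * (?w * ?w))" unfolding 1 by simp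
      finally show ?thesis unfolding 3 by simp
    qed
    ultimately show ?thesis using ne by simp
  next
    case False
    have "(\<Sum>t\<in>Pow V. inc g t * inc g' t) = 0"
    proof (intro sum.neutral ballI, rule ccontr)
      fix t assume "inc g t * inc g' t \<noteq> 0"
      then show False using False by (elim up_neighbours_common[OF _ ne]) metis
    qed
    moreover have "(\<Sum>r\<in>Pow V. inc r g * inc r g') = 0"
    proof (intro sum.neutral ballI, rule ccontr)
      fix r assume "inc r g * inc r g' \<noteq> 0"
      then show False using False by (elim down_neighbours_common[OF _ ne]) metis
    qed
    ultimately show ?thesis using ne by simp
  qed
qed

text \<open>The second index counts vertices, one more than the dimension:
  \<open>ksub m (Suc k)\<close> holds the \<open>k\<close>-faces, and natural numbers reach the
  empty face as well.\<close>

definition ksub :: "nat \<Rightarrow> nat \<Rightarrow> nat set set" where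
  "ksub m j = {s. s \<subseteq> {1..m} \<and> card s = j}"

lemma ksub_finite_elem: "s \<in> ksub m j \<Longrightarrow> finite s"
  unfolding ksub_def using finite_subset by fastforce

lemma finite_ksub [simp]: "finite (ksub m j)"
  unfolding ksub_def by (rule finite_subset[of _ "Pow {1..m}"]) auto

lemma card_ksub: "card (ksub m j) = m choose j"
  unfolding ksub_def using n_subsets[of "{1..m}" j] by simp

lemma ksub_disjoint: "i \<noteq> j \<Longrightarrow> ksub m i \<inter> ksub n j = {}"
  unfolding ksub_def by auto

lemma ksub_subset_Pow: "ksub m j \<subseteq> Pow {1..m}"
  unfolding ksub_def by auto

definition gram :: "nat \<Rightarrow> nat set \<Rightarrow> nat set \<Rightarrow> int" where
  "gram m t t' = (\<Sum>g\<in>Pow {1..m}. inc g t * inc g t')"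

text \<open>This is \<partial>\<partial>^T\<partial> = m\<partial>: replace \<partial>\<partial>^T
  by m - \<partial>^T\<partial> and use \<partial>\<partial> = 0.\<close>

lemma inc_gram_sum:
  assumes "s \<subseteq> {1..m}" "t' \<subseteq> {1..m}"
  shows "(\<Sum>t\<in>Pow {1..m}. inc s t * gram m t t') = int m * inc s t'"
proof -
  let ?P = "Pow {1..m}"
  have "(\<Sum>t\<in>?P. inc s t * gram m t t') = (\<Sum>g\<in>?P. (\<Sum>t\<in>?P. inc s t * inc g t) * inc g t')"
    unfolding gram_def sum_distrib_left sum_distrib_right by (subst sum.swap) (simp add: mult_ac)
  also have "\<dots> = (\<Sum>g\<in>?P. ((if s = g then int m else 0) - (\<Sum>r\<in>?P. inc r s * inc r g)) * inc g t')"
  proof (intro sum.cong refl arg_cong2[where f = "(*)"])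
    fix g assume "g \<in> ?P"
    then show "(\<Sum>t\<in>?P. inc s t * inc g t) = (if s = g then int m else 0) - (\<Sum>r\<in>?P. inc r s * inc r g)"
      using Laplacian_full[of "{1..m}" s g] assms by (cases "s = g") simp_all
  qed
  also have "\<dots> = (\<Sum>g\<in>?P. if s = g then int m * inc g t' else 0) -
      (\<Sum>g\<in>?P. (\<Sum>r\<in>?P. inc r s * inc r g) * inc g t')"
    unfolding sum_subtractf[symmetric] by (intro sum.cong) (auto simp: algebra_simps)
  also have "(\<Sum>g\<in>?P. if s = g then int m * inc g t' else 0) = int m * inc s t'"
    using assms by simp
  also have "(\<Sum>g\<in>?P. (\<Sum>r\<in>?P. inc r s * inc r g) * inc g t') =
      (\<Sum>r\<in>?P. inc r s * (\<Sum>g\<in>?P. inc r g * inc g t'))"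
    unfolding sum_distrib_left sum_distrib_right by (subst sum.swap) (simp add: mult_ac)
  also have "\<dots> = 0"
    using assms by (intro sum.neutral ballI) (simp add: inc_inc_sum)
  finally show ?thesis by simp
qed

section \<open>Expansion along the last vertex\<close>

lemma inc_cone_nonzero:
  assumes "inc g (insert n s) \<noteq> 0" "n \<notin> s" "n \<notin> g"
  shows "g = s"
proof -
  obtain v where v: "v \<notin> g" "insert n s = insert v g" using assms(1) by (rule inc_nonzeroE)
  then have "n = v" using assms(3) by blast
  then show ?thesis using v assms(2) by auto
qed

lemma notin_ksub: "s \<in> ksub m k \<Longrightarrow> Suc m \<notin> s"
  unfolding ksub_def by auto

text \<open>A cycle is determined by its coefficients on the faces avoiding the cone vertex.\<close>

lemma inc_cone_expansion:
  assumes t: "t \<in> ksub (Suc m) (Suc k)" and g: "g \<subseteq> {1..Suc m}"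
  shows "inc g t = (\<Sum>s\<in>ksub m k. inc s t * inc s (insert (Suc m) s) * inc g (insert (Suc m) s))"
proof (cases "Suc m \<in> g")
  case False
  have "(\<Sum>s\<in>ksub m k. inc s t * inc s (insert (Suc m) s) * inc g (insert (Suc m) s)) =
      (\<Sum>s\<in>ksub m k. if s = g then inc g t else 0)"
  proof (rule sum.cong)
    fix s assume s: "s \<in> ksub m k"
    show "inc s t * inc s (insert (Suc m) s) * inc g (insert (Suc m) s) = (if s = g then inc g t else 0)"
      using inc_cone_nonzero[of g "Suc m" s] inc_insert_square[OF notin_ksub[OF s]] notin_ksub[OF s] False
      by (auto simp: mult.assoc)
  qed simp
  also have "\<dots> = (if g \<in> ksub m k then inc g t else 0)" by simp
  also have "\<dots> = inc g t"
  proof -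
    have "g \<in> ksub m k" if "inc g t \<noteq> 0"
    proof -
      have "card t = Suc (card g)"
        using inc_nonzero_cards[OF that] g finite_subset by blast
      moreover have "g \<subseteq> {1..m}" using g False by (auto simp: subset_iff le_Suc_eq)
      ultimately show ?thesis using t by (simp add: ksub_def)
    qed
    then show ?thesis by auto
  qed
  finally show ?thesis by simp
next
  case True
  let ?n = "Suc m"
  define r where "r = g - {?n}"
  have r: "g = insert ?n r" "?n \<notin> r" "r \<subseteq> {1..?n}" using True g by (auto simp: r_def)
  have gR: "g \<notin> ksub m k" using notin_ksub True by blast
  \<comment> \<open>This is \<partial>\<partial> = 0 read at \<open>r\<close>. Among the cofaces of
    \<open>r\<close> only \<open>g\<close> contains the last vertex, so its term is determined by
    those in \<open>ksub m k\<close>.\<close>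
  have red: "inc r g * inc g t' = - (\<Sum>s\<in>ksub m k. inc r s * inc s t')"
    if t': "t' \<in> ksub ?n (Suc k)" for t'
  proof -
    have "0 = (\<Sum>g'\<in>Pow {1..?n}. inc r g' * inc g' t')"
      using t' r by (subst inc_inc_sum) (auto simp: ksub_def)
    also have "\<dots> = (\<Sum>g'\<in>insert g (ksub m k). inc r g' * inc g' t')"
    proof (rule sum.mono_neutral_right)
      show "insert g (ksub m k) \<subseteq> Pow {1..?n}" using g unfolding ksub_def by auto
      show "\<forall>g'\<in>Pow {1..?n} - insert g (ksub m k). inc r g' * inc g' t' = 0"
      proof (rule ballI, rule ccontr)
        fix g' assume g: "g' \<in> Pow {1..?n} - insert g (ksub m k)" and "inc r g' * inc g' t' \<noteq> 0"
        then have nz: "inc r g' \<noteq> 0" "inc g' t' \<noteq> 0" by auto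
        have "card t' = Suc (card g')"
          using inc_nonzero_cards[OF nz(2)] g finite_subset by blast
        then have "card g' = k" using t' by (simp add: ksub_def)
        moreover have "?n \<notin> g'" using nz(1) r g by (elim inc_nonzeroE) auto
        then have "g' \<subseteq> {1..m}" using g by (auto simp: subset_iff le_Suc_eq)
        ultimately show False using g by (simp add: ksub_def)
      qed
    qed simp
    finally show ?thesis using gR by simp
  qed
  have sq: "inc r g * inc r g = 1" using inc_insert_square r by simp
  have cone: "inc r g * inc g (insert ?n s) = - (inc r s * inc s (insert ?n s))" if s: "s \<in> ksub m k" for s
  proof -
    have "insert ?n s \<in> ksub ?n (Suc k)"
      using s notin_ksub[OF s] ksub_finite_elem[OF s] by (auto simp: ksub_def subset_iff le_Suc_eq)
    then have "inc r g * inc g (insert ?n s) = - (\<Sum>s'\<in>ksub m k. inc r s' * inc s' (insert ?n s))"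
      by (rule red)
    also have "(\<Sum>s'\<in>ksub m k. inc r s' * inc s' (insert ?n s)) =
        (\<Sum>s'\<in>ksub m k. if s' = s then inc r s * inc s (insert ?n s) else 0)"
      using inc_cone_nonzero[of _ ?n s] notin_ksub s by (intro sum.cong) auto
    finally show ?thesis using s by simp
  qed
  have "inc g t = inc r g * (inc r g * inc g t)" using sq by (simp flip: mult.assoc)
  also have "\<dots> = inc r g * (\<Sum>s\<in>ksub m k. - (inc r s * inc s t))" using red[OF t] by (simp add: sum_negf)
  also have "(\<Sum>s\<in>ksub m k. - (inc r s * inc s t)) =
      (\<Sum>s\<in>ksub m k. inc r g * (inc s t * inc s (insert ?n s) * inc g (insert ?n s)))"
  proof (rule sum.cong)
    fix s assume s: "s \<in> ksub m k"
    have "inc r g * (inc s t * inc s (insert ?n s) * inc g (insert ?n s)) =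
       inc s t * inc s (insert ?n s) * (inc r g * inc g (insert ?n s))" by simp
    also have "\<dots> = - (inc s t * inc r s * (inc s (insert ?n s) * inc s (insert ?n s)))"
      unfolding cone[OF s] by simp
    also have "\<dots> = - (inc r s * inc s t)"
      unfolding inc_insert_square[OF notin_ksub[OF s]] by simp
    finally show "- (inc r s * inc s t) =
       inc r g * (inc s t * inc s (insert ?n s) * inc g (insert ?n s))" by simp
  qed simp
  also have "inc r g * \<dots> = (inc r g * inc r g) *
      (\<Sum>s\<in>ksub m k. inc s t * inc s (insert ?n s) * inc g (insert ?n s))"
    by (simp add: sum_distrib_left mult.assoc)
  finally show ?thesis using sq by simp
qed

text \<open>The boundary of \<open>t\<close>, written through boundaries of cones, is paired with
  that of \<open>t'\<close>. The Gram rows at the cones thus generate the others, which is why cones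
  enter the explicit inverse below.\<close>

lemma gram_cone_expansion:
  assumes "t \<in> ksub (Suc m) (Suc k)"
  shows "gram (Suc m) t t' =
    (\<Sum>s\<in>ksub m k. inc s t * inc s (insert (Suc m) s) * gram (Suc m) (insert (Suc m) s) t')"
proof -
  let ?P = "Pow {1..Suc m}"
  have "gram (Suc m) t t' = (\<Sum>g\<in>?P. (\<Sum>s\<in>ksub m k. inc s t * inc s (insert (Suc m) s) *
      inc g (insert (Suc m) s)) * inc g t')"
    unfolding gram_def using inc_cone_expansion[OF assms] by (intro sum.cong) auto
  also have "\<dots> = (\<Sum>s\<in>ksub m k. inc s t * inc s (insert (Suc m) s) * gram (Suc m) (insert (Suc m) s) t')"
    unfolding gram_def sum_distrib_left sum_distrib_right by (subst sum.swap) (simp add: mult_ac)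
  finally show ?thesis .
qed

section \<open>Hypertree weights as principal minors\<close>

definition dirac :: "nat set \<Rightarrow> nat set \<Rightarrow> int" where
  "dirac s t = inc s t - inc t s"

text \<open>Stated for \<open>S\<close> of any size: for sets of \<open>k\<close>-faces of the wrong
  size the determinant vanishes, so sums may run over the full power set of the
  \<open>k\<close>-faces.\<close>

definition weight :: "nat \<Rightarrow> nat \<Rightarrow> nat set set \<Rightarrow> int" where
  "weight m k S = sdet (ksub (m - 1) k \<union> S) dirac"

lemma inc_ksub_eq_0:
  assumes "s \<in> ksub m i" "t \<in> ksub n j" "j \<noteq> Suc i"
  shows "inc s t = 0"
  using inc_nonzero_cards[of s t] ksub_finite_elem[OF assms(1)] assms by (auto simp: ksub_def)

lemma inc_up_ksub:
  assumes "inc s t \<noteq> 0" "s \<in> ksub m i" "t \<subseteq> {1..n}"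
  shows "t \<in> ksub n (Suc i)"
  using inc_nonzero_cards[OF assms(1) ksub_finite_elem[OF assms(2)]] assms by (auto simp: ksub_def)

lemma inc_down_ksub:
  assumes "inc s t \<noteq> 0" "t \<in> ksub m (Suc i)"
  shows "s \<in> ksub m i"
proof -
  obtain v where v: "v \<notin> s" "t = insert v s" using assms(1) by (rule inc_nonzeroE)
  then have "finite s" using ksub_finite_elem[OF assms(2)] by simp
  then show ?thesis using v assms(2) by (auto simp: ksub_def)
qed

lemma cone_in_ksub: "s \<in> ksub m k \<Longrightarrow> insert (Suc m) s \<in> ksub (Suc m) (Suc k)"
  using notin_ksub[of s m k] ksub_finite_elem[of s m k] by (auto simp: ksub_def subset_iff le_Suc_eq)

lemma sum_inc_gram_ksub:
  assumes "s \<in> ksub m k" "t' \<in> ksub (Suc m) j"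
  shows "(\<Sum>t\<in>ksub (Suc m) (Suc k). inc s t * gram (Suc m) t t') = int (Suc m) * inc s t'"
proof -
  have "(\<Sum>t\<in>ksub (Suc m) (Suc k). inc s t * gram (Suc m) t t') =
      (\<Sum>t\<in>Pow {1..Suc m}. inc s t * gram (Suc m) t t')"
    using inc_up_ksub[OF _ assms(1)] ksub_subset_Pow[of "Suc m" "Suc k"]
    by (intro sum.mono_neutral_left) fastforce+
  also have "\<dots> = int (Suc m) * inc s t'"
    using assms by (intro inc_gram_sum) (auto simp: ksub_def)
  finally show ?thesis .
qed

text \<open>In blocks over \<open>R\<close> and \<open>F\<close> the matrix is [[0, D], [-D^T, 1]],
  where \<open>D\<close> consists of the boundary rows at \<open>R\<close>. The inverse, multiplied
  by m+1, has \<open>F\<close>-block m+1 - G because D G = (m+1) D. Its columns over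
  \<open>R\<close> are Gram columns at cones, because \<open>D\<close> restricted to the cones is
  diagonal with entries 1 or -1. Only the \<open>F\<close>-block is needed later.\<close>

lemma dirac_inverse:
  fixes m k :: nat
  defines "R \<equiv> ksub m k" and "F \<equiv> ksub (Suc m) (Suc k)"
  obtains N :: "nat set \<Rightarrow> nat set \<Rightarrow> real" where
    "\<And>i j. i \<in> R \<union> F \<Longrightarrow> j \<in> R \<union> F \<Longrightarrow>
       (\<Sum>l\<in>R \<union> F. (real_of_int (dirac i l) + (if i = l \<and> i \<in> F then 1 else 0)) * N l j) = (if i = j then 1 else 0)"
    "\<And>i j. i \<in> F \<Longrightarrow> j \<in> F \<Longrightarrow> N i j = (if i = j then 1 else 0) - real_of_int (gram (Suc m) i j) / real (Suc m)"
proof -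
  let ?n = "Suc m"
  \<comment> \<open>\<open>c\<close> replaces an index in \<open>R\<close> by its cone,
    \<open>e\<close> is the sign of that incidence, and \<open>s\<close> separates the columns over
    \<open>R\<close> from those over \<open>F\<close>. With them one formula covers all four
    blocks.\<close>
  define c where "c i = (if i \<in> R then insert ?n i else i)" for i
  define e where "e i = (if i \<in> R then inc i (insert ?n i) else 1)" for i
  define s :: "nat set \<Rightarrow> int" where "s j = (if j \<in> R then 1 else - 1)" for j
  define M where "M i j = (if i = j \<and> i \<in> F then int ?n else 0) + s j * e i * e j * gram ?n (c i) (c j)" for i j
  define X where "X i l = dirac i l + (if i = l \<and> i \<in> F then 1 else 0)" for i l
  have RF: "R \<inter> F = {}" unfolding R_def F_def by (rule ksub_disjoint) simp
  have fin: "finite R" "finite F" unfolding R_def F_def by auto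
  have cF: "c j \<in> F" if "j \<in> R \<union> F" for j
    using that RF cone_in_ksub unfolding c_def R_def F_def by auto
  have XM: "(\<Sum>l\<in>R \<union> F. X i l * M l j) = (if i = j then int ?n else 0)" if i: "i \<in> R \<union> F" and j: "j \<in> R \<union> F" for i j
  proof -
    have split: "(\<Sum>l\<in>R \<union> F. X i l * M l j) = (\<Sum>l\<in>R. X i l * M l j) + (\<Sum>l\<in>F. X i l * M l j)"
      using RF fin by (intro sum.union_disjoint) auto
    show ?thesis
    proof (cases "i \<in> R")
      case iR: True
      then have "i \<notin> F" using RF by blast
      have "(\<Sum>l\<in>R. X i l * M l j) = 0"
        using iR \<open>i \<notin> F\<close> unfolding R_def by (intro sum.neutral ballI) (simp add: X_def dirac_def inc_ksub_eq_0)
      moreover have "(\<Sum>l\<in>F. X i l * M l j) =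
          (\<Sum>l\<in>F. (if l = j then int ?n * inc i j else 0) + s j * e j * (inc i l * gram ?n l (c j)))"
      proof (rule sum.cong)
        fix l assume l: "l \<in> F"
        then have "l \<notin> R" using RF by blast
        moreover have "X i l = inc i l"
          using inc_ksub_eq_0[of l ?n "Suc k" i m k] l iR \<open>i \<notin> F\<close> unfolding R_def F_def by (simp add: X_def dirac_def F_def)
        ultimately show "X i l * M l j = (if l = j then int ?n * inc i j else 0) + s j * e j * (inc i l * gram ?n l (c j))"
          using l by (auto simp: M_def c_def e_def algebra_simps)
      qed simp
      moreover have "\<dots> = (if j \<in> F then int ?n * inc i j else 0) + s j * e j * (int ?n * inc i (c j))"
        using sum_inc_gram_ksub[of i m k "c j" "Suc k"] iR cF[OF j] fin
        by (simp add: sum.distrib R_def F_def flip: sum_distrib_left)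
      ultimately have eq: "(\<Sum>l\<in>R \<union> F. X i l * M l j) =
          (if j \<in> F then int ?n * inc i j else 0) + s j * e j * (int ?n * inc i (c j))"
        using split by simp
      show ?thesis
      proof (cases "j \<in> R")
        case True
        then have "j \<notin> F" using RF by blast
        moreover have "inc j (insert ?n j) * inc i (insert ?n j) = (if i = j then 1 else 0)"
          using inc_cone_nonzero[of i ?n j] notin_ksub iR True inc_insert_square[of ?n j] unfolding R_def by auto
        ultimately show ?thesis unfolding eq using True by (cases "i = j") (simp_all add: s_def e_def c_def)
      next
        case False
        then have "j \<in> F" "i \<noteq> j" using j iR RF by blast+
        then show ?thesis unfolding eq using False by (simp add: s_def e_def c_def)
      qed
    next
      case False
      then have iF: "i \<in> F" using i by blast
      have "(\<Sum>l\<in>F. X i l * M l j) = (\<Sum>l\<in>F. if l = i then M i j else 0)"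
        using iF unfolding F_def by (intro sum.cong) (auto simp: X_def dirac_def F_def inc_ksub_eq_0)
      also have "\<dots> = M i j" using iF fin by simp
      finally have 1: "(\<Sum>l\<in>F. X i l * M l j) = M i j" .
      have "(\<Sum>l\<in>R. X i l * M l j) =
         (\<Sum>l\<in>R. - (s j * e j) * (inc l i * inc l (insert ?n l) * gram ?n (insert ?n l) (c j)))"
      proof (rule sum.cong)
        fix l assume l: "l \<in> R"
        then have "l \<notin> F" "i \<noteq> l" using RF iF by blast+
        moreover have "X i l = - inc l i"
          using inc_ksub_eq_0[of i ?n "Suc k" l m k] l iF \<open>i \<noteq> l\<close> unfolding R_def F_def by (simp add: X_def dirac_def)
        ultimately show "X i l * M l j = - (s j * e j) * (inc l i * inc l (insert ?n l) * gram ?n (insert ?n l) (c j))"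
          using l by (simp add: M_def c_def e_def)
      qed simp
      also have "\<dots> = - (s j * e j) * gram ?n i (c j)"
        using gram_cone_expansion[of i m k "c j"] iF unfolding R_def F_def by (simp only: sum_distrib_left)
      finally show ?thesis unfolding split 1 using False iF by (auto simp: M_def c_def e_def)
    qed
  qed
  show ?thesis
  proof (rule that[of "\<lambda>i j. real_of_int (M i j) / real ?n"])
    fix i j assume ij: "i \<in> R \<union> F" "j \<in> R \<union> F"
    have "(\<Sum>l\<in>R \<union> F. (real_of_int (dirac i l) + (if i = l \<and> i \<in> F then 1 else 0)) * (real_of_int (M l j) / real ?n)) =
        real_of_int (\<Sum>l\<in>R \<union> F. X i l * M l j) / real ?n"
      unfolding of_int_sum sum_divide_distrib by (intro sum.cong) (auto simp: X_def)
    also have "\<dots> = (if i = j then 1 else 0)" unfolding XM[OF ij] by simp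
    finally show "(\<Sum>l\<in>R \<union> F. (real_of_int (dirac i l) + (if i = l \<and> i \<in> F then 1 else 0)) * (real_of_int (M l j) / real ?n)) =
      (if i = j then 1 else 0)" .
  next
    fix i j assume ij: "i \<in> F" "j \<in> F"
    then have "i \<notin> R" "j \<notin> R" using RF by blast+
    then show "real_of_int (M i j) / real ?n = (if i = j then 1 else 0) - real_of_int (gram ?n i j) / real ?n"
      using ij by (simp add: M_def s_def e_def c_def diff_divide_distrib)
  qed
qed

section \<open>Sums of weights over the sets containing or avoiding given faces\<close>

definition total_weight :: "nat \<Rightarrow> nat \<Rightarrow> int" where
  "total_weight m k = (\<Sum>T\<in>Pow (ksub m (Suc k)). weight m k T)"

lemma sum_Pow_complement:
  assumes "finite F"
  shows "(\<Sum>S\<in>Pow F. f (F - S)) = (\<Sum>S\<in>Pow F. f S)"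
  by (rule sum.reindex_bij_witness[where i = "\<lambda>S. F - S" and j = "\<lambda>S. F - S"]) (auto simp: double_diff)

lemma sum_minors_complement:
  assumes "finite F" "R \<inter> F = {}" "C \<subseteq> F"
  shows "(\<Sum>S\<in>Pow C. f (R \<union> F - S)) = (\<Sum>S\<in>Pow C. f (R \<union> (F - C) \<union> S))"
proof -
  have "(\<Sum>S\<in>Pow C. f (R \<union> F - S)) = (\<Sum>S\<in>Pow C. f (R \<union> (F - C) \<union> (C - S)))"
    using assms by (intro sum.cong refl arg_cong[where f = f]) blast
  also have "\<dots> = (\<Sum>S\<in>Pow C. f (R \<union> (F - C) \<union> S))"
    using sum_Pow_complement[of C "\<lambda>S. f (R \<union> (F - C) \<union> S)"] assms finite_subset by blast
  finally show ?thesis .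
qed

text \<open>Forcing \<open>B\<close> into the set drops the added diagonal ones at \<open>B\<close>;
  forbidding \<open>B\<close> turns its rows into identity rows. Either way only the rows of
  \<open>B\<close> change, so each sum is the total times a minor of size |B|, read off from the
  \<open>F\<close>-block of the inverse. The power of m+1 clears denominators.\<close>

lemma superset_weights_minor:
  assumes "B \<subseteq> ksub (Suc m) (Suc k)"
  shows "(\<Sum>S\<in>Pow (ksub (Suc m) (Suc k) - B). weight (Suc m) k (B \<union> S)) * int (Suc m) ^ card B =
         total_weight (Suc m) k * sdet B (gram (Suc m))" (is ?A)
    and "(\<Sum>S\<in>Pow (ksub (Suc m) (Suc k) - B). weight (Suc m) k S) * int (Suc m) ^ card B =
         total_weight (Suc m) k * sdet B (\<lambda>i j. (if i = j then int (Suc m) else 0) - gram (Suc m) i j)" (is ?B)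
    and "total_weight (Suc m) k \<noteq> 0" (is ?C)
proof -
  let ?n = "Suc m"
  define R where "R = ksub m k"
  define F where "F = ksub ?n (Suc k)"
  let ?U = "R \<union> F"
  let ?d = "\<lambda>i l. real_of_int (dirac i l)"
  let ?E = "\<lambda>D i l. ?d i l + (if i = l \<and> i \<in> F - D then 1 else 0)"
  let ?X = "\<lambda>i l. real_of_int (dirac i l) + (if i = l \<and> i \<in> F then 1 else 0)"
  let ?g = "\<lambda>i j. real_of_int (gram ?n i j) / real ?n"
  obtain N where inv: "\<And>i j. i \<in> ?U \<Longrightarrow> j \<in> ?U \<Longrightarrow> (\<Sum>l\<in>?U. ?X i l * N l j) = (if i = j then 1 else 0)"
    and NF: "\<And>i j. i \<in> F \<Longrightarrow> j \<in> F \<Longrightarrow> N i j = (if i = j then 1 else 0) - ?g i j"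
    unfolding R_def F_def by (rule dirac_inverse[of m k]) blast
  have RF: "R \<inter> F = {}" unfolding R_def F_def by (rule ksub_disjoint) simp
  then have RFB: "R \<inter> (F - B) = {}" by blast
  have fin: "finite R" "finite F" "finite ?U" unfolding R_def F_def by auto
  have BF: "B \<subseteq> F" and BU: "B \<subseteq> ?U" using assms unfolding F_def by auto
  then have fB: "finite B" using fin finite_subset by blast
  have w: "weight ?n k S = sdet (R \<union> S) dirac" for S by (simp add: weight_def R_def)
  have of_int_w: "real_of_int (weight ?n k S) = sdet (R \<union> S) ?d" for S
    unfolding w sdet_of_int ..
  have minors: "sdet ?U (?E D) =
      real_of_int (\<Sum>S\<in>Pow (F - D). weight ?n k (D \<union> S))" if "D \<subseteq> F" for D
  proof -
    have "sdet ?U (?E D) =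
        (\<Sum>S\<in>Pow (F - D). sdet (R \<union> F - S) ?d)"
      using fin by (intro sdet_principal_minors) auto
    also have "\<dots> = (\<Sum>S\<in>Pow (F - D). sdet (R \<union> (F - (F - D)) \<union> S) ?d)"
      using sum_minors_complement[OF fin(2) RF, of "F - D" "\<lambda>S. sdet S ?d"] by simp
    also have "F - (F - D) = D" using that by blast
    finally show ?thesis by (simp only: of_int_sum of_int_w Un_assoc)
  qed
  have tot: "sdet ?U ?X = real_of_int (total_weight ?n k)"
    using minors[of "{}"] by (simp add: total_weight_def F_def)
  have scale: "sdet B (\<lambda>i j. real_of_int (a i j) / real ?n) * real ?n ^ card B = real_of_int (sdet B a)" for a
    using sdet_scale[OF fB, of "1 / real ?n" "\<lambda>i j. real_of_int (a i j)"] by (simp add: sdet_of_int power_one_over)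
  show ?C
  proof
    assume "total_weight ?n k = 0"
    then have "sdet ?U ?X = 0" using tot by simp
    moreover have "sdet ?U ?X * sdet ?U N = sdet ?U (\<lambda>i j. if i = j then 1 else 0)"
      unfolding sdet_mult[OF fin(3), symmetric] using inv by (intro sdet_cong)
    moreover have "\<dots> = (1 :: real)" using fin(3) by (rule sdet_identity)
    ultimately show False by simp
  qed
  show ?A
  proof -
    let ?Y = "\<lambda>i l. real_of_int (dirac i l) + (if i = l \<and> i \<in> F - B then 1 else 0)"
    have "real_of_int (\<Sum>S\<in>Pow (F - B). weight ?n k (B \<union> S)) = sdet ?U ?Y" using minors[OF BF] by simp
    also have "\<dots> = sdet ?U ?X * sdet B (\<lambda>i j. \<Sum>l\<in>?U. ?Y i l * N l j)"
      by (rule sdet_replace_rows[OF fin(3) BU inv]) auto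
    also have "sdet B (\<lambda>i j. \<Sum>l\<in>?U. ?Y i l * N l j) = sdet B ?g"
    proof (rule sdet_cong)
      fix i j assume ij: "i \<in> B" "j \<in> B"
      then have iU: "i \<in> ?U" and jU: "j \<in> ?U" using BU by auto
      \<comment> \<open>Row \<open>i\<close> of \<open>Y\<close> is that of \<open>X\<close> minus a
        unit vector, so on \<open>B\<close> the product \<open>Y N\<close> is 1 - N.\<close>
      have "(\<Sum>l\<in>?U. ?Y i l * N l j) = (\<Sum>l\<in>?U. ?X i l * N l j - (if l = i then N i j else 0))"
        using ij BF by (intro sum.cong) (auto simp: algebra_simps)
      also have "\<dots> = (if i = j then 1 else 0) - N i j"
        unfolding sum_subtractf inv[OF iU jU] using iU fin by simp
      also have "\<dots> = ?g i j" using NF[OF subsetD[OF BF ij(1)] subsetD[OF BF ij(2)]] by simp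
      finally show "(\<Sum>l\<in>?U. ?Y i l * N l j) = ?g i j" .
    qed
    finally have "real_of_int (\<Sum>S\<in>Pow (F - B). weight ?n k (B \<union> S)) * real ?n ^ card B =
        real_of_int (total_weight ?n k) * real_of_int (sdet B (gram ?n))"
      unfolding tot scale[symmetric] by simp
    then have "real_of_int ((\<Sum>S\<in>Pow (F - B). weight ?n k (B \<union> S)) * int ?n ^ card B) =
        real_of_int (total_weight ?n k * sdet B (gram ?n))" by simp
    then show ?thesis unfolding of_int_eq_iff F_def .
  qed
  show ?B
  proof -
    let ?Y = "\<lambda>i l. if i \<in> B then if i = l then 1 else 0 else ?X i l"
    have "real_of_int (\<Sum>S\<in>Pow (F - B). weight ?n k S) = (\<Sum>S\<in>Pow (F - B). sdet (R \<union> S) ?d)"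
      by (simp add: of_int_w)
    also have "\<dots> = (\<Sum>S\<in>Pow (F - B). sdet (R \<union> (F - B) - S) ?d)"
      using sum_minors_complement[OF _ RFB subset_refl, of "\<lambda>S. sdet S ?d"] fin by simp
    also have "\<dots> = sdet (R \<union> (F - B)) (\<lambda>i l. real_of_int (dirac i l) + (if i = l \<and> i \<in> F - B then 1 else 0))"
      using fin by (intro sdet_principal_minors[symmetric]) auto
    also have "\<dots> = sdet (R \<union> (F - B)) ?Y"
      using BF RF by (intro sdet_cong) auto
    \<comment> \<open>An index whose row is a unit vector does not affect the determinant, so the
      forbidden faces may be put back.\<close>
    also have "\<dots> = sdet ?U ?Y"
      using fin by (intro sdet_identity_rows[symmetric]) auto
    also have "\<dots> = sdet ?U ?X * sdet B (\<lambda>i j. \<Sum>l\<in>?U. ?Y i l * N l j)"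
      by (rule sdet_replace_rows[OF fin(3) BU inv]) auto
    also have "sdet B (\<lambda>i j. \<Sum>l\<in>?U. ?Y i l * N l j) =
        sdet B (\<lambda>i j. real_of_int ((if i = j then int ?n else 0) - gram ?n i j) / real ?n)"
    proof (rule sdet_cong)
      fix i j assume ij: "i \<in> B" "j \<in> B"
      have "(\<Sum>l\<in>?U. ?Y i l * N l j) = (\<Sum>l\<in>?U. if l = i then N i j else 0)"
        using ij by (intro sum.cong) auto
      also have "\<dots> = N i j" using ij BU fin by auto
      also have "\<dots> = real_of_int ((if i = j then int ?n else 0) - gram ?n i j) / real ?n"
        using NF[OF subsetD[OF BF ij(1)] subsetD[OF BF ij(2)]] by (simp add: diff_divide_distrib)
      finally show "(\<Sum>l\<in>?U. ?Y i l * N l j) = real_of_int ((if i = j then int ?n else 0) - gram ?n i j) / real ?n" .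
    qed
    finally have "real_of_int (\<Sum>S\<in>Pow (F - B). weight ?n k S) * real ?n ^ card B =
        real_of_int (total_weight ?n k) * real_of_int (sdet B (\<lambda>i j. (if i = j then int ?n else 0) - gram ?n i j))"
      unfolding tot scale[symmetric] by simp
    then have "real_of_int ((\<Sum>S\<in>Pow (F - B). weight ?n k S) * int ?n ^ card B) =
        real_of_int (total_weight ?n k * sdet B (\<lambda>i j. (if i = j then int ?n else 0) - gram ?n i j))" by simp
    then show ?thesis unfolding of_int_eq_iff F_def .
  qed
qed

section \<open>Elimination of the cone faces\<close>

lemma dirac_antisym: "dirac t s = - dirac s t"
  by (simp add: dirac_def)

lemma dirac_same_card:
  assumes "s \<in> ksub m j" "t \<in> ksub n j"
  shows "dirac s t = 0"
  using inc_ksub_eq_0[OF assms] inc_ksub_eq_0[OF assms(2,1)] by (simp add: dirac_def)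

lemma dirac_up:
  assumes "s \<in> ksub m k" "t \<in> ksub n (Suc k)"
  shows "dirac s t = inc s t"
  using inc_ksub_eq_0[OF assms(2,1)] by (simp add: dirac_def)

definition cone_join :: "nat \<Rightarrow> nat set set \<Rightarrow> nat set set \<Rightarrow> nat set set" where
  "cone_join m A B = insert (Suc m) ` A \<union> B"

text \<open>All faces in \<open>Q\<close> and \<open>B\<close> avoid the last vertex, so among the
  indices present a cone face is incident only to its base. Base and cone leave together, with
  factor \<open>inc\<close> squared, that is 1. \<open>Q\<close> shrinks along the
  induction.\<close>

lemma sdet_cone_pairs:
  assumes "finite A" "A \<subseteq> Q" "Q \<subseteq> ksub m k" "B \<subseteq> ksub m (Suc k)"
  shows "sdet (Q \<union> cone_join m A B) dirac = sdet ((Q - A) \<union> B) dirac"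
  using assms
proof (induction A arbitrary: Q)
  case empty
  then show ?case by (simp add: cone_join_def)
next
  case (insert s A)
  let ?n = "Suc m"
  let ?y = "insert ?n s"
  let ?S = "Q \<union> cone_join m (insert s A) B"
  have s: "s \<in> Q" "s \<in> ksub m k" and ns: "?n \<notin> s" using insert.prems notin_ksub by blast+
  have y: "?y \<in> ksub ?n (Suc k)" using s(2) by (rule cone_in_ksub)
  have nQ: "?n \<notin> j" if "j \<in> Q \<union> A \<union> B" for j using that insert.prems notin_ksub by blast
  have Sj: "j \<in> Q \<or> (\<exists>l. j \<in> ksub l (Suc k))" if "j \<in> ?S" for j
    using that insert.prems cone_in_ksub[of _ m k] unfolding cone_join_def by blast
  have zero: "dirac ?y j = 0" if "j \<in> ?S" "j \<noteq> s" for j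
    using Sj[OF that(1)]
  proof
    assume j: "j \<in> Q"
    have "dirac j ?y = inc j ?y" using j insert.prems y by (intro dirac_up) auto
    then show ?thesis using inc_cone_nonzero[of j ?n s] nQ[of j] j ns that(2) dirac_antisym[of ?y j] by auto
  next
    assume "\<exists>l. j \<in> ksub l (Suc k)"
    then show ?thesis using dirac_same_card[OF y] by blast
  qed
  have "sdet ?S dirac = - (dirac s ?y * dirac ?y s) * sdet (?S - {s, ?y}) dirac"
  proof (rule sdet_remove_pair)
    show "finite ?S" using insert.hyps insert.prems finite_subset[OF _ finite_ksub] by (auto simp: cone_join_def)
    show "s \<in> ?S" "?y \<in> ?S" "s \<noteq> ?y" using s ns by (auto simp: cone_join_def)
    show "dirac i ?y = 0" if "i \<in> ?S" "i \<noteq> s" for i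
      using zero[OF that] dirac_antisym[of i ?y] by simp
  qed (rule zero)
  moreover have "- (dirac s ?y * dirac ?y s) = 1"
    using dirac_up[OF s(2) y] dirac_antisym[of ?y s] inc_insert_square[OF ns] by simp
  moreover have "?S - {s, ?y} = (Q - {s}) \<union> cone_join m A B"
  proof -
    have "?y \<notin> insert ?n ` A"
    proof
      assume "?y \<in> insert ?n ` A"
      then obtain t where t: "t \<in> A" "insert ?n s = insert ?n t" by blast
      then have "s = t" using insert_ident[OF ns, of t] nQ[of t] by simp
      then show False using t insert.hyps by simp
    qed
    moreover have "?y \<notin> Q" "?y \<notin> B" using nQ[of ?y] by auto
    moreover have "s \<notin> insert ?n ` A" using ns by auto
    moreover have "s \<notin> B" using ksub_disjoint[of k "Suc k" m m] s(2) insert.prems by auto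
    ultimately show ?thesis unfolding cone_join_def by auto
  qed
  moreover have "sdet ((Q - {s}) \<union> cone_join m A B) dirac = sdet ((Q - {s} - A) \<union> B) dirac"
    using insert.prems insert.hyps by (intro insert.IH) auto
  moreover have "Q - {s} - A = Q - insert s A" by blast
  ultimately show ?case by simp
qed

lemma weight_cone_join:
  assumes "A \<subseteq> ksub m k" "B \<subseteq> ksub m (Suc k)"
  shows "weight (Suc m) k (cone_join m A B) = sdet ((ksub m k - A) \<union> B) dirac"
  using sdet_cone_pairs[of A "ksub m k" m k B] assms finite_subset[OF assms(1)] by (simp add: weight_def)

text \<open>Letting \<open>A\<close> vary puts ones on the diagonal over all of
  \<open>ksub m k\<close>. The Schur complement of this identity block is 0 - (-D^T) D, with
  \<open>D\<close> now the boundary on m vertices, and this is the Gram matrix.\<close>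

lemma sum_weight_over_link:
  assumes B: "B \<subseteq> ksub m (Suc k)"
  shows "(\<Sum>A\<in>Pow (ksub m k). weight (Suc m) k (cone_join m A B)) = sdet B (gram m)"
proof -
  let ?\<Gamma> = "ksub m k"
  let ?M = "\<lambda>i j. dirac i j + (if i = j \<and> i \<in> ?\<Gamma> then 1 else 0)"
  have fB: "finite B" using B finite_subset finite_ksub by blast
  have disj: "?\<Gamma> \<inter> B = {}" using ksub_disjoint[of k "Suc k" m m] B by auto
  have "(\<Sum>A\<in>Pow ?\<Gamma>. weight (Suc m) k (cone_join m A B)) = (\<Sum>A\<in>Pow ?\<Gamma>. sdet (?\<Gamma> \<union> B - A) dirac)"
  proof (rule sum.cong)
    fix A assume "A \<in> Pow ?\<Gamma>"
    then have "(?\<Gamma> - A) \<union> B = ?\<Gamma> \<union> B - A" using disj by blast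
    then show "weight (Suc m) k (cone_join m A B) = sdet (?\<Gamma> \<union> B - A) dirac"
      using weight_cone_join[of A m k B] \<open>A \<in> Pow ?\<Gamma>\<close> B by simp
  qed simp
  also have "\<dots> = sdet (?\<Gamma> \<union> B) ?M"
    using fB by (intro sdet_principal_minors[symmetric]) auto
  also have "\<dots> = sdet B (\<lambda>i j. ?M i j -
     (\<Sum>s\<in>?\<Gamma>. ?M i s * ?M s j))"
    using fB disj by (intro sdet_Schur) (auto simp: dirac_same_card)
  also have "\<dots> = sdet B (gram m)"
  proof (rule sdet_cong)
    fix i j assume ij: "i \<in> B" "j \<in> B"
    then have iG: "i \<notin> ?\<Gamma>" and jG: "j \<notin> ?\<Gamma>" using disj by auto
    have ik: "i \<in> ksub m (Suc k)" and jk: "j \<in> ksub m (Suc k)" using ij B by auto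
    have "(\<Sum>s\<in>?\<Gamma>. ?M i s * ?M s j) =
       (\<Sum>s\<in>?\<Gamma>. - (inc s i * inc s j))"
    proof (rule sum.cong)
      fix s assume s: "s \<in> ?\<Gamma>"
      have "dirac i s = - inc s i" using dirac_up[OF s ik] dirac_antisym[of i s] by simp
      moreover have "s \<noteq> j" using s jG by blast
      ultimately show "?M i s * ?M s j =
         - (inc s i * inc s j)"
        using dirac_up[OF s jk] iG by simp
    qed simp
    also have "\<dots> = - gram m i j"
      unfolding gram_def sum_negf
      using inc_down_ksub[OF _ ik] ksub_subset_Pow[of m k]
      by (intro arg_cong[where f = uminus] sum.mono_neutral_left) fastforce+
    finally show "?M i j -
     (\<Sum>s\<in>?\<Gamma>. ?M i s * ?M s j) = gram m i j"
      using iG dirac_same_card[OF ik jk] by simp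
  qed
  finally show ?thesis .
qed

text \<open>The dual elimination: the identity block sits on the \<open>k\<close>-faces, its Schur
  complement is \<partial>\<partial>^T on the faces outside \<open>A\<close>, and the Laplacian
  identity turns this into m - G one dimension lower.\<close>

lemma sum_weight_over_deletion:
  assumes A: "A \<subseteq> ksub m k"
  shows "(\<Sum>B\<in>Pow (ksub m (Suc k)). weight (Suc m) k (cone_join m A B)) =
    sdet (ksub m k - A) (\<lambda>i j. (if i = j then int m else 0) - gram m i j)"
proof -
  let ?F = "ksub m (Suc k)"
  let ?M = "\<lambda>i j. dirac i j + (if i = j \<and> i \<in> ?F then 1 else 0)"
  define C where "C = ksub m k - A"
  have C: "C \<subseteq> ksub m k" and fC: "finite C" by (auto simp: C_def)
  have disj: "C \<inter> ?F = {}" using ksub_disjoint[of k "Suc k" m m] C by auto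
  have "(\<Sum>B\<in>Pow ?F. weight (Suc m) k (cone_join m A B)) = (\<Sum>B\<in>Pow ?F. sdet (C \<union> (?F - ?F) \<union> B) dirac)"
    using weight_cone_join[OF A] by (intro sum.cong) (auto simp: C_def)
  also have "\<dots> = (\<Sum>B\<in>Pow ?F. sdet (C \<union> ?F - B) dirac)"
    by (rule sum_minors_complement[symmetric]) (use disj in auto)
  also have "\<dots> = sdet (C \<union> ?F) ?M"
    using fC by (intro sdet_principal_minors[symmetric]) auto
  also have "C \<union> ?F = ?F \<union> C" by blast
  also have "sdet (?F \<union> C) ?M =
     sdet C (\<lambda>i j. ?M i j -
     (\<Sum>s\<in>?F. ?M i s * ?M s j))"
    using fC disj by (intro sdet_Schur) (auto simp: dirac_same_card)
  also have "\<dots> = sdet C (\<lambda>i j. (if i = j then int m else 0) - gram m i j)"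
  proof (rule sdet_cong)
    fix i j assume ij: "i \<in> C" "j \<in> C"
    then have iG: "i \<notin> ?F" and jG: "j \<notin> ?F" using disj by auto
    have ik: "i \<in> ksub m k" and jk: "j \<in> ksub m k" using ij C by auto
    have "(\<Sum>s\<in>?F. ?M i s * ?M s j) =
       (\<Sum>s\<in>?F. - (inc i s * inc j s))"
    proof (rule sum.cong)
      fix s assume s: "s \<in> ?F"
      have "dirac s j = - inc j s" using dirac_up[OF jk s] dirac_antisym[of s j] by simp
      moreover have "s \<noteq> j" using s jG by blast
      ultimately show "?M i s * ?M s j =
         - (inc i s * inc j s)"
        using dirac_up[OF ik s] iG by simp
    qed simp
    also have "\<dots> = - (\<Sum>s\<in>Pow {1..m}. inc i s * inc j s)"
      unfolding sum_negf
      using inc_up_ksub[OF _ ik, where n = m] ksub_subset_Pow[of m "Suc k"]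
      by (intro arg_cong[where f = uminus] sum.mono_neutral_left) fastforce+
    also have "(\<Sum>s\<in>Pow {1..m}. inc i s * inc j s) = (if i = j then int m else 0) - gram m i j"
    proof -
      have "(\<Sum>s\<in>Pow {1..m}. inc i s * inc j s) + gram m i j = (if i = j then int (card {1..m}) else 0)"
        unfolding gram_def using ik jk by (intro Laplacian_full) (auto simp: ksub_def)
      then show ?thesis by (cases "i = j") simp_all
    qed
    finally show "?M i j -
     (\<Sum>s\<in>?F. ?M i s * ?M s j) =
       (if i = j then int m else 0) - gram m i j"
      using iG dirac_same_card[OF ik jk] by simp
  qed
  finally show ?thesis unfolding C_def .
qed

lemma weight_nonzero_card:
  assumes "T \<subseteq> ksub (Suc m) (Suc k)" "weight (Suc m) k T \<noteq> 0"
  shows "card T = m choose k"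
proof (rule ccontr)
  assume ne: "card T \<noteq> m choose k"
  have "sdet (ksub m k \<union> T) dirac = 0"
  proof (rule sdet_bipartite_unbalanced)
    show "finite T" using assms(1) finite_subset finite_ksub by blast
    show "ksub m k \<inter> T = {}" using ksub_disjoint[of k "Suc k" m "Suc m"] assms(1) by auto
    show "card (ksub m k) \<noteq> card T" using ne card_ksub by simp
    show "dirac i j = 0" if "i \<in> T" "j \<in> T" for i j using that assms(1) dirac_same_card by blast
  qed (auto intro: dirac_same_card)
  then show False using assms(2) by (simp add: weight_def)
qed

text \<open>Both sides are the same multiple of det G_B, obtained once from the trees on one more
  vertex with deletion \<open>B\<close> and once from the trees containing \<open>B\<close>.\<close>

lemma deletion_weight_eq:
  assumes "B \<subseteq> ksub (Suc m) (Suc k)"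
  shows "(\<Sum>A\<in>Pow (ksub (Suc m) k). weight (Suc (Suc m)) k (cone_join (Suc m) A B)) * total_weight (Suc m) k =
    int (Suc m) ^ card B * (\<Sum>S\<in>Pow (ksub (Suc m) (Suc k) - B). weight (Suc m) k (B \<union> S))"
  using sum_weight_over_link[OF assms] superset_weights_minor(1)[OF assms] by (simp add: mult.commute)

text \<open>Here the common factor is the minor of m - G on the complement of \<open>A\<close>.
  Passing to the link lowers the dimension, and a tree avoids this complement exactly when it lies
  in \<open>A\<close>.\<close>

lemma link_weight_eq:
  assumes A: "A \<subseteq> ksub (Suc m) (Suc k)"
  shows "(\<Sum>B\<in>Pow (ksub (Suc m) (Suc (Suc k))). weight (Suc (Suc m)) (Suc k) (cone_join (Suc m) A B)) * total_weight (Suc m) k =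
    int (Suc m) ^ card (ksub (Suc m) (Suc k) - A) * (\<Sum>S\<in>Pow A. weight (Suc m) k S)"
proof -
  have "ksub (Suc m) (Suc k) - (ksub (Suc m) (Suc k) - A) = A" using A by blast
  then show ?thesis
    using sum_weight_over_deletion[OF A] superset_weights_minor(2)[of "ksub (Suc m) (Suc k) - A" m k]
    by (simp add: mult.commute)
qed

section \<open>Link and deletion of a set of faces, and the total weight\<close>

definition link_faces :: "nat \<Rightarrow> nat set set \<Rightarrow> nat set set" where
  "link_faces m T = {s. Suc m \<notin> s \<and> insert (Suc m) s \<in> T}"

definition deletion_faces :: "nat \<Rightarrow> nat set set \<Rightarrow> nat set set" where
  "deletion_faces m T = {t \<in> T. Suc m \<notin> t}"

lemma cone_join_link_deletion: "cone_join m (link_faces m T) (deletion_faces m T) = T"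
proof (intro equalityI subsetI)
  fix t assume t: "t \<in> T"
  show "t \<in> cone_join m (link_faces m T) (deletion_faces m T)"
  proof (cases "Suc m \<in> t")
    case True
    then have eq: "insert (Suc m) (t - {Suc m}) = t" by blast
    then have "t - {Suc m} \<in> link_faces m T" using t by (simp add: link_faces_def)
    then show ?thesis using eq unfolding cone_join_def by (metis UnI1 imageI)
  qed (use t in \<open>simp add: cone_join_def deletion_faces_def\<close>)
qed (auto simp: cone_join_def link_faces_def deletion_faces_def)

lemma cone_join_link:
  assumes "A \<subseteq> ksub m k" "B \<subseteq> ksub m l"
  shows "link_faces m (cone_join m A B) = A"
proof -
  have n: "Suc m \<notin> s" if "s \<in> A \<union> B" for s using that assms notin_ksub by blast
  have "s \<in> A" if s: "Suc m \<notin> s" "insert (Suc m) s \<in> cone_join m A B" for s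
  proof -
    have "insert (Suc m) s \<notin> B" using n[of "insert (Suc m) s"] by auto
    then obtain t where t: "t \<in> A" "insert (Suc m) s = insert (Suc m) t"
      using s(2) by (auto simp: cone_join_def)
    then have "s = t" using insert_ident[OF s(1), of t] n[of t] by simp
    then show ?thesis using t by simp
  qed
  then show ?thesis using n by (auto simp: cone_join_def link_faces_def)
qed

lemma cone_join_deletion:
  assumes "B \<subseteq> ksub m l"
  shows "deletion_faces m (cone_join m A B) = B"
  using assms notin_ksub unfolding cone_join_def deletion_faces_def by blast

lemma cone_join_subset:
  assumes "A \<subseteq> ksub m k" "B \<subseteq> ksub m (Suc k)"
  shows "cone_join m A B \<subseteq> ksub (Suc m) (Suc k)"
proof -
  have "insert (Suc m) ` A \<subseteq> ksub (Suc m) (Suc k)" using assms(1) cone_in_ksub by blast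
  moreover have "ksub m (Suc k) \<subseteq> ksub (Suc m) (Suc k)" by (auto simp: ksub_def)
  ultimately show ?thesis using assms(2) unfolding cone_join_def by blast
qed

lemma deletion_subset: "T \<subseteq> ksub (Suc m) k \<Longrightarrow> deletion_faces m T \<subseteq> ksub m k"
  by (auto simp: ksub_def deletion_faces_def subset_iff le_Suc_eq)

lemma link_subset:
  assumes "T \<subseteq> ksub (Suc m) (Suc k)"
  shows "link_faces m T \<subseteq> ksub m k"
proof
  fix s assume "s \<in> link_faces m T"
  then have m: "insert (Suc m) s \<in> ksub (Suc m) (Suc k)" "Suc m \<notin> s"
    using assms by (auto simp: link_faces_def)
  moreover have "finite s" using ksub_finite_elem[OF m(1)] by simp
  ultimately show "s \<in> ksub m k" by (auto simp: ksub_def subset_iff le_Suc_eq)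
qed

lemma sum_Pow_cone_join:
  "(\<Sum>T\<in>Pow (ksub (Suc m) (Suc k)). f T) =
     (\<Sum>B\<in>Pow (ksub m (Suc k)). \<Sum>A\<in>Pow (ksub m k). f (cone_join m A B))"
proof -
  have "(\<Sum>B\<in>Pow (ksub m (Suc k)). \<Sum>A\<in>Pow (ksub m k). f (cone_join m A B)) =
      (\<Sum>(B, A)\<in>Pow (ksub m (Suc k)) \<times> Pow (ksub m k). f (cone_join m A B))"
    by (rule sum.cartesian_product)
  also have "\<dots> = (\<Sum>T\<in>Pow (ksub (Suc m) (Suc k)). f T)"
  proof (rule sum.reindex_bij_witness[where j = "\<lambda>(B, A). cone_join m A B"
        and i = "\<lambda>T. (deletion_faces m T, link_faces m T)"])
    fix p assume p: "p \<in> Pow (ksub m (Suc k)) \<times> Pow (ksub m k)"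
    then obtain B A where "p = (B, A)" "B \<subseteq> ksub m (Suc k)" "A \<subseteq> ksub m k" by auto
    then show "(deletion_faces m (case p of (B, A) \<Rightarrow> cone_join m A B),
        link_faces m (case p of (B, A) \<Rightarrow> cone_join m A B)) = p"
      "(case p of (B, A) \<Rightarrow> cone_join m A B) \<in> Pow (ksub (Suc m) (Suc k))"
      using cone_join_link cone_join_deletion cone_join_subset by auto
  next
    fix T assume "T \<in> Pow (ksub (Suc m) (Suc k))"
    then show "(deletion_faces m T, link_faces m T) \<in> Pow (ksub m (Suc k)) \<times> Pow (ksub m k)"
      using deletion_subset link_subset by auto
  qed (auto simp: cone_join_link_deletion)
  finally show ?thesis by simp
qed

lemma sum_Pow_power: 
  fixes x :: "'a::comm_semiring_1"
  assumes "finite T"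
  shows "(\<Sum>B\<in>Pow T. x ^ card B) = (1 + x) ^ card T"
  using assms
proof (induction T)
  case (insert a T)
  have "(\<Sum>B\<in>Pow T. x ^ card (insert a B)) = (\<Sum>B\<in>Pow T. x * x ^ card B)"
  proof (rule sum.cong)
    fix B assume "B \<in> Pow T"
    then have "finite B" "a \<notin> B" using insert.hyps finite_subset by auto
    then show "x ^ card (insert a B) = x * x ^ card B" by simp
  qed simp
  then show ?case
    using insert by (simp add: sum_Pow_insert algebra_simps flip: sum_distrib_left)
qed simp

lemma sum_Pow_Pow_swap:
  assumes "finite F"
  shows "(\<Sum>B\<in>Pow F. \<Sum>S\<in>Pow (F - B). g B (B \<union> S)) = (\<Sum>T\<in>Pow F. \<Sum>B\<in>Pow T. g B T)"
proof -
  have "(\<Sum>B\<in>Pow F. \<Sum>S\<in>Pow (F - B). g B (B \<union> S)) = (\<Sum>(B, S)\<in>(SIGMA B:Pow F. Pow (F - B)). g B (B \<union> S))"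
    by (rule sum.Sigma) (use assms in auto)
  also have "\<dots> = (\<Sum>(T, B)\<in>(SIGMA T:Pow F. Pow T). g B T)"
    by (rule sum.reindex_bij_witness[where j = "\<lambda>(B, S). (B \<union> S, B)" and i = "\<lambda>(T, B). (B, T - B)"]) auto
  also have "\<dots> = (\<Sum>T\<in>Pow F. \<Sum>B\<in>Pow T. g B T)"
    by (rule sum.Sigma[symmetric]) (use assms finite_subset in auto)
  finally show ?thesis .
qed

text \<open>Summing the deletion identity over all \<open>B\<close> counts each tree T on m+1
  vertices with the factor (m+2)^|T|, the sum of (m+1)^|B| over the subsets B of T. Since |T| is
  constant, the total on m+1 vertices cancels. This is Kalai's weighted count of hypertrees.\<close>

theorem total_weight_eq: "total_weight (Suc (Suc m)) k = int (Suc (Suc m)) ^ (m choose k)"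
proof -
  let ?F = "ksub (Suc m) (Suc k)" and ?w = "weight (Suc m) k"
  have "total_weight (Suc (Suc m)) k * total_weight (Suc m) k =
     (\<Sum>B\<in>Pow ?F. (\<Sum>A\<in>Pow (ksub (Suc m) k). weight (Suc (Suc m)) k (cone_join (Suc m) A B)) * total_weight (Suc m) k)"
    unfolding total_weight_def[of "Suc (Suc m)"] sum_Pow_cone_join sum_distrib_right ..
  also have "\<dots> = (\<Sum>B\<in>Pow ?F. \<Sum>S\<in>Pow (?F - B). int (Suc m) ^ card B * ?w (B \<union> S))"
    using deletion_weight_eq unfolding sum_distrib_left by (intro sum.cong) auto
  also have "\<dots> = (\<Sum>T\<in>Pow ?F. \<Sum>B\<in>Pow T. int (Suc m) ^ card B * ?w T)"
    by (rule sum_Pow_Pow_swap[where g = "\<lambda>B T. int (Suc m) ^ card B * ?w T"]) simp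
  also have "\<dots> = (\<Sum>T\<in>Pow ?F. int (Suc (Suc m)) ^ (m choose k) * ?w T)"
  proof (rule sum.cong)
    fix T assume T: "T \<in> Pow ?F"
    then have "finite T" using finite_subset finite_ksub by blast
    then have "(\<Sum>B\<in>Pow T. int (Suc m) ^ card B * ?w T) = int (Suc (Suc m)) ^ card T * ?w T"
      using sum_Pow_power[of T "int (Suc m)"] by (simp flip: sum_distrib_right)
    then show "(\<Sum>B\<in>Pow T. int (Suc m) ^ card B * ?w T) = int (Suc (Suc m)) ^ (m choose k) * ?w T"
      using weight_nonzero_card[of T m k] T by (cases "?w T = 0") auto
  qed simp
  also have "\<dots> = int (Suc (Suc m)) ^ (m choose k) * total_weight (Suc m) k"
    unfolding total_weight_def sum_distrib_left ..
  finally show ?thesis using superset_weights_minor(3)[of "{}" m k] by simp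
qed

section \<open>Weights as squares of minors\<close>

lemma sdet_signed_matching:
  fixes f :: "'a \<Rightarrow> 'a"
  defines "J \<equiv> \<lambda>Q i j. if i \<in> Q \<and> j = f i then 1 else if j \<in> Q \<and> i = f j then - 1 else (0 :: 'b::linordered_idom)"
  assumes "finite R" "inj_on f Q" "Q \<inter> f ` Q = {}" "R \<subseteq> Q"
  shows "sdet (R \<union> f ` R) (J Q) = 1"
  using assms(2-)
\<comment> \<open>The matrix refers to \<open>Q\<close> throughout, so the induction changes only
  the index set. Each matched pair contributes the factor -(1 * (-1)) = 1.\<close>
proof (induction R)
  case (insert x R)
  let ?S = "insert x R \<union> f ` insert x R"
  have x: "x \<in> Q" "f x \<notin> Q" "x \<noteq> f x" using insert.prems by auto
  have fx: "f x \<notin> f ` R" "f x \<notin> R" "x \<notin> f ` R"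
    using insert.prems insert.hyps x unfolding inj_on_def by blast+
  have "sdet ?S (J Q) = - (J Q x (f x) * J Q (f x) x) * sdet (?S - {x, f x}) (J Q)"
  proof (rule sdet_remove_pair)
    show "finite ?S" using insert.hyps by simp
    show "J Q (f x) j = 0" "J Q j (f x) = 0" if "j \<in> ?S" "j \<noteq> x" for j
      using that x insert.prems(1) by (auto simp: J_def inj_on_def)
  qed (use x in auto)
  moreover have "J Q x (f x) = 1" "J Q (f x) x = - 1" using x by (auto simp: J_def)
  moreover have "?S - {x, f x} = R \<union> f ` R" using fx insert.hyps by auto
  ultimately show ?case using insert by simp
qed simp

text \<open>\<open>L\<close> factors as P J P^T, where J is the symplectic matrix of the matching
  \<open>f\<close> and P is the off-diagonal block extended by the identity. As det J = 1, no sign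
  of a block permutation has to be computed.\<close>

lemma sdet_bipartite_skew:
  fixes L :: "'a \<Rightarrow> 'a \<Rightarrow> 'b::linordered_idom"
  assumes fin: "finite R" and inj: "inj_on f R" and disj: "R \<inter> f ` R = {}"
    and LR: "\<And>i j. i \<in> R \<Longrightarrow> j \<in> R \<Longrightarrow> L i j = 0"
    and LS: "\<And>i j. i \<in> R \<Longrightarrow> j \<in> R \<Longrightarrow> L (f i) (f j) = 0"
    and skew: "\<And>i j. i \<in> R \<Longrightarrow> j \<in> R \<Longrightarrow> L (f j) i = - L i (f j)"
  shows "sdet (R \<union> f ` R) L = (sdet R (\<lambda>i j. L i (f j)))\<^sup>2"
proof -
  let ?U = "R \<union> f ` R"
  let ?J = "\<lambda>i j. if i \<in> R \<and> j = f i then 1 else if j \<in> R \<and> i = f j then - 1 else (0 :: 'b)"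
  define P where "P i j = (if i \<in> R then if j \<in> R then L i (f j) else 0 else if i = j then 1 else 0)" for i j
  have fU: "finite ?U" using fin by simp
  have fnot: "f i \<notin> R" if "i \<in> R" for i using that disj by blast
  have sumU: "(\<Sum>k\<in>?U. h k) = (\<Sum>k\<in>R. h k) + (\<Sum>k\<in>R. h (f k))" for h :: "'a \<Rightarrow> 'b"
    using fin disj by (subst sum.union_disjoint) (auto simp: sum.reindex[OF inj])
  have eqf: "f k = f j \<longleftrightarrow> k = j" if "k \<in> R" "j \<in> R" for k j using that inj by (auto simp: inj_on_def)
  define Q where "Q k j = (\<Sum>l\<in>?U. ?J k l * P j l)" for k j
  have QR: "Q k j = P j (f k)" if k: "k \<in> R" for k j
  proof -
    have "Q k j = (\<Sum>l\<in>R. ?J k l * P j l) + (\<Sum>l\<in>R. ?J k (f l) * P j (f l))"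
      unfolding Q_def by (rule sumU)
    also have "(\<Sum>l\<in>R. ?J k l * P j l) = 0" using k fnot by (intro sum.neutral) auto
    also have "(\<Sum>l\<in>R. ?J k (f l) * P j (f l)) = (\<Sum>l\<in>R. if l = k then P j (f k) else 0)"
      using k fnot eqf by (intro sum.cong) auto
    finally show ?thesis using k fin by simp
  qed
  have QS: "Q (f k) j = - P j k" if k: "k \<in> R" for k j
  proof -
    have "Q (f k) j = (\<Sum>l\<in>R. ?J (f k) l * P j l) + (\<Sum>l\<in>R. ?J (f k) (f l) * P j (f l))"
      unfolding Q_def by (rule sumU)
    also have "(\<Sum>l\<in>R. ?J (f k) (f l) * P j (f l)) = 0" using k fnot by (intro sum.neutral) auto
    also have "(\<Sum>l\<in>R. ?J (f k) l * P j l) = (\<Sum>l\<in>R. if l = k then - P j k else 0)"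
      using k fnot eqf by (intro sum.cong) auto
    finally show ?thesis using k fin by simp
  qed
  have "sdet ?U L = sdet ?U (\<lambda>i j. \<Sum>k\<in>?U. P i k * Q k j)"
  proof (rule sdet_cong)
    fix i j assume i: "i \<in> ?U" and j: "j \<in> ?U"
    have split: "(\<Sum>k\<in>?U. P i k * Q k j) = (\<Sum>k\<in>R. P i k * P j (f k)) - (\<Sum>k\<in>R. P i (f k) * P j k)"
      unfolding sumU by (simp add: QR QS sum_negf)
    show "L i j = (\<Sum>k\<in>?U. P i k * Q k j)"
    proof (cases "i \<in> R")
      case True
      have 2: "(\<Sum>k\<in>R. P i (f k) * P j k) = 0" using True fnot by (intro sum.neutral) (auto simp: P_def)
      show ?thesis
      proof (cases "j \<in> R")
        case jR: True
        have "(\<Sum>k\<in>R. P i k * P j (f k)) = 0" using jR fnot by (intro sum.neutral) (auto simp: P_def)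
        then show ?thesis using split 2 True jR LR by simp
      next
        case False
        then obtain j' where j': "j' \<in> R" "j = f j'" using j by blast
        have "(\<Sum>k\<in>R. P i k * P j (f k)) = (\<Sum>k\<in>R. if k = j' then L i (f j') else 0)"
          using True j' fnot eqf by (intro sum.cong) (auto simp: P_def)
        then show ?thesis using split 2 j' fin by simp
      qed
    next
      case False
      then obtain i' where i': "i' \<in> R" "i = f i'" using i by blast
      have 1: "(\<Sum>k\<in>R. P i k * P j (f k)) = 0" using False by (intro sum.neutral) (auto simp: P_def)
      have "(\<Sum>k\<in>R. P i (f k) * P j k) = (\<Sum>k\<in>R. if k = i' then P j i' else 0)"
        using i' fnot eqf by (intro sum.cong) (auto simp: P_def)
      then have 2: "(\<Sum>k\<in>R. P i (f k) * P j k) = P j i'" using i' fin by simp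
      show ?thesis
      proof (cases "j \<in> R")
        case True
        then show ?thesis using split 1 2 i' skew[of j i'] by (simp add: P_def)
      next
        case False
        then obtain j' where j': "j' \<in> R" "j = f j'" using j by blast
        then show ?thesis using split 1 2 i' fnot[OF j'(1)] LS[of i' j'] by (auto simp: P_def)
      qed
    qed
  qed
  also have "\<dots> = sdet ?U P * sdet ?U Q" using fU by (rule sdet_mult)
  also have "sdet ?U Q = sdet ?U ?J * sdet ?U (\<lambda>i j. P j i)" unfolding Q_def using fU by (rule sdet_mult)
  also have "sdet ?U (\<lambda>i j. P j i) = sdet ?U P" using fU by (rule sdet_transpose)
  also have "sdet ?U ?J = 1" using sdet_signed_matching[OF fin inj disj subset_refl] by simp
  also have "sdet ?U P = sdet R P" using fU by (intro sdet_identity_rows) (auto simp: P_def)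
  also have "sdet R P = sdet R (\<lambda>i j. L i (f j))" by (rule sdet_cong) (simp add: P_def)
  finally show ?thesis by (simp add: power2_eq_square)
qed

lemma weight_eq_square:
  assumes S: "S \<subseteq> ksub (Suc m) (Suc k)" and f: "bij_betw f (ksub m k) S"
  shows "weight (Suc m) k S = (sdet (ksub m k) (\<lambda>i j. inc i (f j)))\<^sup>2"
proof -
  let ?R = "ksub m k"
  have inj: "inj_on f ?R" and img: "f ` ?R = S" using f by (auto simp: bij_betw_def)
  have fS: "f j \<in> ksub (Suc m) (Suc k)" if "j \<in> ?R" for j using that img S by blast
  have "sdet (?R \<union> f ` ?R) dirac = (sdet ?R (\<lambda>i j. dirac i (f j)))\<^sup>2"
  proof (rule sdet_bipartite_skew[OF finite_ksub inj])
    show "?R \<inter> f ` ?R = {}" using img S ksub_disjoint[of k "Suc k" m "Suc m"] by auto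
    show "dirac (f j) i = - dirac i (f j)" for i j by (rule dirac_antisym)
    show "dirac (f i) (f j) = 0" if "i \<in> ?R" "j \<in> ?R" for i j
      using fS[OF that(1)] fS[OF that(2)] by (rule dirac_same_card)
  qed (rule dirac_same_card)
  also have "sdet ?R (\<lambda>i j. dirac i (f j)) = sdet ?R (\<lambda>i j. inc i (f j))"
    using fS by (intro sdet_cong dirac_up) auto
  finally show ?thesis by (simp add: weight_def img)
qed

lemma weight_nonneg:
  assumes S: "S \<subseteq> ksub (Suc m) (Suc k)"
  shows "weight (Suc m) k S \<ge> 0"
proof (cases "weight (Suc m) k S = 0")
  case False
  have "finite S" using S finite_subset finite_ksub by blast
  moreover have "card (ksub m k) = card S" using weight_nonzero_card[OF S False] card_ksub by simp
  ultimately have "\<exists>f. bij_betw f (ksub m k) S" by (rule finite_same_card_bij[OF finite_ksub])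
  then obtain f where "bij_betw f (ksub m k) S" ..
  then show ?thesis using weight_eq_square[OF S] by simp
qed simp

section \<open>Quotients of subgroups of free abelian groups and their rank\<close>

abbreviation frag_coset :: "('a \<Rightarrow>\<^sub>0 int) set \<Rightarrow> ('a \<Rightarrow>\<^sub>0 int) \<Rightarrow> ('a \<Rightarrow>\<^sub>0 int) set" where
  "frag_coset B z \<equiv> (\<lambda>b. b + z) ` B"

locale frag_quotient =
  fixes F :: "'a set" and Z B :: "('a \<Rightarrow>\<^sub>0 int) set"
  assumes Z: "subgroup Z (free_Abelian_group F)" and B: "subgroup B (free_Abelian_group F)" and BZ: "B \<subseteq> Z"
begin

abbreviation "ZG \<equiv> subgroup_generated (free_Abelian_group F) Z"
abbreviation "H \<equiv> ZG Mod B"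

lemma carrier_ZG: "carrier ZG = Z"
  by (rule subgroup.carrier_subgroup_generated_subgroup[OF Z])

lemma comm_ZG: "comm_group ZG"
  by (rule group.abelian_subgroup_generated[OF group_free_Abelian_group abelian_free_Abelian_group])

lemma subgroup_B: "subgroup B ZG"
  using group.subgroup_subgroup_generated_iff[OF group_free_Abelian_group, of B F Z] B BZ carrier_ZG by simp

lemma comm_H: "comm_group H"
  by (rule comm_group.abelian_FactGroup[OF comm_ZG subgroup_B])

lemma r_coset_ZG: "B #>\<^bsub>ZG\<^esub> z = frag_coset B z"
  by (auto simp: r_coset_def)

lemma carrier_H: "carrier H = frag_coset B ` Z"
  unfolding carrier_FactGroup carrier_ZG r_coset_ZG ..

lemma zero_B: "0 \<in> B"
  using subgroup.one_closed[OF B] by simp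

lemma minus_B: "x \<in> B \<Longrightarrow> - x \<in> B"
  using subgroup.m_inv_closed[OF B, of x] subgroup.mem_carrier[OF B, of x] by simp

lemma add_B: "x \<in> B \<Longrightarrow> y \<in> B \<Longrightarrow> x + y \<in> B"
  using subgroup.m_closed[OF B, of x y] by simp

lemma frag_coset_eq_iff: "frag_coset B x = frag_coset B y \<longleftrightarrow> x - y \<in> B"
proof
  assume "frag_coset B x = frag_coset B y"
  moreover have "x \<in> frag_coset B x" using zero_B by (intro image_eqI[of _ _ 0]) auto
  ultimately obtain b where "b \<in> B" "x = b + y" by auto
  then show "x - y \<in> B" by simp
next
  assume xy: "x - y \<in> B"
  have sub: "frag_coset B x \<subseteq> frag_coset B y" if "x - y \<in> B" for x y
  proof
    fix w assume "w \<in> frag_coset B x"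
    then obtain b where "b \<in> B" "w = b + x" by blast
    then show "w \<in> frag_coset B y" using add_B[OF _ that] by (intro image_eqI[of _ _ "b + (x - y)"]) auto
  qed
  show "frag_coset B x = frag_coset B y"
    using sub[OF xy] sub[of y x] minus_B[OF xy] by auto
qed

lemma pow_H:
  fixes n :: int
  assumes "z \<in> Z"
  shows "frag_coset B z [^]\<^bsub>H\<^esub> n = frag_coset B (frag_cmul n z)"
proof -
  interpret comm_group ZG by (rule comm_ZG)
  interpret normal B ZG using subgroup_B by (rule subgroup_imp_normal)
  have "z [^]\<^bsub>ZG\<^esub> n = frag_cmul n z"
    using group.int_pow_subgroup_generated[OF group_free_Abelian_group, of z F Z n] assms carrier_ZG
      subgroup.mem_carrier[OF Z assms] by simp
  then show ?thesis using FactGroup_int_pow[of z n] assms carrier_ZG by (simp add: r_coset_ZG)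
qed

text \<open>The group order annihilates every element, which is a nontrivial relation on any
  nonempty set.\<close>

lemma rank_eq_0_if_finite:
  assumes fin: "finite (frag_coset B ` Z)"
  shows "abelian_rank H = 0"
proof -
  interpret H: comm_group H by (rule comm_H)
  have fin: "finite (carrier H)" using fin carrier_H by simp
  have "S = {}" if S: "int_independent H S" for S
  proof (rule ccontr)
    assume "S \<noteq> {}"
    then obtain s where s: "s \<in> S" by blast
    have SH: "S \<subseteq> carrier H" using S by (simp add: int_independent_def)
    have "finprod H (\<lambda>s. s [^]\<^bsub>H\<^esub> int (order H)) S = \<one>\<^bsub>H\<^esub>"
      using SH H.pow_order_eq_1 by (intro H.finprod_one_eqI) (auto simp: int_pow_int)
    then have "int (order H) = 0"
      using S s unfolding int_independent_def by (elim conjE) (drule spec[of _ "\<lambda>_. int (order H)"], blast)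
    then show False using fin H.order_gt_0_iff_finite by simp
  qed
  then have "{S. int_independent H S} \<subseteq> {{}}" by blast
  then have "abelian_rank H \<le> 0"
    unfolding abelian_rank_def by (intro SUP_least) (auto simp: zero_enat_def)
  then show ?thesis by simp
qed

text \<open>A class of infinite order is by itself an independent set.\<close>

lemma rank_ne_0_if_torsion_free:
  assumes z: "z \<in> Z" and tf: "\<And>n. n \<noteq> 0 \<Longrightarrow> frag_cmul n z \<notin> B"
  shows "abelian_rank H \<noteq> 0"
proof -
  interpret H: comm_group H by (rule comm_H)
  have zH: "frag_coset B z \<in> carrier H" using z carrier_H by blast
  have "int_independent H {frag_coset B z}"
    unfolding int_independent_def
  proof (intro conjI allI impI)
    fix c :: "('a \<Rightarrow>\<^sub>0 int) set \<Rightarrow> int"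
    let ?c = "c (frag_coset B z)"
    have "finprod H (\<lambda>s. s [^]\<^bsub>H\<^esub> c s) {frag_coset B z} = frag_coset B z [^]\<^bsub>H\<^esub> ?c"
      using zH H.int_pow_closed by (subst H.finprod_insert) (auto simp del: mult_FactGroup one_FactGroup)
    also have "\<dots> = frag_coset B (frag_cmul ?c z)" using z by (rule pow_H)
    finally have eq: "finprod H (\<lambda>s. s [^]\<^bsub>H\<^esub> c s) {frag_coset B z} = frag_coset B (frag_cmul ?c z)" .
    assume "finprod H (\<lambda>s. s [^]\<^bsub>H\<^esub> c s) {frag_coset B z} = \<one>\<^bsub>H\<^esub>"
    then have "frag_coset B (frag_cmul ?c z) = frag_coset B 0" using eq by simp
    then have "frag_cmul ?c z \<in> B" unfolding frag_coset_eq_iff by simp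
    then show "\<forall>s\<in>{frag_coset B z}. c s = 0" using tf by blast
  qed (use zH in auto)
  then have "enat (card {frag_coset B z}) \<le> abelian_rank H"
    unfolding abelian_rank_def by (intro SUP_upper) simp
  then show ?thesis by (auto simp: zero_enat_def)
qed

end

section \<open>Homology of complexes with full skeleton\<close>

abbreviation (input) "coef \<equiv> poly_mapping.lookup"
abbreviation (input) "supp \<equiv> Poly_Mapping.keys"

text \<open>A member of \<open>complexes m k\<close> is determined by its \<open>k\<close>-faces.
  Counting and probability are carried out on sets of \<open>k\<close>-faces; this map returns to
  complexes.\<close>

definition tree_complex :: "nat \<Rightarrow> nat \<Rightarrow> nat set set \<Rightarrow> nat set set" where
  "tree_complex m k S = full_skeleton m (int k - 1) \<union> S"

lemma faces_tree_complex:
  assumes "S \<subseteq> ksub m (Suc k)"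
  shows "faces (tree_complex m k S) (int k) = S"
    and "faces (tree_complex m k S) (int k - 1) = ksub m k"
    and "faces (tree_complex m k S) (int k + 1) = {}"
proof -
  have S: "s \<subseteq> {1..m}" "card s = Suc k" "finite s" if "s \<in> S" for s
    using that assms ksub_finite_elem[of s m "Suc k"] by (auto simp: ksub_def)
  have mem: "s \<in> faces (tree_complex m k S) j \<longleftrightarrow>
      (s \<subseteq> {1..m} \<and> int (card s) \<le> int k \<or> s \<in> S) \<and> finite s \<and> int (card s) = j + 1" for s j
    by (simp add: faces_def tree_complex_def full_skeleton_def)
  show "faces (tree_complex m k S) (int k) = S"
  proof (rule Set.set_eqI)
    fix s show "s \<in> faces (tree_complex m k S) (int k) \<longleftrightarrow> s \<in> S"
      unfolding mem using S(2)[of s] S(3)[of s] by linarith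
  qed
  show "faces (tree_complex m k S) (int k + 1) = {}"
  proof (rule equals0I)
    fix s assume "s \<in> faces (tree_complex m k S) (int k + 1)"
    then show False unfolding mem using S(2)[of s] by linarith
  qed
  show "faces (tree_complex m k S) (int k - 1) = ksub m k"
  proof (rule Set.set_eqI)
    fix s
    have "s \<in> ksub m k \<longleftrightarrow> s \<subseteq> {1..m} \<and> card s = k \<and> finite s"
      using ksub_finite_elem[of s m k] by (auto simp: ksub_def)
    then show "s \<in> faces (tree_complex m k S) (int k - 1) \<longleftrightarrow> s \<in> ksub m k"
      unfolding mem using S(2)[of s] by linarith
  qed
qed

lemma tree_complex_in_complexes:
  assumes "S \<subseteq> ksub m (Suc k)"
  shows "tree_complex m k S \<in> complexes m k"
proof -
  have closed: "t \<in> tree_complex m k S" if "s \<in> tree_complex m k S" "t \<subseteq> s" for s t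
  proof (cases "t = s")
    case False
    have s: "s \<subseteq> {1..m}" "card s \<le> Suc k"
      using that(1) assms by (auto simp: tree_complex_def full_skeleton_def ksub_def)
    then have "card t < card s" using that(2) False finite_subset[of s "{1..m}"] by (intro psubset_card_mono) auto
    then show ?thesis using s that(2) by (auto simp: tree_complex_def full_skeleton_def)
  qed (use that in simp)
  have "{} \<in> tree_complex m k S" by (simp add: tree_complex_def full_skeleton_def)
  moreover have "tree_complex m k S \<subseteq> full_skeleton m (int k)"
    using assms by (auto simp: tree_complex_def full_skeleton_def ksub_def)
  moreover have "tree_complex m k S \<subseteq> Pow {1..m}"
    using assms by (auto simp: tree_complex_def full_skeleton_def ksub_def)
  ultimately show ?thesis
    using closed by (auto simp: complexes_def is_simplicial_complex_def tree_complex_def)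
qed

lemma complexes_eq_tree_complex:
  assumes "X \<in> complexes m k"
  shows "faces X (int k) \<subseteq> ksub m (Suc k)" "X = tree_complex m k (faces X (int k))"
proof -
  have X: "full_skeleton m (int k - 1) \<subseteq> X" "X \<subseteq> full_skeleton m (int k)"
    using assms by (auto simp: complexes_def)
  show "faces X (int k) \<subseteq> ksub m (Suc k)"
    using X by (auto simp: faces_def full_skeleton_def ksub_def)
  have "s \<in> tree_complex m k (faces X (int k))" if "s \<in> X" for s
  proof -
    have "s \<subseteq> {1..m}" "int (card s) \<le> int k + 1" using that X by (auto simp: full_skeleton_def)
    then show ?thesis
      using that finite_subset[of s "{1..m}"] by (auto simp: tree_complex_def faces_def full_skeleton_def)
  qed
  then show "X = tree_complex m k (faces X (int k))"
    using X by (auto simp: tree_complex_def faces_def)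
qed

section \<open>The boundary map in coordinates\<close>

lemma card_less_nth_sorted_list:
  fixes g :: "nat set"
  assumes "finite g" "i < card g"
  shows "card {u \<in> g. u < sorted_list_of_set g ! i} = i"
proof -
  let ?s = "sorted_list_of_set g"
  have sorted: "sorted_wrt (<) ?s" by (rule strict_sorted_list_of_set)
  have len: "length ?s = card g" and set: "set ?s = g" using assms by auto
  have less: "?s ! j < ?s ! i \<longleftrightarrow> j < i" if "j < card g" for j
    using that assms(2) len sorted_wrt_nth_less[OF sorted, of j i] sorted_wrt_nth_less[OF sorted, of i j]
    by (cases j i rule: linorder_cases) auto
  have "{u \<in> g. u < ?s ! i} = (!) ?s ` {..<i}"
  proof (intro equalityI subsetI)
    fix u assume u: "u \<in> {u \<in> g. u < ?s ! i}"
    then obtain j where j: "j < card g" "u = ?s ! j" using set len by (metis (no_types, lifting) in_set_conv_nth mem_Collect_eq)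
    then show "u \<in> (!) ?s ` {..<i}" using less[OF j(1)] u by auto
  next
    fix u assume "u \<in> (!) ?s ` {..<i}"
    then obtain j where j: "j < i" "u = ?s ! j" by auto
    then have "j < card g" using assms by simp
    then show "u \<in> {u \<in> g. u < ?s ! i}" using j less[of j] nth_mem[of j ?s] len set by auto
  qed
  moreover have "inj_on ((!) ?s) {..<i}"
    using assms len by (intro inj_on_nth) auto
  ultimately show ?thesis by (simp add: card_image)
qed

text \<open>The vertex at position i of the increasing list has exactly i smaller ones, so the sign
  in the boundary formula is the one in \<open>inc\<close>.\<close>

lemma lookup_face_boundary:
  assumes "finite g"
  shows "coef (face_boundary g) r = inc r g"
proof -
  let ?s = "sorted_list_of_set g"
  have bij: "bij_betw ((!) ?s) {..<card g} g"
    using bij_betw_nth[of ?s "{..<card g}" g] assms by simp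
  have "coef (face_boundary g) r =
      (\<Sum>i<card g. (-1) ^ i * (if r = g - {?s ! i} then 1 else 0))"
    by (simp add: face_boundary_def lookup_sum)
  also have "\<dots> = (\<Sum>i<card g. (\<lambda>v. (-1) ^ card {u \<in> g. u < v} * (if r = g - {v} then 1 else 0)) (?s ! i))"
    using card_less_nth_sorted_list[OF assms] by (intro sum.cong) auto
  also have "\<dots> = (\<Sum>v\<in>g. (-1) ^ card {u \<in> g. u < v} * (if r = g - {v} then 1 else 0))"
    by (rule sum.reindex_bij_betw[OF bij])
  also have "\<dots> = inc r g"
  proof (cases "\<exists>v\<in>g. r = g - {v}")
    case True
    then obtain v where v: "v \<in> g" "r = g - {v}" by blast
    then have g: "g = insert v r" "v \<notin> r" by auto
    have "(\<Sum>w\<in>g. (-1) ^ card {u \<in> g. u < w} * (if r = g - {w} then 1 else 0)) =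
        (\<Sum>w\<in>g. if w = v then (-1) ^ card {u \<in> g. u < v} else (0::int))"
    proof (rule sum.cong)
      fix w assume "w \<in> g"
      then have "r = g - {w} \<longleftrightarrow> w = v" using v by blast
      then show "(-1) ^ card {u \<in> g. u < w} * (if r = g - {w} then 1 else 0) =
        (if w = v then (-1) ^ card {u \<in> g. u < v} else (0::int))" by simp
    qed simp
    also have "\<dots> = (-1) ^ card {u \<in> g. u < v}" using v assms by simp
    also have "{u \<in> g. u < v} = {u \<in> r. u < v}" using g by auto
    finally show ?thesis using inc_insert[OF g(2)] g(1) by simp
  next
    case False
    have "inc r g = 0"
    proof (rule ccontr)
      assume "inc r g \<noteq> 0"
      then obtain v where "v \<notin> r" "g = insert v r" by (rule inc_nonzeroE)
      then have "v \<in> g" "r = g - {v}" by auto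
      then show False using False by blast
    qed
    then show ?thesis using False by (simp add: sum.neutral)
  qed
  finally show ?thesis .
qed

lemma lookup_boundary:
  assumes "supp c \<subseteq> W" "finite W" "\<And>g. g \<in> W \<Longrightarrow> finite g"
  shows "coef (boundary_map c) r = (\<Sum>g\<in>W. coef c g * inc r g)"
proof -
  have "coef (boundary_map c) r =
      (\<Sum>g\<in>supp c. coef c g * inc r g)"
    unfolding frag_extend_def lookup_sum using assms
    by (intro sum.cong) (auto simp: lookup_face_boundary)
  also have "\<dots> = (\<Sum>g\<in>W. coef c g * inc r g)"
    using assms by (intro sum.mono_neutral_left) (auto simp: in_keys_iff)
  finally show ?thesis .
qed

lemma lookup_boundary_ksub:
  assumes "supp c \<subseteq> ksub m j"
  shows "coef (boundary_map c) r = (\<Sum>g\<in>ksub m j. coef c g * inc r g)"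
  using assms ksub_finite_elem by (intro lookup_boundary) auto

lemma keys_boundary_ksub:
  assumes "supp c \<subseteq> ksub m (Suc k)"
  shows "supp (boundary_map c) \<subseteq> ksub m k"
proof
  fix r assume "r \<in> supp (boundary_map c)"
  then have "(\<Sum>g\<in>ksub m (Suc k). coef c g * inc r g) \<noteq> 0"
    unfolding lookup_boundary_ksub[OF assms, symmetric] by (simp add: in_keys_iff)
  then obtain g where "g \<in> ksub m (Suc k)" "coef c g * inc r g \<noteq> 0"
    by (meson sum.neutral)
  then show "r \<in> ksub m k" using inc_down_ksub[of r g m k] by auto
qed

lemma boundary_boundary:
  assumes "supp c \<subseteq> ksub m (Suc k)"
  shows "boundary_map (boundary_map c) = 0"
proof (rule poly_mapping_eqI)
  fix r
  have "coef (boundary_map (boundary_map c)) r =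
      (\<Sum>g\<in>ksub m k. (\<Sum>t\<in>ksub m (Suc k). coef c t * inc g t) * inc r g)"
    using lookup_boundary_ksub[OF keys_boundary_ksub[OF assms]] lookup_boundary_ksub[OF assms] by simp
  also have "\<dots> = (\<Sum>t\<in>ksub m (Suc k). coef c t * (\<Sum>g\<in>ksub m k. inc r g * inc g t))"
    unfolding sum_distrib_left sum_distrib_right by (subst sum.swap) (simp add: mult_ac)
  also have "\<dots> = 0"
  proof (intro sum.neutral ballI)
    fix t assume t: "t \<in> ksub m (Suc k)"
    have "(\<Sum>g\<in>ksub m k. inc r g * inc g t) = 0"
    proof (cases "r \<subseteq> {1..m}")
      case True
      have "(\<Sum>g\<in>ksub m k. inc r g * inc g t) = (\<Sum>g\<in>Pow {1..m}. inc r g * inc g t)"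
        using ksub_subset_Pow[of m k] inc_down_ksub[OF _ t] by (intro sum.mono_neutral_left) fastforce+
      then show ?thesis using inc_inc_sum[of "{1..m}" r t] True t by (simp add: ksub_def)
    next
      case False
      show ?thesis
      proof (intro sum.neutral ballI)
        fix g assume g: "g \<in> ksub m k"
        have "inc r g = 0"
        proof (rule ccontr)
          assume "inc r g \<noteq> 0"
          then obtain v where "g = insert v r" by (rule inc_nonzeroE)
          then show False using False g by (auto simp: ksub_def)
        qed
        then show "inc r g * inc g t = 0" by simp
      qed
    qed
    then show "coef c t * (\<Sum>g\<in>ksub m k. inc r g * inc g t) = 0" by simp
  qed
  finally show "coef (boundary_map (boundary_map c)) r = coef 0 r" by simp
qed

text \<open>At \<open>r\<close> the boundary retains a single term, that of \<open>r\<close> with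
  the last vertex added, so this coefficient vanishes too. Hence restriction to the faces avoiding
  the last vertex is injective on cycles.\<close>

lemma cycle_eq_0:
  assumes keys: "supp z \<subseteq> ksub (Suc m) k" and cyc: "boundary_map z = 0"
    and zero: "\<And>s. s \<in> ksub m k \<Longrightarrow> coef z s = 0"
  shows "z = 0"
proof (rule poly_mapping_eqI)
  fix g
  show "coef z g = coef 0 g"
  proof (cases "g \<in> ksub (Suc m) k")
    case False
    then show ?thesis using keys by (simp add: in_keys_iff subset_iff) blast
  next
    case g: True
    show ?thesis
    proof (cases "Suc m \<in> g")
      case False
      then have "g \<in> ksub m k" using g by (auto simp: ksub_def subset_iff le_Suc_eq)
      then show ?thesis using zero by simp
    next
      case True
      define r where "r = g - {Suc m}"
      have r: "g = insert (Suc m) r" "Suc m \<notin> r" using True by (auto simp: r_def)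
      have "0 = (\<Sum>g'\<in>ksub (Suc m) k. coef z g' * inc r g')"
        using lookup_boundary_ksub[OF keys, of r] cyc by simp
      also have "\<dots> = (\<Sum>g'\<in>ksub (Suc m) k. if g' = g then coef z g * inc r g else 0)"
      proof (rule sum.cong)
        fix g' assume g': "g' \<in> ksub (Suc m) k"
        have "coef z g' * inc r g' = 0" if "g' \<noteq> g"
        proof (cases "inc r g' = 0")
          case False
          then obtain v where v: "g' = insert v r" by (rule inc_nonzeroE)
          then have "Suc m \<notin> g'" using that r by auto
          then have "g' \<in> ksub m k" using g' by (auto simp: ksub_def subset_iff le_Suc_eq)
          then show ?thesis using zero by simp
        qed simp
        then show "coef z g' * inc r g' =
          (if g' = g then coef z g * inc r g else 0)" by simp
      qed simp
      also have "\<dots> = coef z g * inc r g" using g by simp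
      finally have "coef z g * inc r g = 0" by simp
      moreover have "inc r g \<noteq> 0" using inc_insert_square[OF r(2)] r(1) by auto
      ultimately show ?thesis by simp
    qed
  qed
qed

text \<open>The inverse of that restriction: the boundary of the cone over the prescribed
  coefficients, with signs making \<open>s\<close> appear with coefficient \<open>v s\<close>. The
  cycles of the full simplex thus form a copy of the integer vectors on
  \<open>ksub m k\<close>.\<close>

definition cone_cycle :: "nat \<Rightarrow> nat \<Rightarrow> (nat set \<Rightarrow> int) \<Rightarrow> nat set \<Rightarrow>\<^sub>0 int" where
  "cone_cycle m k v = boundary_map
     (\<Sum>s\<in>ksub m k. frag_cmul (v s * inc s (insert (Suc m) s)) (frag_of (insert (Suc m) s)))"

lemma keys_cone_chain:
  "supp (\<Sum>s\<in>ksub m k. frag_cmul (v s * inc s (insert (Suc m) s)) (frag_of (insert (Suc m) s)))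
     \<subseteq> ksub (Suc m) (Suc k)"
proof -
  have "(\<Sum>s\<in>ksub m k. frag_cmul (v s * inc s (insert (Suc m) s)) (frag_of (insert (Suc m) s)))
      \<in> carrier (free_Abelian_group (ksub (Suc m) (Suc k)))"
    by (rule sum_closed_free_Abelian_group) (auto simp: cone_in_ksub split: if_splits)
  then show ?thesis by simp
qed

lemma cone_cycle_props:
  shows "supp (cone_cycle m k v) \<subseteq> ksub (Suc m) k"
    and "boundary_map (cone_cycle m k v) = 0"
    and "s \<in> ksub m k \<Longrightarrow> coef (cone_cycle m k v) s = v s"
proof -
  show "supp (cone_cycle m k v) \<subseteq> ksub (Suc m) k"
    unfolding cone_cycle_def by (rule keys_boundary_ksub[OF keys_cone_chain])
  show "boundary_map (cone_cycle m k v) = 0"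
    unfolding cone_cycle_def by (rule boundary_boundary[OF keys_cone_chain])
  assume s: "s \<in> ksub m k"
  have "coef (cone_cycle m k v) s =
     (\<Sum>s'\<in>ksub m k. v s' * inc s' (insert (Suc m) s') * inc s (insert (Suc m) s'))"
    unfolding cone_cycle_def using ksub_finite_elem
    by (simp add: frag_extend_sum frag_extend_cmul lookup_sum lookup_face_boundary)
  also have "\<dots> = (\<Sum>s'\<in>ksub m k. if s' = s then v s else 0)"
  proof (rule sum.cong)
    fix s' assume s': "s' \<in> ksub m k"
    show "v s' * inc s' (insert (Suc m) s') * inc s (insert (Suc m) s') = (if s' = s then v s else 0)"
      using inc_cone_nonzero[of s "Suc m" s'] notin_ksub[OF s'] notin_ksub[OF s]
        inc_insert_square[OF notin_ksub[OF s]] by (auto simp: mult.assoc)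
  qed simp
  finally show "coef (cone_cycle m k v) s = v s" using s by simp
qed

lemma in_lattice_cong: "(\<And>i. i \<in> R \<Longrightarrow> z i = w i) \<Longrightarrow> in_lattice R A z = in_lattice R A w"
  by (simp add: in_lattice_def)

section \<open>Homology of a face set with square boundary matrix\<close>

lemma subgroup_free_Abelian_groupI:
  assumes "\<And>x. x \<in> A \<Longrightarrow> supp x \<subseteq> F" "0 \<in> A" "\<And>x y. x \<in> A \<Longrightarrow> y \<in> A \<Longrightarrow> x - y \<in> A"
  shows "subgroup A (free_Abelian_group F)"
proof
  show "A \<subseteq> carrier (free_Abelian_group F)" using assms(1) by auto
  show "\<one>\<^bsub>free_Abelian_group F\<^esub> \<in> A" using assms(2) by simp
  have minus: "- x \<in> A" if "x \<in> A" for x using assms(3)[OF assms(2) that] by simp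
  show "inv\<^bsub>free_Abelian_group F\<^esub> x \<in> A" if "x \<in> A" for x using minus[OF that] assms(1)[OF that] by simp
  show "x \<otimes>\<^bsub>free_Abelian_group F\<^esub> y \<in> A" if "x \<in> A" "y \<in> A" for x y
    using assms(3)[OF that(1) minus[OF that(2)]] by simp
qed

lemma subgroup_cycles: "subgroup {z. supp z \<subseteq> F \<and> boundary_map z = 0} (free_Abelian_group F)"
  by (rule subgroup_free_Abelian_groupI)
    (auto simp: frag_extend_diff dest: subsetD[OF keys_diff])

lemma subgroup_boundaries:
  assumes "S \<subseteq> ksub m (Suc k)"
  shows "subgroup (boundary_map ` {d. supp d \<subseteq> S}) (free_Abelian_group (ksub m k))"
proof (rule subgroup_free_Abelian_groupI)
  fix x y assume "x \<in> boundary_map ` {d. supp d \<subseteq> S}" "y \<in> boundary_map ` {d. supp d \<subseteq> S}"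
  then obtain d e where de: "x = boundary_map d" "y = boundary_map e" "supp d \<subseteq> S" "supp e \<subseteq> S"
    by auto
  then have "supp (d - e) \<subseteq> S" using keys_diff[of d e] by blast
  then show "x - y \<in> boundary_map ` {d. supp d \<subseteq> S}"
    using de by (intro image_eqI[of _ _ "d - e"]) (auto simp: frag_extend_diff)
next
  show "0 \<in> boundary_map ` {d. supp d \<subseteq> S}" by (intro image_eqI[of _ _ 0]) auto
qed (use assms keys_boundary_ksub in blast)

lemma carrier_free_Abelian_group: "carrier (free_Abelian_group F) = {c. supp c \<subseteq> F}"
  by auto

text \<open>The bijection \<open>f\<close> labels the columns by the rows and makes the boundary
  matrix square. Its choice affects the determinant only by a sign.\<close>

locale tree_faces =
  fixes m k :: nat and S :: "nat set set" and f :: "nat set \<Rightarrow> nat set"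
  assumes S: "S \<subseteq> ksub (Suc m) (Suc k)" and bij: "bij_betw f (ksub m k) S"
begin

abbreviation "R \<equiv> ksub m k"
abbreviation "X \<equiv> tree_complex (Suc m) k S"
abbreviation "A \<equiv> \<lambda>i j. inc i (f j)"
definition "Z = {z. supp z \<subseteq> ksub (Suc m) k \<and> boundary_map z = 0}"
definition "B = boundary_map ` {d. supp d \<subseteq> S}"
definition "Ztop = {z. supp z \<subseteq> S \<and> boundary_map z = 0}"

lemma homology_low: "reduced_homology X (int k - 1) = subgroup_generated (free_Abelian_group (ksub (Suc m) k)) Z Mod B"
  using faces_tree_complex[OF S] unfolding reduced_homology_def cycles_def boundaries_def kernel_def Z_def B_def
  by (simp add: carrier_free_Abelian_group)

lemma homology_top: "reduced_homology X (int k) = subgroup_generated (free_Abelian_group S) Ztop Mod {0}"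
proof -
  have "{c. supp c \<subseteq> {}} = {0 :: nat set \<Rightarrow>\<^sub>0 int}" by auto
  then show ?thesis
    using faces_tree_complex[OF S] unfolding reduced_homology_def cycles_def boundaries_def kernel_def Ztop_def
    by (simp add: carrier_free_Abelian_group)
qed

lemma keys_S: "supp d \<subseteq> S \<Longrightarrow> supp d \<subseteq> ksub (Suc m) (Suc k)"
  using S by blast

sublocale low: frag_quotient "ksub (Suc m) k" Z B
proof (rule frag_quotient.intro)
  show "subgroup Z (free_Abelian_group (ksub (Suc m) k))" unfolding Z_def by (rule subgroup_cycles)
  show "subgroup B (free_Abelian_group (ksub (Suc m) k))" unfolding B_def by (rule subgroup_boundaries[OF S])
  show "B \<subseteq> Z"
  proof
    fix z assume "z \<in> B"
    then obtain d where d: "z = boundary_map d" "supp d \<subseteq> S" unfolding B_def by blast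
    show "z \<in> Z"
      using keys_boundary_ksub[OF keys_S[OF d(2)]] boundary_boundary[OF keys_S[OF d(2)]]
      unfolding Z_def d(1) by simp
  qed
qed

sublocale top: frag_quotient S Ztop "{0}"
proof (rule frag_quotient.intro)
  show "subgroup Ztop (free_Abelian_group S)" unfolding Ztop_def by (rule subgroup_cycles)
  show "subgroup {0} (free_Abelian_group S)" by (rule subgroup_free_Abelian_groupI) auto
  show "{0} \<subseteq> Ztop" by (simp add: Ztop_def)
qed

lemma lookup_boundary_S:
  assumes "supp d \<subseteq> S"
  shows "coef (boundary_map d) s = (\<Sum>j\<in>R. A s j * coef d (f j))"
proof -
  have "coef (boundary_map d) s = (\<Sum>t\<in>S. coef d t * inc s t)"
    using assms S ksub_finite_elem finite_subset[OF S] by (intro lookup_boundary) auto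
  also have "\<dots> = (\<Sum>j\<in>R. coef d (f j) * inc s (f j))"
    by (rule sum.reindex_bij_betw[OF bij, symmetric])
  finally show ?thesis by (simp add: mult.commute)
qed

definition "S_chain c = (\<Sum>j\<in>R. frag_cmul (c j) (frag_of (f j)))" for c :: "nat set \<Rightarrow> int"

lemma keys_S_chain: "supp (S_chain c) \<subseteq> S"
proof -
  have "S_chain c \<in> carrier (free_Abelian_group S)"
    unfolding S_chain_def using bij_betw_apply[OF bij]
    by (intro sum_closed_free_Abelian_group) (auto split: if_splits)
  then show ?thesis by simp
qed

lemma lookup_S_chain:
  assumes "j \<in> R"
  shows "coef (S_chain c) (f j) = c j"
proof -
  have "coef (S_chain c) (f j) = (\<Sum>i\<in>R. if i = j then c j else 0)"
    unfolding S_chain_def lookup_sum using bij assms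
    by (intro sum.cong) (auto simp: bij_betw_def inj_on_eq_iff)
  then show ?thesis using assms by simp
qed

lemma lookup_boundary_S_chain:
  "coef (boundary_map (S_chain c)) s = (\<Sum>j\<in>R. A s j * c j)"
  unfolding lookup_boundary_S[OF keys_S_chain] by (intro sum.cong) (simp_all add: lookup_S_chain)

lemma boundary_S_in_Z: "supp d \<subseteq> S \<Longrightarrow> boundary_map d \<in> Z"
  using low.BZ by (auto simp: B_def)

lemma Z_eq_0: "z \<in> Z \<Longrightarrow> (\<And>s. s \<in> R \<Longrightarrow> coef z s = 0) \<Longrightarrow> z = 0"
  using cycle_eq_0[of z m k] by (auto simp: Z_def)

lemma diff_Z: "x \<in> Z \<Longrightarrow> y \<in> Z \<Longrightarrow> x - y \<in> Z"
  by (auto simp: Z_def frag_extend_diff dest: subsetD[OF keys_diff])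

text \<open>A cycle that agrees on \<open>R\<close> with a boundary is that boundary. So the
  coordinates on \<open>R\<close> identify cycles with integer vectors and the boundaries of chains
  on \<open>S\<close> with the column lattice.\<close>

lemma boundary_iff_in_lattice:
  assumes z: "z \<in> Z"
  shows "z \<in> B \<longleftrightarrow> in_lattice R A (coef z)"
proof
  assume "z \<in> B"
  then obtain d where "z = boundary_map d" "supp d \<subseteq> S" by (auto simp: B_def)
  then show "in_lattice R A (coef z)"
    unfolding in_lattice_def
    by (intro exI[of _ "\<lambda>j. coef d (f j)"]) (simp add: lookup_boundary_S)
next
  assume "in_lattice R A (coef z)"
  then obtain c where c: "\<forall>i\<in>R. coef z i = (\<Sum>j\<in>R. A i j * c j)" by (auto simp: in_lattice_def)
  have "z - boundary_map (S_chain c) = 0"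
    using z c by (intro Z_eq_0 diff_Z boundary_S_in_Z keys_S_chain)
      (simp_all add: lookup_minus lookup_boundary_S_chain)
  then have "z = boundary_map (S_chain c)" by simp
  then show "z \<in> B" unfolding B_def by (rule image_eqI) (simp add: keys_S_chain)
qed

lemma cone_cycle_Z: "cone_cycle m k v \<in> Z"
  using cone_cycle_props by (simp add: Z_def)

lemma coset_eq_iff:
  assumes "x \<in> Z" "y \<in> Z"
  shows "frag_coset B x = frag_coset B y \<longleftrightarrow> in_lattice R A (\<lambda>i. coef x i - coef y i)"
  unfolding low.frag_coset_eq_iff boundary_iff_in_lattice[OF diff_Z[OF assms]]
  by (intro in_lattice_cong) (simp add: lookup_minus)

text \<open>Integer vectors are cycles by way of \<open>cone_cycle\<close>, so representatives
  modulo the lattice represent the homology classes.\<close>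

lemma bij_transversal_homology:
  assumes V: "lattice_transversal R A V"
  shows "bij_betw (\<lambda>v. frag_coset B (cone_cycle m k v)) V (frag_coset B ` Z)"
proof -
  have uniq: "\<exists>!v. v \<in> V \<and> in_lattice R A (\<lambda>i. z i - v i)" for z
    using V by (simp add: lattice_transversal_def)
  have eq: "frag_coset B z = frag_coset B (cone_cycle m k v) \<longleftrightarrow>
      in_lattice R A (\<lambda>i. coef z i - v i)" if "z \<in> Z" for z v
    unfolding coset_eq_iff[OF that cone_cycle_Z]
    by (intro in_lattice_cong) (simp add: cone_cycle_props)
  show ?thesis
    unfolding bij_betw_def
  proof
    show "inj_on (\<lambda>v. frag_coset B (cone_cycle m k v)) V"
    proof (rule inj_onI)
      fix v w assume vw: "v \<in> V" "w \<in> V" and e: "frag_coset B (cone_cycle m k v) = frag_coset B (cone_cycle m k w)"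
      let ?z = "coef (cone_cycle m k v)"
      have "in_lattice R A (\<lambda>i. ?z i - v i)" "in_lattice R A (\<lambda>i. ?z i - w i)"
        using eq[OF cone_cycle_Z, of v v] eq[OF cone_cycle_Z, of v w] e by simp_all
      then show "v = w" using uniq[of ?z] vw by blast
    qed
    show "(\<lambda>v. frag_coset B (cone_cycle m k v)) ` V = frag_coset B ` Z"
    proof
      show "(\<lambda>v. frag_coset B (cone_cycle m k v)) ` V \<subseteq> frag_coset B ` Z" using cone_cycle_Z by blast
      show "frag_coset B ` Z \<subseteq> (\<lambda>v. frag_coset B (cone_cycle m k v)) ` V"
      proof
        fix C assume "C \<in> frag_coset B ` Z"
        then obtain z where z: "z \<in> Z" "C = frag_coset B z" by blast
        obtain v where v: "v \<in> V" "in_lattice R A (\<lambda>i. coef z i - v i)"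
          using uniq by blast
        have "C = frag_coset B (cone_cycle m k v)" using z(2) v(2) eq[OF z(1)] by blast
        then show "C \<in> (\<lambda>v. frag_coset B (cone_cycle m k v)) ` V" using v(1) by (rule image_eqI)
      qed
    qed
  qed
qed

text \<open>Above dimension \<open>k\<close> there are no faces, so the top homology is the
  torsion-free group of cycles on \<open>S\<close>; and a boundary vanishing on \<open>R\<close>
  vanishes, so the rows in \<open>R\<close> suffice to detect cycles.\<close>

lemma betti_top_eq_0_iff: "betti (int k) X = 0 \<longleftrightarrow> int_kernel_trivial R A"
proof
  assume K: "int_kernel_trivial R A"
  have "c = 0" if c: "c \<in> Ztop" for c
  proof (rule poly_mapping_eqI)
    fix t
    have keys: "supp c \<subseteq> S" and "boundary_map c = 0" using c by (auto simp: Ztop_def)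
    then have "\<forall>i\<in>R. (\<Sum>j\<in>R. A i j * coef c (f j)) = 0"
      using lookup_boundary_S[OF keys] by simp
    then have z: "\<forall>j\<in>R. coef c (f j) = 0" 
      using K[unfolded int_kernel_trivial_def, THEN spec, of "\<lambda>j. coef c (f j)"] by simp
    show "coef c t = coef 0 t"
    proof (cases "t \<in> S")
      case True
      then obtain j where "j \<in> R" "t = f j" using bij by (auto simp: bij_betw_def)
      then show ?thesis using z by simp
    next
      case False
      then have "t \<notin> supp c" using keys by blast
      then show ?thesis by (simp add: in_keys_iff)
    qed
  qed
  then have "Ztop \<subseteq> {0}" by blast
  then have "finite (frag_coset {0} ` Ztop)" using finite_subset by blast
  then show "betti (int k) X = 0"
    unfolding betti_def homology_top by (rule top.rank_eq_0_if_finite)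
next
  assume b: "betti (int k) X = 0"
  show "int_kernel_trivial R A"
  proof (rule ccontr)
    assume "\<not> int_kernel_trivial R A"
    then obtain c j where c: "\<forall>i\<in>R. (\<Sum>j\<in>R. A i j * c j) = 0" and j: "j \<in> R" "c j \<noteq> 0"
      by (auto simp: int_kernel_trivial_def)
    have "boundary_map (S_chain c) = 0"
      using c by (intro Z_eq_0 boundary_S_in_Z keys_S_chain) (simp add: lookup_boundary_S_chain)
    then have "S_chain c \<in> Ztop" using keys_S_chain by (simp add: Ztop_def)
    moreover have "S_chain c \<noteq> 0" using lookup_S_chain[OF j(1), of c] j(2) by auto
    ultimately have "betti (int k) X \<noteq> 0"
      unfolding betti_def homology_top by (intro top.rank_ne_0_if_torsion_free[of "S_chain c"]) auto
    then show False using b by simp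
  qed
qed

lemma homology_of_nonzero_det:
  assumes "sdet R A \<noteq> 0"
  shows "betti (int k) X = 0" "betti (int k - 1) X = 0"
    "int (card (carrier (reduced_homology X (int k - 1)))) = \<bar>sdet R A\<bar>"
proof -
  have "index_is_det R A" by (rule lattice_index_det) simp
  then obtain V where K: "int_kernel_trivial R A" and V: "lattice_transversal R A V" and c: "int (card V) = \<bar>sdet R A\<bar>"
    using assms by (auto simp: index_is_det_def)
  show "betti (int k) X = 0" using K betti_top_eq_0_iff by simp
  have fin: "finite (frag_coset B ` Z)"
    using bij_betw_finite[OF bij_transversal_homology[OF V]] V by (simp add: lattice_transversal_def)
  then show "betti (int k - 1) X = 0"
    unfolding betti_def homology_low by (rule low.rank_eq_0_if_finite)
  show "int (card (carrier (reduced_homology X (int k - 1)))) = \<bar>sdet R A\<bar>"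
    unfolding homology_low low.carrier_H using bij_betw_same_card[OF bij_transversal_homology[OF V]] c by simp
qed

lemma betti_top_ne_0: "sdet R A = 0 \<Longrightarrow> betti (int k) X \<noteq> 0"
  using lattice_index_det[of R A] betti_top_eq_0_iff by (simp add: index_is_det_def)

end

lemma tree_faces_bij_exists:
  assumes "S \<subseteq> ksub (Suc m) (Suc k)" "card S = m choose k"
  obtains f where "tree_faces m k S f"
proof -
  have "finite S" using assms(1) finite_subset finite_ksub by blast
  moreover have "card (ksub m k) = card S" using assms(2) card_ksub by simp
  ultimately have "\<exists>f. bij_betw f (ksub m k) S" by (rule finite_same_card_bij[OF finite_ksub])
  then obtain f where "bij_betw f (ksub m k) S" ..
  then show ?thesis using assms(1) by (intro that[of f]) unfold_locales
qed

text \<open>A face set of the right size has a square matrix. A zero determinant would produce a top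
  cycle; a nonzero one kills the top homology and makes the homology below finite.\<close>

theorem hypertrees_eq:
  "hypertrees (Suc m) k = tree_complex (Suc m) k ` {S. S \<subseteq> ksub (Suc m) (Suc k) \<and> weight (Suc m) k S \<noteq> 0}"
proof (intro equalityI subsetI)
  fix T assume T: "T \<in> hypertrees (Suc m) k"
  define S where "S = faces T (int k)"
  have TC: "T \<in> complexes (Suc m) k" and card: "card S = m choose k" and b: "betti (int k) T = 0"
    using T by (auto simp: hypertrees_def S_def)
  have S: "S \<subseteq> ksub (Suc m) (Suc k)" and eq: "T = tree_complex (Suc m) k S"
    using complexes_eq_tree_complex[OF TC] by (simp_all add: S_def)
  obtain f where "tree_faces m k S f" using tree_faces_bij_exists[OF S card] .
  then interpret tree_faces m k S f .
  have "sdet R A \<noteq> 0" using betti_top_ne_0 b eq by blast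
  then have "weight (Suc m) k S \<noteq> 0" using weight_eq_square[OF S bij] by simp
  then show "T \<in> tree_complex (Suc m) k ` {S. S \<subseteq> ksub (Suc m) (Suc k) \<and> weight (Suc m) k S \<noteq> 0}"
    using S eq by blast
next
  fix T assume "T \<in> tree_complex (Suc m) k ` {S. S \<subseteq> ksub (Suc m) (Suc k) \<and> weight (Suc m) k S \<noteq> 0}"
  then obtain S where S: "S \<subseteq> ksub (Suc m) (Suc k)" and w: "weight (Suc m) k S \<noteq> 0" and eq: "T = tree_complex (Suc m) k S"
    by blast
  have card: "card S = m choose k" using weight_nonzero_card[OF S w] .
  obtain f where "tree_faces m k S f" using tree_faces_bij_exists[OF S card] .
  then interpret tree_faces m k S f .
  have "sdet R A \<noteq> 0" using weight_eq_square[OF S bij] w by auto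
  then show "T \<in> hypertrees (Suc m) k"
    using homology_of_nonzero_det(1,2) tree_complex_in_complexes[OF S] card faces_tree_complex(1)[OF S]
    by (simp add: hypertrees_def eq)
qed

theorem card_homology_square:
  assumes S: "S \<subseteq> ksub (Suc m) (Suc k)" and w: "weight (Suc m) k S \<noteq> 0"
  shows "(real (card (carrier (reduced_homology (tree_complex (Suc m) k S) (int k - 1)))))\<^sup>2 =
    real_of_int (weight (Suc m) k S)"
proof -
  obtain f where "tree_faces m k S f" using tree_faces_bij_exists[OF S weight_nonzero_card[OF S w]] .
  then interpret tree_faces m k S f .
  have "sdet R A \<noteq> 0" using weight_eq_square[OF S bij] w by auto
  then have "int (card (carrier (reduced_homology X (int k - 1)))) = \<bar>sdet R A\<bar>"
    by (rule homology_of_nonzero_det(3))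
  then have "real (card (carrier (reduced_homology X (int k - 1)))) = real_of_int \<bar>sdet R A\<bar>"
    by (metis of_int_of_nat_eq)
  then show ?thesis using weight_eq_square[OF S bij] by simp
qed

section \<open>Laws of the link and of the deletion\<close>

lemma bind_pmf_finite:
  assumes "finite A" "set_pmf M \<subseteq> A"
  shows "pmf (bind_pmf M N) x = (\<Sum>a\<in>A. pmf M a * pmf (N a) x)"
  unfolding pmf_bind using assms by (subst integral_measure_pmf_real[of A]) (auto simp: mult.commute)

lemma pmf_map_finite:
  assumes "finite A" "set_pmf M \<subseteq> A"
  shows "pmf (map_pmf f M) x = (\<Sum>a\<in>A. if f a = x then pmf M a else 0)"
  unfolding map_pmf_def bind_pmf_finite[OF assms] by (intro sum.cong) (auto simp: indicator_def)

lemma pmf_eqI_on: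
  assumes "set_pmf p \<subseteq> U" "set_pmf q \<subseteq> U" "\<And>x. x \<in> U \<Longrightarrow> pmf p x = pmf q x"
  shows "p = q"
proof (rule pmf_eqI)
  fix x show "pmf p x = pmf q x"
  proof (cases "x \<in> U")
    case False
    then have "x \<notin> set_pmf p" "x \<notin> set_pmf q" using assms by blast+
    then show ?thesis by (simp add: set_pmf_iff)
  qed (use assms in simp)
qed

section \<open>Thinning and thickening by a random subset\<close>

definition random_subset :: "'a set \<Rightarrow> real \<Rightarrow> 'a set pmf" where
  "random_subset F p = map_pmf (\<lambda>w. {s \<in> F. w s}) (Pi_pmf F False (\<lambda>_. bernoulli_pmf p))"

lemma set_random_subset: "set_pmf (random_subset F p) \<subseteq> Pow F"
  by (auto simp: random_subset_def)

text \<open>Prescribing the subset on \<open>D\<close> fixes finitely many independent coordinates,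
  and those outside \<open>D\<close> integrate out.\<close>

lemma prob_random_subset_Int:
  assumes "finite F" "D \<subseteq> F" "C \<subseteq> D" "0 \<le> p" "p \<le> 1"
  shows "measure_pmf.prob (random_subset F p) {Y. Y \<inter> D = C} = p ^ card C * (1 - p) ^ card (D - C)"
proof -
  have fD: "finite D" using assms finite_subset by blast
  have "measure_pmf.prob (random_subset F p) {Y. Y \<inter> D = C} =
      measure_pmf.prob (Pi_pmf F False (\<lambda>_. bernoulli_pmf p)) {w. {s \<in> F. w s} \<inter> D = C}"
    unfolding random_subset_def measure_map_pmf by (simp add: vimage_def)
  also have "{w. {s \<in> F. w s} \<inter> D = C} =
      (\<lambda>w x. if x \<in> D then w x else False) -` {\<lambda>x. x \<in> C}"
  proof (intro equalityI subsetI)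
    fix w assume a: "w \<in> {w. {s \<in> F. w s} \<inter> D = C}"
    have "(if x \<in> D then w x else False) = (x \<in> C)" for x
      using a assms(2,3) by auto
    then show "w \<in> (\<lambda>w x. if x \<in> D then w x else False) -` {\<lambda>x. x \<in> C}" by simp
  next
    fix w assume "w \<in> (\<lambda>w x. if x \<in> D then w x else False) -` {\<lambda>x. x \<in> C}"
    then have "(if x \<in> D then w x else False) = (x \<in> C)" for x by (simp add: fun_eq_iff)
    then have "x \<in> D \<Longrightarrow> w x = (x \<in> C)" for x by presburger
    then show "w \<in> {w. {s \<in> F. w s} \<inter> D = C}" using assms(2,3) by auto
  qed
  also have "measure_pmf.prob (Pi_pmf F False (\<lambda>_. bernoulli_pmf p)) \<dots> =
      pmf (Pi_pmf D False (\<lambda>_. bernoulli_pmf p)) (\<lambda>x. x \<in> C)"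
    unfolding Pi_pmf_subset[OF assms(1,2)] pmf_map ..
  also have "\<dots> = (\<Prod>x\<in>D. pmf (bernoulli_pmf p) (x \<in> C))"
    using fD assms(3) by (subst pmf_Pi) auto
  also have "\<dots> = (\<Prod>x\<in>D. if x \<in> C then p else 1 - p)"
    using assms by (intro prod.cong) auto
  also have "\<dots> = (\<Prod>x\<in>C. p) * (\<Prod>x\<in>D - C. 1 - p)"
  proof -
    have "D = C \<union> (D - C)" using assms(3) by blast
    then have "(\<Prod>x\<in>D. if x \<in> C then p else 1 - p) =
        (\<Prod>x\<in>C. if x \<in> C then p else 1 - p) * (\<Prod>x\<in>D - C. if x \<in> C then p else 1 - p)"
      using fD finite_subset[OF assms(3)] prod.subset_diff[OF assms(3) fD, of "\<lambda>x. if x \<in> C then p else 1 - p"]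
      by (simp add: mult.commute)
    then show ?thesis by simp
  qed
  finally show ?thesis by simp
qed

text \<open>\<open>T - Y = B\<close> means \<open>B \<subseteq> T\<close> and
  \<open>Y \<inter> T = T - B\<close>, an event about the coordinates in \<open>T\<close> only.
  Writing T as \<open>B \<union> S\<close> gives the index set of the inclusion sums.\<close>

lemma pmf_thinning:
  assumes "finite F" "set_pmf q \<subseteq> Pow F" "B \<subseteq> F" "0 \<le> p" "p \<le> 1"
  shows "pmf (map_pmf (\<lambda>(T, Y). T - Y) (pair_pmf q (random_subset F p))) B =
    (\<Sum>S\<in>Pow (F - B). pmf q (B \<union> S) * (p ^ card S * (1 - p) ^ card B))"
proof -
  let ?r = "random_subset F p"
  let ?m = "\<lambda>T. map_pmf (\<lambda>Y. T - Y) ?r"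
  have "map_pmf (\<lambda>(T, Y). T - Y) (pair_pmf q ?r) =
      bind_pmf q (\<lambda>T. ?m T)"
    by (simp add: pair_pmf_def map_bind_pmf map_pmf_def bind_assoc_pmf bind_return_pmf)
  then have "pmf (map_pmf (\<lambda>(T, Y). T - Y) (pair_pmf q ?r)) B =
      (\<Sum>T\<in>Pow F. pmf q T * pmf (?m T) B)"
    using assms by (simp add: bind_pmf_finite[of "Pow F"])
  also have "\<dots> = (\<Sum>T\<in>Pow F. if B \<subseteq> T then pmf q T * (p ^ card (T - B) * (1 - p) ^ card B) else 0)"
  proof (rule sum.cong)
    fix T assume T: "T \<in> Pow F"
    have m: "pmf (?m T) B =
        measure_pmf.prob ?r {Y. T - Y = B}"
      unfolding pmf_map by (simp add: vimage_def)
    show "pmf q T * pmf (?m T) B =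
        (if B \<subseteq> T then pmf q T * (p ^ card (T - B) * (1 - p) ^ card B) else 0)"
    proof (cases "B \<subseteq> T")
      case True
      then have "{Y. T - Y = B} = {Y. Y \<inter> T = T - B}" "T - (T - B) = B" by blast+
      then show ?thesis
        unfolding m using prob_random_subset_Int[of F T "T - B" p] True T assms by simp
    next
      case False
      then have "{Y. T - Y = B} = {}" by blast
      then show ?thesis unfolding m using False by simp
    qed
  qed simp
  also have "\<dots> = (\<Sum>T | T \<in> Pow F \<and> B \<subseteq> T. pmf q T * (p ^ card (T - B) * (1 - p) ^ card B))"
    using assms by (intro sum.inter_filter[symmetric]) simp
  also have "\<dots> = (\<Sum>S\<in>Pow (F - B). pmf q (B \<union> S) * (p ^ card S * (1 - p) ^ card B))"
  proof (rule sum.reindex_bij_witness[where i = "\<lambda>S. B \<union> S" and j = "\<lambda>T. T - B"])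
    fix T assume T: "T \<in> {T. T \<in> Pow F \<and> B \<subseteq> T}"
    then show "B \<union> (T - B) = T" by blast
    then show "pmf q (B \<union> (T - B)) * (p ^ card (T - B) * (1 - p) ^ card B) =
        pmf q T * (p ^ card (T - B) * (1 - p) ^ card B)" by simp
  qed (use assms(3) in auto)
  finally show ?thesis .
qed

lemma pmf_thickening:
  assumes "finite F" "set_pmf q \<subseteq> Pow F" "A \<subseteq> F" "0 \<le> p" "p \<le> 1"
  shows "pmf (map_pmf (\<lambda>(T, Y). T \<union> Y) (pair_pmf q (random_subset F p))) A =
    (\<Sum>T\<in>Pow A. pmf q T * (p ^ card (A - T) * (1 - p) ^ card (F - A)))"
proof -
  let ?r = "random_subset F p"
  let ?m = "\<lambda>T. map_pmf (\<lambda>Y. T \<union> Y) ?r"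
  have "map_pmf (\<lambda>(T, Y). T \<union> Y) (pair_pmf q ?r) =
      bind_pmf q (\<lambda>T. ?m T)"
    by (simp add: pair_pmf_def map_bind_pmf map_pmf_def bind_assoc_pmf bind_return_pmf)
  then have "pmf (map_pmf (\<lambda>(T, Y). T \<union> Y) (pair_pmf q ?r)) A =
      (\<Sum>T\<in>Pow F. pmf q T * pmf (?m T) A)"
    using assms by (simp add: bind_pmf_finite[of "Pow F"])
  also have "\<dots> = (\<Sum>T\<in>Pow A. pmf q T * pmf (?m T) A)"
  proof (rule sum.mono_neutral_right)
    show "\<forall>T\<in>Pow F - Pow A. pmf q T * pmf (?m T) A = 0"
    proof
      fix T assume "T \<in> Pow F - Pow A"
      then have "(\<lambda>Y. T \<union> Y) -` {A} = {}" by blast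
      then show "pmf q T * pmf (?m T) A = 0"
        unfolding pmf_map by simp
    qed
  qed (use assms in auto)
  also have "\<dots> = (\<Sum>T\<in>Pow A. pmf q T * (p ^ card (A - T) * (1 - p) ^ card (F - A)))"
  proof (rule sum.cong)
    fix T assume T: "T \<in> Pow A"
    have "pmf (?m T) A = measure_pmf.prob ?r ({Y. T \<union> Y = A} \<inter> set_pmf ?r)"
      unfolding pmf_map measure_Int_set_pmf by (simp add: vimage_def)
    \<comment> \<open>The two events agree only for \<open>Y \<subseteq> F\<close>, hence the
      intersection with the support.\<close>
    also have "{Y. T \<union> Y = A} \<inter> set_pmf ?r = {Y. Y \<inter> (F - T) = A - T} \<inter> set_pmf ?r"
      using set_random_subset[of F p] T assms(3) by blast
    also have "measure_pmf.prob ?r ({Y. Y \<inter> (F - T) = A - T} \<inter> set_pmf ?r) =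
        p ^ card (A - T) * (1 - p) ^ card ((F - T) - (A - T))"
      unfolding measure_Int_set_pmf using assms T by (intro prob_random_subset_Int) auto
    also have "(F - T) - (A - T) = F - A" using T by blast
    finally show "pmf q T * pmf (?m T) A =
       pmf q T * (p ^ card (A - T) * (1 - p) ^ card (F - A))" by simp
  qed simp
  finally show ?thesis .
qed

text \<open>The hypertree law on sets of \<open>k\<close>-faces, normalised by the sum of the
  weights. The closed form of the denominator enters through \<open>total_weight_eq\<close>, which
  starts at two vertices.\<close>

definition tree_pmf :: "nat \<Rightarrow> nat \<Rightarrow> nat set set pmf" where
  "tree_pmf m k = embed_pmf (\<lambda>S. if S \<subseteq> ksub m (Suc k)
     then real_of_int (weight m k S) / real_of_int (total_weight m k) else 0)"

lemma total_weight_pos: "total_weight (Suc m) k > 0"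
proof -
  have "total_weight (Suc m) k \<ge> 0"
    unfolding total_weight_def by (intro sum_nonneg) (simp add: weight_nonneg)
  then show ?thesis using superset_weights_minor(3)[of "{}" m k] by simp
qed

lemma pmf_tree_pmf:
  "pmf (tree_pmf (Suc m) k) S = (if S \<subseteq> ksub (Suc m) (Suc k)
     then real_of_int (weight (Suc m) k S) / real_of_int (total_weight (Suc m) k) else 0)"
  unfolding tree_pmf_def
proof (rule pmf_embed_pmf)
  let ?f = "\<lambda>S. if S \<subseteq> ksub (Suc m) (Suc k)
     then real_of_int (weight (Suc m) k S) / real_of_int (total_weight (Suc m) k) else 0"
  show nn: "0 \<le> ?f S" for S
    using total_weight_pos[of m k] weight_nonneg[of S m k] by simp
  have "(\<integral>\<^sup>+S. ennreal (?f S) \<partial>count_space UNIV) = (\<Sum>S\<in>Pow (ksub (Suc m) (Suc k)). ennreal (?f S))"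
    by (rule nn_integral_count_space') auto
  also have "\<dots> = ennreal (\<Sum>S\<in>Pow (ksub (Suc m) (Suc k)). ?f S)"
    by (rule sum_ennreal) (rule nn)
  also have "(\<Sum>S\<in>Pow (ksub (Suc m) (Suc k)). ?f S) =
      (\<Sum>S\<in>Pow (ksub (Suc m) (Suc k)). real_of_int (weight (Suc m) k S)) / real_of_int (total_weight (Suc m) k)"
    unfolding sum_divide_distrib by (intro sum.cong) auto
  also have "\<dots> = 1"
  proof -
    have "(\<Sum>S\<in>Pow (ksub (Suc m) (Suc k)). real_of_int (weight (Suc m) k S)) = real_of_int (total_weight (Suc m) k)"
      by (simp add: total_weight_def)
    then show ?thesis using total_weight_pos[of m k] by simp
  qed
  finally show "(\<integral>\<^sup>+S. ennreal (?f S) \<partial>count_space UNIV) = 1" by simp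
qed

lemma set_tree_pmf: "set_pmf (tree_pmf (Suc m) k) = {S. S \<subseteq> ksub (Suc m) (Suc k) \<and> weight (Suc m) k S \<noteq> 0}"
  using total_weight_pos[of m k] by (auto simp: set_pmf_iff pmf_tree_pmf split: if_splits)

lemma set_tree_pmf_subset: "set_pmf (tree_pmf (Suc m) k) \<subseteq> Pow (ksub (Suc m) (Suc k))"
  by (auto simp: set_tree_pmf)

text \<open>Up to a constant, both point masses at \<open>B\<close> are m^|B| times the weight of
  the trees containing \<open>B\<close>: on the left by \<open>deletion_weight_eq\<close>, on the
  right by thinning trees of constant size.\<close>

theorem deletion_tree_pmf:
  fixes p k :: nat
  defines "m \<equiv> Suc p"
  shows "map_pmf (deletion_faces m) (tree_pmf (Suc m) k) =
    map_pmf (\<lambda>(T, Y). T - Y) (pair_pmf (tree_pmf m k) (random_subset (ksub m (Suc k)) (1 / real (Suc m))))"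
    (is "?L = ?R")
proof (rule pmf_eqI_on)
  let ?F = "ksub m (Suc k)" and ?q = "1 / real (Suc m)"
  let ?w = "weight (Suc m) k" and ?T = "tree_pmf (Suc m) k"
  let ?s = "real_of_int (total_weight m k)"
  show "set_pmf ?L \<subseteq> Pow ?F"
  proof -
    have "deletion_faces m T \<in> Pow ?F" if "T \<in> set_pmf ?T" for T
      using that deletion_subset[of T m "Suc k"] by (simp add: set_tree_pmf)
    then show ?thesis by auto
  qed
  show "set_pmf ?R \<subseteq> Pow ?F"
    using set_tree_pmf_subset[of p k] by (auto simp: m_def)
  fix B assume B: "B \<in> Pow ?F"
  have fB: "finite B" using B finite_subset finite_ksub by blast
  have s: "?s \<noteq> 0" using total_weight_pos[of p k] by (simp add: m_def)
  have "pmf ?L B = (\<Sum>T\<in>Pow (ksub (Suc m) (Suc k)). if deletion_faces m T = B then pmf ?T T else 0)"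
    by (rule pmf_map_finite[OF _ set_tree_pmf_subset]) simp
  also have "\<dots> = (\<Sum>B'\<in>Pow ?F. \<Sum>A\<in>Pow (ksub m k).
      if deletion_faces m (cone_join m A B') = B then pmf ?T (cone_join m A B') else 0)"
    by (rule sum_Pow_cone_join)
  also have "\<dots> = (\<Sum>B'\<in>Pow ?F. if B' = B then \<Sum>A\<in>Pow (ksub m k). pmf ?T (cone_join m A B) else 0)"
    by (intro sum.cong) (auto simp: cone_join_deletion)
  also have "\<dots> = (\<Sum>A\<in>Pow (ksub m k). pmf ?T (cone_join m A B))"
    using B by simp
  also have "\<dots> = (\<Sum>A\<in>Pow (ksub m k). real_of_int (?w (cone_join m A B)) / real_of_int (total_weight (Suc m) k))"
    using B cone_join_subset[of _ m k B] by (intro sum.cong) (auto simp: pmf_tree_pmf)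
  also have "\<dots> = real_of_int (\<Sum>A\<in>Pow (ksub m k). ?w (cone_join m A B)) / real (Suc m) ^ (p choose k)"
    unfolding m_def by (simp add: total_weight_eq flip: sum_divide_distrib)
  also have "real_of_int (\<Sum>A\<in>Pow (ksub m k). ?w (cone_join m A B)) =
      real m ^ card B * (\<Sum>S\<in>Pow (?F - B). real_of_int (weight m k (B \<union> S))) / ?s"
  proof -
    have "real_of_int ((\<Sum>A\<in>Pow (ksub m k). ?w (cone_join m A B)) * total_weight m k) =
        real_of_int (int m ^ card B * (\<Sum>S\<in>Pow (?F - B). weight m k (B \<union> S)))"
      using deletion_weight_eq[of B p k] B by (simp add: m_def)
    then show ?thesis using s by (simp add: field_simps)
  qed
  also have "real m ^ card B * (\<Sum>S\<in>Pow (?F - B). real_of_int (weight m k (B \<union> S))) / ?s / real (Suc m) ^ (p choose k) =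
      (\<Sum>S\<in>Pow (?F - B). real_of_int (weight m k (B \<union> S)) / ?s * (real m ^ card B / real (Suc m) ^ (p choose k)))"
    unfolding sum_distrib_right[symmetric] sum_divide_distrib[symmetric] by (simp add: mult.commute)
  also have "\<dots> = (\<Sum>S\<in>Pow (?F - B). pmf (tree_pmf m k) (B \<union> S) * (?q ^ card S * (1 - ?q) ^ card B))"
  proof (rule sum.cong)
    fix S assume S: "S \<in> Pow (?F - B)"
    show "real_of_int (weight m k (B \<union> S)) / ?s * (real m ^ card B / real (Suc m) ^ (p choose k)) =
        pmf (tree_pmf m k) (B \<union> S) * (?q ^ card S * (1 - ?q) ^ card B)"
    proof (cases "weight m k (B \<union> S) = 0")
      case True then show ?thesis by (simp add: m_def pmf_tree_pmf)
    next
      case False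
      have sub: "B \<union> S \<subseteq> ?F" using S B by blast
      have "finite S" using S finite_subset[of S ?F] by auto
      then have "card (B \<union> S) = card B + card S" using fB S by (intro card_Un_disjoint) auto
      \<comment> \<open>The size of the tree \<open>B \<union> S\<close> is also the exponent in the
        total weight on m+1 vertices, so q^|S| (1-q)^|B| has exactly the denominator
        required.\<close>
      then have c: "p choose k = card B + card S"
        using weight_nonzero_card[of "B \<union> S" p k] sub False by (simp add: m_def)
      have q: "1 - ?q = real m / real (Suc m)" by (simp add: field_simps)
      have "?q ^ card S * (1 - ?q) ^ card B = real m ^ card B / real (Suc m) ^ (p choose k)"
        unfolding q c by (simp add: power_divide power_add)
      then show ?thesis using sub by (simp add: m_def pmf_tree_pmf)
    qed
  qed simp
  also have "\<dots> = pmf ?R B"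
    using set_tree_pmf_subset[of p k] B by (intro pmf_thinning[symmetric]) (auto simp: m_def)
  finally show "pmf ?L B = pmf ?R B" .
qed

theorem link_tree_pmf:
  fixes p k :: nat
  defines "m \<equiv> Suc p"
  shows "map_pmf (link_faces m) (tree_pmf (Suc m) (Suc k)) =
    map_pmf (\<lambda>(T, Y). T \<union> Y) (pair_pmf (tree_pmf m k) (random_subset (ksub m (Suc k)) (1 / real (Suc m))))"
    (is "?L = ?R")
proof (rule pmf_eqI_on)
  let ?F = "ksub m (Suc k)" and ?q = "1 / real (Suc m)"
  let ?s = "real_of_int (total_weight m k)"
  let ?w = "weight (Suc m) (Suc k)" and ?T = "tree_pmf (Suc m) (Suc k)" and ?K = "ksub m (Suc (Suc k))"
  show "set_pmf ?L \<subseteq> Pow ?F"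
  proof -
    have "link_faces m T \<in> Pow ?F" if "T \<in> set_pmf ?T" for T
      using that link_subset[of T m "Suc k"] by (simp add: set_tree_pmf)
    then show ?thesis by auto
  qed
  show "set_pmf ?R \<subseteq> Pow ?F"
    using set_tree_pmf_subset[of p k] set_random_subset[of ?F ?q] by (auto simp: m_def)
  fix A assume A: "A \<in> Pow ?F"
  have s: "?s \<noteq> 0" using total_weight_pos[of p k] by (simp add: m_def)
  have "pmf ?L A = (\<Sum>T\<in>Pow (ksub (Suc m) (Suc (Suc k))). if link_faces m T = A then pmf ?T T else 0)"
    by (rule pmf_map_finite[OF _ set_tree_pmf_subset]) simp
  also have "\<dots> = (\<Sum>B\<in>Pow ?K. \<Sum>A'\<in>Pow ?F.
      if link_faces m (cone_join m A' B) = A then pmf ?T (cone_join m A' B) else 0)"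
    by (rule sum_Pow_cone_join)
  also have "\<dots> = (\<Sum>B\<in>Pow ?K. \<Sum>A'\<in>Pow ?F. if A' = A then pmf ?T (cone_join m A B) else 0)"
    by (intro sum.cong) (auto simp: cone_join_link[of _ m "Suc k" _ "Suc (Suc k)"])
  also have "\<dots> = (\<Sum>B\<in>Pow ?K. pmf ?T (cone_join m A B))"
    using A by simp
  also have "\<dots> = (\<Sum>B\<in>Pow ?K. real_of_int (?w (cone_join m A B)) / real_of_int (total_weight (Suc m) (Suc k)))"
    using A cone_join_subset[of A m "Suc k"] by (intro sum.cong) (auto simp: pmf_tree_pmf)
  also have "\<dots> = real_of_int (\<Sum>B\<in>Pow ?K. ?w (cone_join m A B)) / real (Suc m) ^ (p choose Suc k)"
    unfolding m_def by (simp add: total_weight_eq flip: sum_divide_distrib)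
  also have "real_of_int (\<Sum>B\<in>Pow ?K. ?w (cone_join m A B)) =
      real m ^ card (?F - A) * (\<Sum>S\<in>Pow A. real_of_int (weight m k S)) / ?s"
  proof -
    have "real_of_int ((\<Sum>B\<in>Pow ?K. ?w (cone_join m A B)) * total_weight m k) =
        real_of_int (int m ^ card (?F - A) * (\<Sum>S\<in>Pow A. weight m k S))"
      using link_weight_eq[of A p k] A by (simp add: m_def)
    then show ?thesis using s by (simp add: field_simps)
  qed
  also have "real m ^ card (?F - A) * (\<Sum>S\<in>Pow A. real_of_int (weight m k S)) / ?s / real (Suc m) ^ (p choose Suc k) =
      (\<Sum>S\<in>Pow A. real_of_int (weight m k S) / ?s * (real m ^ card (?F - A) / real (Suc m) ^ (p choose Suc k)))"
    unfolding sum_distrib_right[symmetric] sum_divide_distrib[symmetric] by (simp add: mult.commute)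
  also have "\<dots> = (\<Sum>S\<in>Pow A. pmf (tree_pmf m k) S * (?q ^ card (A - S) * (1 - ?q) ^ card (?F - A)))"
  proof (rule sum.cong)
    fix S assume S: "S \<in> Pow A"
    show "real_of_int (weight m k S) / ?s * (real m ^ card (?F - A) / real (Suc m) ^ (p choose Suc k)) =
        pmf (tree_pmf m k) S * (?q ^ card (A - S) * (1 - ?q) ^ card (?F - A))"
    proof (cases "weight m k S = 0")
      case True then show ?thesis by (simp add: m_def pmf_tree_pmf)
    next
      case False
      have sub: "S \<subseteq> ?F" using S A by blast
      have fA: "finite A" using A finite_subset[of A ?F] by auto
      have "card S = p choose k" using weight_nonzero_card[of S p k] sub False by (simp add: m_def)
      moreover have "card S + card (A - S) = card A" using S fA by (simp add: card_Diff_subset finite_subset card_mono)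
      moreover have "card A + card (?F - A) = card ?F" using A fA by (simp add: card_Diff_subset card_mono)
      moreover have "card ?F = (p choose k) + (p choose Suc k)" by (simp add: card_ksub m_def)
      \<comment> \<open>By Pascal's rule the number of faces missing from a tree is the exponent in
        the total weight one dimension higher. The missing faces split into those added in
        \<open>A - S\<close> and those absent in \<open>F - A\<close>.\<close>
      ultimately have c: "p choose Suc k = card (?F - A) + card (A - S)" by linarith
      have q: "1 - ?q = real m / real (Suc m)" by (simp add: field_simps)
      have "?q ^ card (A - S) * (1 - ?q) ^ card (?F - A) = real m ^ card (?F - A) / real (Suc m) ^ (p choose Suc k)"
        unfolding q c by (simp add: power_divide power_add)
      then show ?thesis using sub by (simp add: m_def pmf_tree_pmf)
    qed
  qed simp
  also have "\<dots> = pmf ?R A"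
    using set_tree_pmf_subset[of p k] A by (intro pmf_thickening[symmetric]) (auto simp: m_def)
  finally show "pmf ?L A = pmf ?R A" .
qed

section \<open>The coupling\<close>

lemma measurable_measure_pmf_iff: "f \<in> measure_pmf C \<rightarrow>\<^sub>M N \<longleftrightarrow> (\<forall>w. f w \<in> space N)"
  by (auto simp: measurable_def)

lemma has_law_measure_pmf: "has_law (measure_pmf C) Y (measure_pmf (map_pmf Y C))"
proof -
  have "distr (measure_pmf C) (measure_pmf (map_pmf Y C)) Y = measure_pmf (map_pmf Y C)"
    by (rule measure_eqI) (simp_all add: emeasure_distr measurable_measure_pmf_iff)
  then show ?thesis by (simp add: has_law_def measurable_measure_pmf_iff)
qed

lemma prob_pair_pmf:
  "measure_pmf.prob (pair_pmf p q) (A \<times> B) = measure_pmf.prob p A * measure_pmf.prob q B"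
proof -
  have "measure_pmf.prob (pair_pmf p q) (A \<times> B) =
      measure_pmf.prob (pair_pmf p q) ((A \<inter> set_pmf p) \<times> (B \<inter> set_pmf q))"
    using measure_Int_set_pmf[of "pair_pmf p q" "A \<times> B"] by (simp add: Times_Int_Times)
  also have "\<dots> = measure_pmf.prob p (A \<inter> set_pmf p) * measure_pmf.prob q (B \<inter> set_pmf q)"
    by (intro measure_pmf_prob_product) (auto intro: countable_Int2)
  finally show ?thesis by (simp add: measure_Int_set_pmf)
qed

text \<open>A product law on face sets is transported along \<open>F\<close> and \<open>G\<close>,
  whose target spaces may be smaller than their types.\<close>

lemma indep_var_measure_pmf:
  assumes pair: "map_pmf (\<lambda>w. (X w, Y w)) C = pair_pmf q r"
    and F: "\<And>x. F x \<in> space N" and G: "\<And>y. G y \<in> space L"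
  shows "prob_space.indep_var (measure_pmf C) N (\<lambda>w. F (X w)) L (\<lambda>w. G (Y w))"
proof -
  let ?I = "\<lambda>f N. {f -` A \<inter> space (measure_pmf C) | A. A \<in> sets N}"
  have prob: "measure_pmf.prob C ((\<lambda>w. F (X w)) -` A \<inter> (\<lambda>w. G (Y w)) -` B) =
      measure_pmf.prob q (F -` A) * measure_pmf.prob r (G -` B)" for A B
  proof -
    have "measure_pmf.prob C ((\<lambda>w. F (X w)) -` A \<inter> (\<lambda>w. G (Y w)) -` B) =
        measure_pmf.prob (map_pmf (\<lambda>w. (X w, Y w)) C) ((F -` A) \<times> (G -` B))"
      unfolding measure_map_pmf by (rule arg_cong[where f = "measure_pmf.prob C"]) auto
    then show ?thesis unfolding pair prob_pair_pmf .
  qed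
  have X1: "measure_pmf.prob C ((\<lambda>w. F (X w)) -` A) = measure_pmf.prob q (F -` A)" for A
    using prob[of A UNIV] by simp
  have Y1: "measure_pmf.prob C ((\<lambda>w. G (Y w)) -` B) = measure_pmf.prob r (G -` B)" for B
    using prob[of UNIV B] by simp
  have stable: "Int_stable (?I f N')" for f and N' :: "'x measure"
  proof (rule Int_stableI)
    fix a b assume "a \<in> ?I f N'" "b \<in> ?I f N'"
    then obtain A B where "a = f -` A" "A \<in> sets N'" "b = f -` B" "B \<in> sets N'" by auto
    then have "a \<inter> b = f -` (A \<inter> B) \<inter> space (measure_pmf C)" "A \<inter> B \<in> sets N'" by auto
    then show "a \<inter> b \<in> ?I f N'" by blast
  qed
  have "prob_space.indep_set (measure_pmf C) (?I (\<lambda>w. F (X w)) N) (?I (\<lambda>w. G (Y w)) L)"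
  proof (rule prob_space.indep_setI[OF measure_pmf.prob_space_axioms])
    fix a b assume "a \<in> ?I (\<lambda>w. F (X w)) N" "b \<in> ?I (\<lambda>w. G (Y w)) L"
    then obtain A B where "a = (\<lambda>w. F (X w)) -` A" "b = (\<lambda>w. G (Y w)) -` B" by auto
    then show "measure_pmf.prob C (a \<inter> b) = measure_pmf.prob C a * measure_pmf.prob C b"
      using prob X1 Y1 by simp
  qed auto
  then have "prob_space.indep_set (measure_pmf C) (sigma_sets (space (measure_pmf C)) (?I (\<lambda>w. F (X w)) N))
      (sigma_sets (space (measure_pmf C)) (?I (\<lambda>w. G (Y w)) L))"
    by (rule prob_space.indep_set_sigma_sets[OF measure_pmf.prob_space_axioms]) (rule stable)+
  then show ?thesis
    unfolding prob_space.indep_var_eq[OF measure_pmf.prob_space_axioms] using F G by (simp add: measurable_measure_pmf_iff)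
qed

text \<open>Equal image laws permit gluing: an outcome of \<open>Q\<close> selects a fibre of
  \<open>f\<close>, and \<open>P\<close> conditioned on this random fibre averages back to
  \<open>P\<close>. The second part makes the conditioning legitimate.\<close>

lemma bind_cond_pmf_fibre:
  assumes "map_pmf g Q = map_pmf f P"
  shows "bind_pmf Q (\<lambda>z. cond_pmf P {x. f x = g z}) = P"
    and "z \<in> set_pmf Q \<Longrightarrow> set_pmf P \<inter> {x. f x = g z} \<noteq> {}"
proof -
  have img: "g ` set_pmf Q = f ` set_pmf P" using arg_cong[OF assms, of set_pmf] by simp
  show ne: "set_pmf P \<inter> {x. f x = g z} \<noteq> {}" if "z \<in> set_pmf Q" for z
  proof -
    have "g z \<in> f ` set_pmf P" using that img by blast
    then show ?thesis by auto
  qed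
  have ne': "set_pmf Q \<inter> {z. f x = g z} \<noteq> {}" if "x \<in> set_pmf P" for x
  proof -
    have "f x \<in> g ` set_pmf Q" using that img by blast
    then show ?thesis by auto
  qed
  show "bind_pmf Q (\<lambda>z. cond_pmf P {x. f x = g z}) = P"
  proof (rule bind_cond_pmf_cancel[OF ne ne'])
    fix z x assume "f x = g z"
    have "measure_pmf.prob P {x. f x = g z} = pmf (map_pmf f P) (g z)"
      unfolding pmf_map by (simp add: vimage_def)
    also have "\<dots> = measure_pmf.prob Q {z'. f x = g z'}"
      unfolding assms[symmetric] pmf_map using \<open>f x = g z\<close> by (simp add: vimage_def eq_commute)
    finally show "measure_pmf.prob P {x. f x = g z} = measure_pmf.prob Q {z'. f x = g z'}" .
  qed
qed

text \<open>Injectivity on the support turns \<open>Z = z0\<close> into the event that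
  \<open>Q\<close> chose one particular \<open>z\<close>; given this, the law is the image of a
  product.\<close>

lemma cond_indep_bind_pair_pmf:
  assumes C: "C = bind_pmf Q (\<lambda>z. map_pmf (h z) (pair_pmf (c z) (d z)))"
    and inj: "inj_on Z' (set_pmf Q)"
    and Z: "\<And>z a b. Z (h z (a, b)) = Z' z"
    and X: "\<And>z a b. X (h z (a, b)) = X' a"
    and Y: "\<And>z a b. Y (h z (a, b)) = Y' b"
  shows "cond_indep_given (measure_pmf C) N X L Y Z"
  unfolding cond_indep_given_def
proof (intro allI impI ballI)
  fix z0 A B
  assume pos: "measure_pmf.prob C {w \<in> space (measure_pmf C). Z w = z0} > 0"
  have "\<exists>z\<in>set_pmf Q. Z' z = z0"
  proof (rule ccontr)
    assume no: "\<not> ?thesis"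
    have "{w. Z w = z0} \<inter> set_pmf C = {}" using no Z unfolding C by auto
    then have "measure_pmf.prob C {w. Z w = z0} = 0" using measure_Int_set_pmf[of C "{w. Z w = z0}"] by simp
    then show False using pos by simp
  qed
  then obtain z where z: "z \<in> set_pmf Q" "Z' z = z0" by blast
  \<comment> \<open>With \<open>E\<close> arbitrary, one formula serves the joint event, both
    marginal events and the conditioning event.\<close>
  have ev: "measure_pmf.prob C {w. E w \<and> Z w = z0} =
      pmf Q z * measure_pmf.prob (pair_pmf (c z) (d z)) {ab. E (h z ab)}" for E
  proof -
    have "emeasure C {w. E w \<and> Z w = z0} =
        (\<integral>\<^sup>+x. emeasure (map_pmf (h x) (pair_pmf (c x) (d x))) {w. E w \<and> Z w = z0} \<partial>Q)"
      unfolding C by simp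
    also have "\<dots> = (\<Sum>x\<in>{z}. emeasure (map_pmf (h x) (pair_pmf (c x) (d x))) {w. E w \<and> Z w = z0} * pmf Q x)"
    proof (rule nn_integral_measure_pmf_support)
      fix x assume x: "x \<in> set_pmf Q" "x \<notin> {z}"
      then have "Z' x \<noteq> z0" using inj z by (auto simp: inj_on_def)
      then have "h x -` {w. E w \<and> Z w = z0} = {}" using Z by auto
      then show "emeasure (map_pmf (h x) (pair_pmf (c x) (d x))) {w. E w \<and> Z w = z0} = 0"
        by (simp only: emeasure_map_pmf emeasure_empty)
    qed auto
    also have "h z -` {w. E w \<and> Z w = z0} = {ab. E (h z ab)}" using Z z by auto
    then have "(\<Sum>x\<in>{z}. emeasure (map_pmf (h x) (pair_pmf (c x) (d x))) {w. E w \<and> Z w = z0} * pmf Q x) =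
        emeasure (pair_pmf (c z) (d z)) {ab. E (h z ab)} * pmf Q z"
      by simp
    finally have "ennreal (measure_pmf.prob C {w. E w \<and> Z w = z0}) =
        ennreal (measure_pmf.prob (pair_pmf (c z) (d z)) {ab. E (h z ab)} * pmf Q z)"
      by (simp add: measure_pmf.emeasure_eq_measure ennreal_mult')
    then show ?thesis by (simp add: mult.commute)
  qed
  have q: "pmf Q z > 0" using z(1) by (simp add: pmf_positive)
  have cond: "cond_prob (measure_pmf C) E (\<lambda>w. Z w = z0) = measure_pmf.prob (pair_pmf (c z) (d z)) {ab. E (h z ab)}" for E
    using ev[of E] ev[of "\<lambda>_. True"] q by (simp add: cond_prob_def)
  have hX: "X (h z ab) = X' (fst ab)" and hY: "Y (h z ab) = Y' (snd ab)" for ab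
    using X[of z "fst ab" "snd ab"] Y[of z "fst ab" "snd ab"] by simp_all
  have "{ab. X (h z ab) \<in> A \<and> Y (h z ab) \<in> B} = (X' -` A) \<times> (Y' -` B)"
    "{ab. X (h z ab) \<in> A} = (X' -` A) \<times> UNIV" "{ab. Y (h z ab) \<in> B} = UNIV \<times> (Y' -` B)"
    by (auto simp: hX hY)
  then show "cond_prob (measure_pmf C) (\<lambda>w. X w \<in> A \<and> Y w \<in> B) (\<lambda>w. Z w = z0) =
      cond_prob (measure_pmf C) (\<lambda>w. X w \<in> A) (\<lambda>w. Z w = z0) *
      cond_prob (measure_pmf C) (\<lambda>w. Y w \<in> B) (\<lambda>w. Z w = z0)"
    unfolding cond by (simp add: prob_pair_pmf)
qed

text \<open>The point measure lives on the hypertrees only, so the random trees have to be hypertrees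
  everywhere and not just almost surely.\<close>

definition retract_onto :: "'a set \<Rightarrow> 'a \<Rightarrow> 'a" where
  "retract_onto H x = (if x \<in> H then x else (SOME y. y \<in> H))"

lemma retract_onto_in: "H \<noteq> {} \<Longrightarrow> retract_onto H x \<in> H"
  by (auto simp: retract_onto_def some_in_eq)

section \<open>The random complexes and their laws\<close>

lemma inj_on_tree_complex: "inj_on (tree_complex m k) (Pow (ksub m (Suc k)))"
  by (rule inj_onI) (metis PowD faces_tree_complex(1))

definition tree_variable :: "nat \<Rightarrow> nat \<Rightarrow> nat set set \<Rightarrow> nat set set" where
  "tree_variable m k S = retract_onto (hypertrees m k) (tree_complex m k S)"

lemma tree_complex_hypertree: "S \<in> set_pmf (tree_pmf (Suc m) k) \<Longrightarrow> tree_complex (Suc m) k S \<in> hypertrees (Suc m) k"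
  by (auto simp: hypertrees_eq set_tree_pmf)

lemma tree_variable_eq:
  "S \<in> set_pmf (tree_pmf (Suc m) k) \<Longrightarrow> tree_variable (Suc m) k S = tree_complex (Suc m) k S"
  by (simp add: tree_variable_def retract_onto_def tree_complex_hypertree)

lemma space_hypertree_measure: "space (hypertree_measure m k) = hypertrees m k"
  by (simp add: hypertree_measure_def space_point_measure)

lemma hypertrees_nonempty: "hypertrees (Suc m) k \<noteq> {}"
  using set_pmf_not_empty[of "tree_pmf (Suc m) k"] tree_complex_hypertree by blast

lemma tree_variable_in_space: "tree_variable (Suc m) k S \<in> space (hypertree_measure (Suc m) k)"
  unfolding space_hypertree_measure tree_variable_def by (rule retract_onto_in[OF hypertrees_nonempty])

lemma finite_hypertrees: "finite (hypertrees (Suc m) k)"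
  unfolding hypertrees_eq by (rule finite_imageI, rule finite_subset[of _ "Pow (ksub (Suc m) (Suc k))"]) auto

text \<open>The comparison is by point masses on the finite set of hypertrees. On the support of
  \<open>tree_pmf\<close> the retraction is the identity and \<open>tree_complex\<close> is
  injective, so a hypertree has the mass of its face set. With at least two vertices the subtraction
  in the exponent is exact.\<close>

lemma has_law_tree:
  assumes X: "map_pmf X C = tree_pmf (Suc (Suc p)) k"
  shows "has_law (measure_pmf C) (\<lambda>w. tree_variable (Suc (Suc p)) k (X w)) (hypertree_measure (Suc (Suc p)) k)"
proof -
  let ?m = "Suc (Suc p)"
  let ?\<mu> = "hypertree_measure ?m k" and ?V = "\<lambda>w. tree_variable ?m k (X w)" and ?q = "tree_pmf ?m k"
  have meas: "?V \<in> measure_pmf C \<rightarrow>\<^sub>M ?\<mu>"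
    using tree_variable_in_space by (simp add: measurable_measure_pmf_iff)
  have "distr (measure_pmf C) ?\<mu> ?V = ?\<mu>"
  proof (rule measure_eqI)
    fix A assume "A \<in> sets (distr (measure_pmf C) ?\<mu> ?V)"
    then have A: "A \<in> sets ?\<mu>" by simp
    then have AH: "A \<subseteq> hypertrees ?m k" by (simp add: hypertree_measure_def sets_point_measure)
    have fA: "finite A" using AH finite_hypertrees finite_subset by blast
    have "emeasure (distr (measure_pmf C) ?\<mu> ?V) A = emeasure (measure_pmf C) (?V -` A)"
      using meas A by (simp add: emeasure_distr)
    also have "\<dots> = emeasure (measure_pmf (map_pmf (tree_variable ?m k) ?q)) A"
      unfolding X[symmetric] map_pmf_comp by simp
    also have "map_pmf (tree_variable ?m k) ?q = map_pmf (tree_complex ?m k) ?q"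
      using tree_variable_eq by (intro map_pmf_cong) auto
    also have "emeasure (measure_pmf \<dots>) A = (\<Sum>T\<in>A. ennreal (pmf (map_pmf (tree_complex ?m k) ?q) T))"
      using fA by (simp add: emeasure_measure_pmf_finite sum_ennreal del: emeasure_map_pmf)
    also have "\<dots> = (\<Sum>T\<in>A. ennreal ((real (card (carrier (reduced_homology T (int k - 1)))))\<^sup>2
        / real ?m ^ ((?m - 2) choose k)))"
    proof (rule sum.cong)
      fix T assume "T \<in> A"
      then obtain S where S: "S \<subseteq> ksub ?m (Suc k)" "weight ?m k S \<noteq> 0" "T = tree_complex ?m k S"
        using AH unfolding hypertrees_eq by blast
      have "pmf (map_pmf (tree_complex ?m k) ?q) T = pmf ?q S"
        unfolding S(3)
      proof (rule pmf_map_inj)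
        show "inj_on (tree_complex ?m k) (set_pmf ?q)"
          using inj_on_tree_complex set_tree_pmf_subset by (rule inj_on_subset)
        show "S \<in> set_pmf ?q" using S by (simp add: set_tree_pmf)
      qed
      also have "\<dots> = (real (card (carrier (reduced_homology T (int k - 1)))))\<^sup>2 / real ?m ^ ((?m - 2) choose k)"
        using S card_homology_square[OF S(1,2)] by (simp add: pmf_tree_pmf total_weight_eq)
      finally show "ennreal (pmf (map_pmf (tree_complex ?m k) ?q) T) =
          ennreal ((real (card (carrier (reduced_homology T (int k - 1)))))\<^sup>2 / real ?m ^ ((?m - 2) choose k))"
        by simp
    qed simp
    also have "\<dots> = emeasure ?\<mu> A"
      unfolding hypertree_measure_def using AH finite_hypertrees
      by (intro emeasure_point_measure_finite[symmetric])
    finally show "emeasure (distr (measure_pmf C) ?\<mu> ?V) A = emeasure ?\<mu> A" .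
  qed simp
  then show ?thesis using meas by (simp add: has_law_def)
qed

lemma faces_Pow: "faces (Pow {1..m}) (int k) = ksub m (Suc k)"
proof (rule Set.set_eqI)
  fix s
  show "s \<in> faces (Pow {1..m}) (int k) \<longleftrightarrow> s \<in> ksub m (Suc k)"
    using finite_subset[of s "{1..m}"] by (auto simp: faces_def ksub_def)
qed

lemma linial_meshulam_measure_eq:
  "linial_meshulam_measure m k =
     measure_pmf (map_pmf (tree_complex m k) (random_subset (ksub m (Suc k)) (1 / real (Suc m))))"
  unfolding linial_meshulam_measure_def linial_meshulam_def faces_Pow random_subset_def map_pmf_comp
    tree_complex_def Let_def by simp

lemma has_law_linial_meshulam:
  assumes "map_pmf Y C = random_subset (ksub m (Suc k)) (1 / real (Suc m))"
  shows "has_law (measure_pmf C) (\<lambda>w. tree_complex m k (Y w)) (linial_meshulam_measure m k)"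
  using has_law_measure_pmf[of C "\<lambda>w. tree_complex m k (Y w)"]
  unfolding linial_meshulam_measure_eq assms[symmetric] map_pmf_comp .

text \<open>Faces containing the last vertex come from the cone: a base with at most k vertices
  gives the skeleton, a base in the link gives T. Faces avoiding it come from the difference, whose
  retained skeleton supplies all faces with at most k+1 vertices. The base of the cone contributes
  only faces of that size.\<close>

lemma tree_complex_decomposition:
  assumes T: "T \<subseteq> ksub (Suc m) (Suc (Suc k))"
    and S: "S \<subseteq> ksub m (Suc (Suc k))" and Y: "Y \<subseteq> ksub m (Suc (Suc k))"
    and del: "S - Y = deletion_faces m T" and link: "S' \<union> Y' = link_faces m T"
  shows "tree_complex (Suc m) (Suc k) T =
    Cone (Suc m) (tree_complex m k S' \<union> tree_complex m k Y') \<union>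
    complex_diff m (Suc k) (tree_complex m (Suc k) S) (tree_complex m (Suc k) Y)"
proof -
  let ?n = "Suc m"
  define \<Delta> where "\<Delta> = full_skeleton m (int k - 1) \<union> link_faces m T"
  have \<Delta>: "tree_complex m k S' \<union> tree_complex m k Y' = \<Delta>"
    using link by (auto simp: tree_complex_def \<Delta>_def)
  have diff: "complex_diff m (Suc k) (tree_complex m (Suc k) S) (tree_complex m (Suc k) Y) =
      full_skeleton m (int k) \<union> deletion_faces m T"
    unfolding complex_diff_def faces_tree_complex(1)[OF S] faces_tree_complex(1)[OF Y] del by simp
  have mem: "s \<in> tree_complex ?n (Suc k) T \<longleftrightarrow> s \<subseteq> {1..?n} \<and> card s \<le> Suc k \<or> s \<in> T" for s
    by (auto simp: tree_complex_def full_skeleton_def)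
  have mem\<Delta>: "s \<in> \<Delta> \<longleftrightarrow> s \<subseteq> {1..m} \<and> card s \<le> k \<or> ?n \<notin> s \<and> insert ?n s \<in> T" for s
    by (auto simp: \<Delta>_def full_skeleton_def link_faces_def)
  have memD: "s \<in> full_skeleton m (int k) \<union> deletion_faces m T \<longleftrightarrow>
      s \<subseteq> {1..m} \<and> card s \<le> Suc k \<or> s \<in> T \<and> ?n \<notin> s" for s
    by (auto simp: full_skeleton_def deletion_faces_def)
  have \<Delta>sub: "s \<subseteq> {1..m} \<and> card s \<le> Suc k" if "s \<in> \<Delta>" for s
    using that link_subset[OF T] by (auto simp: \<Delta>_def full_skeleton_def ksub_def)
  show ?thesis
    unfolding \<Delta> diff
  proof (intro equalityI subsetI)
    fix s assume s: "s \<in> tree_complex ?n (Suc k) T"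
    have sub: "s \<subseteq> {1..?n}" using s T unfolding mem by (auto simp: ksub_def)
    show "s \<in> Cone ?n \<Delta> \<union> (full_skeleton m (int k) \<union> deletion_faces m T)"
    proof (cases "?n \<in> s")
      case False
      then have "s \<subseteq> {1..m}" using sub by (auto simp: subset_iff le_Suc_eq)
      then have "s \<in> full_skeleton m (int k) \<union> deletion_faces m T"
        unfolding memD using s[unfolded mem] False by blast
      then show ?thesis by (rule UnI2)
    next
      case True
      define t where "t = s - {?n}"
      have t: "s = insert ?n t" "?n \<notin> t" using True by (auto simp: t_def)
      have "t \<subseteq> {1..m}" using sub by (auto simp: t_def subset_iff le_Suc_eq)
      moreover have "card s = Suc (card t)"
        using t finite_subset[OF sub] by simp
      ultimately have "t \<in> \<Delta>" using s t unfolding mem mem\<Delta> by auto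
      then show ?thesis using t(1) unfolding Cone_def by auto
    qed
  next
    fix s assume "s \<in> Cone ?n \<Delta> \<union> (full_skeleton m (int k) \<union> deletion_faces m T)"
    then consider "s \<in> \<Delta>" | t where "t \<in> \<Delta>" "s = t \<union> {?n}" | "s \<in> full_skeleton m (int k) \<union> deletion_faces m T"
      unfolding Cone_def by blast
    then show "s \<in> tree_complex ?n (Suc k) T"
    proof cases
      case 1
      then show ?thesis using \<Delta>sub[OF 1] unfolding mem by auto
    next
      case 2
      have "finite t" using \<Delta>sub[OF 2(1)] finite_subset[of t "{1..m}"] by auto
      then show ?thesis using 2 \<Delta>sub[OF 2(1)] unfolding mem mem\<Delta> by (auto simp: card_insert_if)
    next
      case 3
      then show ?thesis unfolding memD mem by auto
    qed
  qed
qed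

text \<open>A regrouping: the construction pairs each smaller tree with its own random subset, while
  the sample lists the trees before the subsets.\<close>

definition sample_of :: "nat set set \<Rightarrow> (nat set set \<times> nat set set) \<times> (nat set set \<times> nat set set) \<Rightarrow> sample" where
  "sample_of z = (\<lambda>((t, y), (t', y')). (z, t, t', y, y'))"

theorem theorem1p1:
  fixes n k :: nat
  assumes "1 \<le> k" and "k < n - 1"
  shows "\<exists>(M :: sample measure) T_n_k T_n1_k T_n1_k1 Y_n1_k Y_n1_k1.
    prob_space M \<and>
    has_law M T_n_k (hypertree_measure n k) \<and>
    has_law M T_n1_k (hypertree_measure (n - 1) k) \<and>
    has_law M T_n1_k1 (hypertree_measure (n - 1) (k - 1)) \<and>
    has_law M Y_n1_k (linial_meshulam_measure (n - 1) k) \<and>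
    has_law M Y_n1_k1 (linial_meshulam_measure (n - 1) (k - 1)) \<and>
    prob_space.indep_var M
      (hypertree_measure (n - 1) k) T_n1_k
      (linial_meshulam_measure (n - 1) k) Y_n1_k \<and>
    prob_space.indep_var M
      (hypertree_measure (n - 1) (k - 1)) T_n1_k1
      (linial_meshulam_measure (n - 1) (k - 1)) Y_n1_k1 \<and>
    cond_indep_given M
      (hypertree_measure (n - 1) k) T_n1_k
      (hypertree_measure (n - 1) (k - 1)) T_n1_k1
      T_n_k \<and>
    (AE w in M. T_n_k w =
      Cone n (T_n1_k1 w \<union> Y_n1_k1 w) \<union> complex_diff (n - 1) k (T_n1_k w) (Y_n1_k w))"
proof -
  \<comment> \<open>The hypotheses force n \<ge> 3, so m = n - 1 is at least 2, as the closed form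
    of the total weight on m vertices requires, and l = k - 1 does not truncate.\<close>
  define p where "p = n - 3"
  define l where "l = k - 1"
  define m where "m = Suc (Suc p)"
  have n: "n = Suc m" and n1: "n - 1 = m" and k: "k = Suc l" and k1: "k - 1 = l"
    using assms by (auto simp: p_def l_def m_def)
  let ?Q = "tree_pmf (Suc m) k"
  let ?Y = "random_subset (ksub m (Suc k)) (1 / real (Suc m))"
  let ?Y' = "random_subset (ksub m (Suc l)) (1 / real (Suc m))"
  let ?P = "pair_pmf (tree_pmf m k) ?Y" and ?P' = "pair_pmf (tree_pmf m l) ?Y'"
  let ?f = "\<lambda>(T, Y). T - Y :: nat set set" and ?f' = "\<lambda>(T, Y). T \<union> Y :: nat set set"
  let ?c = "\<lambda>z. cond_pmf ?P {x. ?f x = deletion_faces m z}"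
  let ?c' = "\<lambda>z. cond_pmf ?P' {x. ?f' x = link_faces m z}"
  define C :: "sample pmf" where
    "C = bind_pmf ?Q (\<lambda>z. map_pmf (sample_of z) (pair_pmf (?c z) (?c' z)))"
  have del: "map_pmf (deletion_faces m) ?Q = map_pmf ?f ?P"
    unfolding m_def by (rule deletion_tree_pmf)
  have link: "map_pmf (link_faces m) ?Q = map_pmf ?f' ?P'"
    unfolding m_def k by (rule link_tree_pmf)
  let ?z = "\<lambda>w::sample. fst w" and ?t = "\<lambda>w::sample. fst (snd w)" and ?t' = "\<lambda>w::sample. fst (snd (snd w))"
    and ?y = "\<lambda>w::sample. fst (snd (snd (snd w)))" and ?y' = "\<lambda>w::sample. snd (snd (snd (snd w)))"
  have "map_pmf ?z C = bind_pmf ?Q (\<lambda>z. map_pmf (\<lambda>_. z) (pair_pmf (?c z) (?c' z)))"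
    unfolding C_def map_bind_pmf map_pmf_comp by (simp add: sample_of_def case_prod_beta)
  then have law_z: "map_pmf ?z C = ?Q" by (simp add: map_pmf_const bind_return_pmf')
  have "map_pmf (\<lambda>w. (?t w, ?y w)) C = bind_pmf ?Q (\<lambda>z. map_pmf fst (pair_pmf (?c z) (?c' z)))"
    unfolding C_def map_bind_pmf map_pmf_comp by (simp add: sample_of_def case_prod_beta)
  \<comment> \<open>Although tree and subset are tied to \<open>z\<close> through the fibre,
    averaging over \<open>z\<close> restores their product law. This gives the independence and both
    marginals at once.\<close>
  then have law_ty: "map_pmf (\<lambda>w. (?t w, ?y w)) C = ?P"
    unfolding map_fst_pair_pmf using bind_cond_pmf_fibre(1)[OF del] by simp
  have "map_pmf (\<lambda>w. (?t' w, ?y' w)) C = bind_pmf ?Q (\<lambda>z. map_pmf snd (pair_pmf (?c z) (?c' z)))"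
    unfolding C_def map_bind_pmf map_pmf_comp by (simp add: sample_of_def case_prod_beta)
  then have law_ty': "map_pmf (\<lambda>w. (?t' w, ?y' w)) C = ?P'"
    unfolding map_snd_pair_pmf using bind_cond_pmf_fibre(1)[OF link] by simp
  have law_t: "map_pmf ?t C = tree_pmf m k" and law_y: "map_pmf ?y C = ?Y"
    using arg_cong[OF law_ty, of "map_pmf fst"] arg_cong[OF law_ty, of "map_pmf snd"]
    by (simp_all add: map_pmf_comp map_fst_pair_pmf map_snd_pair_pmf)
  have law_t': "map_pmf ?t' C = tree_pmf m l" and law_y': "map_pmf ?y' C = ?Y'"
    using arg_cong[OF law_ty', of "map_pmf fst"] arg_cong[OF law_ty', of "map_pmf snd"]
    by (simp_all add: map_pmf_comp map_fst_pair_pmf map_snd_pair_pmf)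
  let ?T = "\<lambda>w. tree_variable (Suc m) k (?z w)"
    and ?T1 = "\<lambda>w. tree_variable m k (?t w)" and ?T1' = "\<lambda>w. tree_variable m l (?t' w)"
    and ?Y1 = "\<lambda>w. tree_complex m k (?y w)" and ?Y1' = "\<lambda>w. tree_complex m l (?y' w)"
  have cond_indep: "cond_indep_given (measure_pmf C) (hypertree_measure m k) ?T1 (hypertree_measure m l) ?T1' ?T"
  proof (rule cond_indep_bind_pair_pmf[OF C_def])
    show "inj_on (tree_variable (Suc m) k) (set_pmf ?Q)"
      using inj_on_subset[OF inj_on_tree_complex set_tree_pmf_subset, of m k]
      by (simp add: inj_on_def tree_variable_eq)
    show "?T (sample_of z (a, b)) = tree_variable (Suc m) k z" for z a b
      by (simp add: sample_of_def case_prod_beta)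
    show "?T1 (sample_of z (a, b)) = tree_variable m k (fst a)" for z a b
      by (simp add: sample_of_def case_prod_beta)
    show "?T1' (sample_of z (a, b)) = tree_variable m l (fst b)" for z a b
      by (simp add: sample_of_def case_prod_beta)
  qed
  have decomposition: "?T w = Cone (Suc m) (?T1' w \<union> ?Y1' w) \<union> complex_diff m k (?T1 w) (?Y1 w)"
    if "w \<in> set_pmf C" for w
  proof -
    obtain z t y t' y' where w: "w = (z, t, t', y, y')" by (cases w)
    have z: "z \<in> set_pmf ?Q" and ty: "(t, y) \<in> set_pmf (?c z)" and ty': "(t', y') \<in> set_pmf (?c' z)"
      using that unfolding C_def w by (auto simp: sample_of_def)
    \<comment> \<open>Conditioning makes the fibre equations hold at every point of the support;
      from here on the decomposition is pure set theory.\<close>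
    have "(t, y) \<in> set_pmf ?P" "t - y = deletion_faces m z"
      using ty set_cond_pmf[OF bind_cond_pmf_fibre(2)[OF del z]] by auto
    moreover have "(t', y') \<in> set_pmf ?P'" "t' \<union> y' = link_faces m z"
      using ty' set_cond_pmf[OF bind_cond_pmf_fibre(2)[OF link z]] by auto
    ultimately have t: "t \<in> set_pmf (tree_pmf m k)" and y: "y \<subseteq> ksub m (Suc k)"
      and t': "t' \<in> set_pmf (tree_pmf m l)" and dl: "t - y = deletion_faces m z" "t' \<union> y' = link_faces m z"
      using set_random_subset[of "ksub m (Suc k)" "1 / real (Suc m)"] by (auto simp del: of_nat_Suc)
    have "tree_complex (Suc m) (Suc l) z = Cone (Suc m) (tree_complex m l t' \<union> tree_complex m l y') \<union>
        complex_diff m (Suc l) (tree_complex m (Suc l) t) (tree_complex m (Suc l) y)"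
      using z t y dl unfolding k m_def by (intro tree_complex_decomposition) (auto simp: set_tree_pmf)
    then show ?thesis
      using tree_variable_eq[OF z] tree_variable_eq[of t "Suc p" k] tree_variable_eq[of t' "Suc p" l] t t'
      unfolding w k m_def by simp
  qed
  show ?thesis
    unfolding n1 k1 unfolding n
  proof (intro exI conjI)
    show "prob_space (measure_pmf C)" by (rule measure_pmf.prob_space_axioms)
    show "has_law (measure_pmf C) ?T (hypertree_measure (Suc m) k)"
      using law_z unfolding m_def by (rule has_law_tree)
    show "has_law (measure_pmf C) ?T1 (hypertree_measure m k)"
      using law_t unfolding m_def by (rule has_law_tree)
    show "has_law (measure_pmf C) ?T1' (hypertree_measure m l)"
      using law_t' unfolding m_def by (rule has_law_tree)
    show "has_law (measure_pmf C) ?Y1 (linial_meshulam_measure m k)"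
      using law_y by (rule has_law_linial_meshulam)
    show "has_law (measure_pmf C) ?Y1' (linial_meshulam_measure m l)"
      using law_y' by (rule has_law_linial_meshulam)
    show "prob_space.indep_var (measure_pmf C) (hypertree_measure m k) ?T1 (linial_meshulam_measure m k) ?Y1"
      using law_ty by (rule indep_var_measure_pmf)
        (simp_all add: m_def tree_variable_in_space linial_meshulam_measure_eq)
    show "prob_space.indep_var (measure_pmf C) (hypertree_measure m l) ?T1' (linial_meshulam_measure m l) ?Y1'"
      using law_ty' by (rule indep_var_measure_pmf)
        (simp_all add: m_def tree_variable_in_space linial_meshulam_measure_eq)
    show "cond_indep_given (measure_pmf C) (hypertree_measure m k) ?T1 (hypertree_measure m l) ?T1' ?T"
      by (rule cond_indep)
    show "AE w in measure_pmf C. ?T w =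
        Cone (Suc m) (?T1' w \<union> ?Y1' w) \<union> complex_diff m k (?T1 w) (?Y1 w)"
      using decomposition by (simp add: AE_measure_pmf_iff)
  qed
qed

end
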